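(* Fix $\epsilon>0$. Let $p=p(n)\in(0,1)$ with $p=o(n^{-2/3})$, let $\mu=\binom n3p^3$, and let $k=k(n)$ be an integer satisfying $0\le k\le(1-\epsilon)\mu$. Then, as $n\to\infty$: 1. (Closeness to uniform) If $p=o(n^{-4/5})$, then $\|\nu_{p,k}^{\mathrm{tilt}}-\nu_k^{\mathrm{unif}}\|_{\mathrm{TV}}=o(1)$. 2. (Far from uniform) If $n^{-4/5}\ll p\ll n^{-3/4}$ and $k=\Theta(\mu)$, then $\|\nu_{p,k}^{\mathrm{tilt}}-\nu_k^{\mathrm{unif}}\|_{\mathrm{TV}}=1-o(1)$. 3. (Closeness to tilted) If $p=o(n^{-3/4})$, then $\|\nu_{p,k,\mathrm{elem}}^{\mathrm{tilt}}-\nu_{p,k}^{\mathrm{tilt}}\|_{\mathrm{TV}}=o(1)$. 4. (Far from tilted) If $p=n^{-\alpha}$ for some (fixed) $\frac23<\alpha<\frac34$ and $k=\Theta(\mu)$, then $\|\nu_{p,k,\mathrm{elem}}^{\mathrm{tilt}}-\nu_{p,k}^{\mathrm{tilt}}\|_{\mathrm{TV}}=1-o(1)$.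
   Context: Let $V$ be a vertex set with $|V|=n$. For a graph $G$ on $V$, $\mathrm{Tri}(G):=\{T\in\binom V3: G[T]\cong K_3\}$. For $F\subseteq\binom V3$, $G_F$ is the graph on $V$ whose edge set is the union of the edges (pairs) covered by triples in $F$, and $e(G_F)$ is its number of edges. A triangle configuration is a set $F\subseteq\binom V3$ with $\mathrm{Tri}(G_F)=F$; $\mathcal F_k$ is the set of all triangle configurations on $V$ with exactly $k$ triangles. $\nu_k^{\mathrm{unif}}$ is the uniform distribution on $\mathcal F_k$. $\nu_{p,k}^{\mathrm{tilt}}$ is the probability distribution on $\mathcal F_k$ with $\nu_{p,k}^{\mathrm{tilt}}(F)\propto \nu_k^{\mathrm{unif}}(F)\,p^{e(G_F)}$. Two triangles are edge-adjacent if they share exactly one edge; the edge-connected components of $F$ are the connected components of the graph whose vertices are the triangles of $F$ with adjacency being edge-adjacency. A configuration $F$ is elementary if each of its edge-connected components is one of: an isolated triangle; a diamond (two triangles sharing an edge); a piglet (three triangles $T_1,T_2,T_3$ such that $T_1,T_2$ share an edge, $T_2,T_3$ share an edge, and $T_1,T_3$ do not share an edge); a 3-book (three triangles sharing a common edge). $\mathcal F_{k,\mathrm{elem}}$ is the set of elementary $F\in\mathcal F_k$, and $\nu_{p,k,\mathrm{elem}}^{\mathrm{tilt}}:=\nu_{p,k}^{\mathrm{tilt}}(\,\cdot\mid F\in\mathcal F_{k,\mathrm{elem}})$. For probability measures $P,P'$ on a common countable space, $\|P-P'\|_{\mathrm{TV}}=\frac12\sum_x|P(x)-P'(x)|$.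 The notation $f\ll g$ means $f=o(g)$ as $n\to\infty$. *)

theory Defs
  imports "HOL-Probability.Probability" "HOL-Library.Landau_Symbols"
begin

(* A graph on V is given by its edge set, a set of 2-element subsets of V. *)

definition pairs :: "'a set \<Rightarrow> 'a set set" where
  "pairs X = {e. e \<subseteq> X \<and> card e = 2}"

definition triples :: "'a set \<Rightarrow> 'a set set" where
  "triples X = {T. T \<subseteq> X \<and> card T = 3}"

definition induced_edges :: "'a set set \<Rightarrow> 'a set \<Rightarrow> 'a set set" where
  "induced_edges E X = {e \<in> E. e \<subseteq> X}"

(* The graph induced on a 3-element set T is a K_3 iff its edges are all pairs in T. *)
definition Tri :: "'a set \<Rightarrow> 'a set set \<Rightarrow> 'a set set" where
  "Tri V E = {T \<in> triples V. induced_edges E T = pairs T}"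

(* The edge set of the graph G_F. *)
definition covered_edges :: "'a set set \<Rightarrow> 'a set set" where
  "covered_edges F = (\<Union>T\<in>F. pairs T)"

definition triangle_configuration :: "'a set \<Rightarrow> 'a set set \<Rightarrow> bool" where
  "triangle_configuration V F \<longleftrightarrow> F \<subseteq> triples V \<and> Tri V (covered_edges F) = F"

definition configs :: "'a set \<Rightarrow> nat \<Rightarrow> 'a set set set" where
  "configs V k = {F. triangle_configuration V F \<and> card F = k}"

definition edge_adjacent :: "'a set \<Rightarrow> 'a set \<Rightarrow> bool" where
  "edge_adjacent S T \<longleftrightarrow> card (pairs S \<inter> pairs T) = 1"

definition edge_adjacency :: "'a set set \<Rightarrow> ('a set \<times> 'a set) set" where
  "edge_adjacency F = {(S, T). S \<in> F \<and> T \<in> F \<and> edge_adjacent S T}"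

(* Classes of F under reachability; paths starting in F stay in F. *)
definition edge_components :: "'a set set \<Rightarrow> 'a set set set" where
  "edge_components F = F // (edge_adjacency F)\<^sup>*"

definition share_edge :: "'a set \<Rightarrow> 'a set \<Rightarrow> bool" where
  "share_edge S T \<longleftrightarrow> pairs S \<inter> pairs T \<noteq> {}"

(* The following four predicates are meant for sets C of 3-element sets. *)

definition isolated_triangle :: "'a set set \<Rightarrow> bool" where
  "isolated_triangle C \<longleftrightarrow> (\<exists>T. C = {T})"

definition diamond :: "'a set set \<Rightarrow> bool" where
  "diamond C \<longleftrightarrow> (\<exists>T1 T2. distinct [T1, T2] \<and> C = {T1, T2} \<and> share_edge T1 T2)"

definition piglet :: "'a set set \<Rightarrow> bool" where
  "piglet C \<longleftrightarrow> (\<exists>T1 T2 T3. distinct [T1, T2, T3] \<and> C = {T1, T2, T3} \<and>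
     share_edge T1 T2 \<and> share_edge T2 T3 \<and> \<not> share_edge T1 T3)"

definition three_book :: "'a set set \<Rightarrow> bool" where
  "three_book C \<longleftrightarrow> (\<exists>T1 T2 T3. distinct [T1, T2, T3] \<and> C = {T1, T2, T3} \<and>
     pairs T1 \<inter> pairs T2 \<inter> pairs T3 \<noteq> {})"

definition elementary :: "'a set set \<Rightarrow> bool" where
  "elementary F \<longleftrightarrow> (\<forall>C \<in> edge_components F.
     isolated_triangle C \<or> diamond C \<or> piglet C \<or> three_book C)"

definition elem_configs :: "'a set \<Rightarrow> nat \<Rightarrow> 'a set set set" where
  "elem_configs V k = {F \<in> configs V k. elementary F}"

(* The three distributions are only specified when V is finite and the set of
   configurations in question is nonempty; lemma pmf_nu_tilt below gives the
   point masses of nu_tilt in that case. *)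

definition nu_unif :: "'a set \<Rightarrow> nat \<Rightarrow> 'a set set pmf" where
  "nu_unif V k = pmf_of_set (configs V k)"

definition tilt_weight :: "'a set \<Rightarrow> real \<Rightarrow> nat \<Rightarrow> 'a set set \<Rightarrow> real" where
  "tilt_weight V p k F = pmf (nu_unif V k) F * p ^ card (covered_edges F)"

definition nu_tilt :: "'a set \<Rightarrow> real \<Rightarrow> nat \<Rightarrow> 'a set set pmf" where
  "nu_tilt V p k =
     embed_pmf (\<lambda>F. tilt_weight V p k F / (\<Sum>F'\<in>configs V k. tilt_weight V p k F'))"

definition nu_tilt_elem :: "'a set \<Rightarrow> real \<Rightarrow> nat \<Rightarrow> 'a set set pmf" where
  "nu_tilt_elem V p k = cond_pmf (nu_tilt V p k) (elem_configs V k)"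

definition tv_dist :: "'b pmf \<Rightarrow> 'b pmf \<Rightarrow> real" where
  "tv_dist P Q = 1 / 2 * (\<Sum>\<^sub>\<infinity>x. \<bar>pmf P x - pmf Q x\<bar>)"

lemma finite_configs:
  assumes "finite V"
  shows "finite (configs V k)"
proof -
  have "configs V k \<subseteq> Pow (Pow V)"
    by (auto simp: configs_def triangle_configuration_def triples_def)
  then show ?thesis
    using assms by (meson finite_Pow_iff finite_subset)
qed

lemma pmf_nu_tilt:
  assumes V: "finite V" and ne: "configs V k \<noteq> {}" and p: "0 < p"
  shows "pmf (nu_tilt V p k) F =
    tilt_weight V p k F / (\<Sum>F'\<in>configs V k. tilt_weight V p k F')"
proof -
  let ?A = "configs V k" and ?w = "tilt_weight V p k"
  let ?Z = "\<Sum>F'\<in>?A. ?w F'"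
  have fin: "finite ?A" using V by (rule finite_configs)
  have nonneg: "0 \<le> ?w G" for G
    using p by (simp add: tilt_weight_def)
  have pos: "0 < ?w G" if "G \<in> ?A" for G
    using p that fin ne by (auto simp: tilt_weight_def nu_unif_def card_gt_0_iff)
  have zero: "?w G = 0" if "G \<notin> ?A" for G
    using that fin ne by (simp add: tilt_weight_def nu_unif_def)
  have Z: "0 < ?Z" using fin ne pos by (intro sum_pos) auto
  have "(\<integral>\<^sup>+G. ennreal (?w G / ?Z) \<partial>count_space UNIV) = (\<Sum>G\<in>?A. ennreal (?w G / ?Z))"
    using fin zero by (intro nn_integral_count_space'[where A = ?A]) auto
  also have "\<dots> = ennreal (\<Sum>G\<in>?A. ?w G / ?Z)"
    using nonneg Z by (intro sum_ennreal) auto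
  also have "(\<Sum>G\<in>?A. ?w G / ?Z) = 1"
    using Z by (simp flip: sum_divide_distrib)
  finally show ?thesis
    unfolding nu_tilt_def using nonneg Z by (subst pmf_embed_pmf) (auto intro: divide_nonneg_pos)
qed

end

theory Submission
  imports Defs
begin

text \<open>
  Let \<open>e F\<close> be the number of covered edges of a configuration \<open>F\<close>, and let \<open>W k\<close> be the sum of \<open>p ^ e F\<close>
  over the configurations with \<open>k\<close> triangles, so that the tilted measure gives \<open>F\<close> the mass
  \<open>p ^ e F / W k\<close>. All four claims compare \<open>W k\<close> with the part of it that comes from special
  configurations. Since \<open>p = o(n powr (-2/3))\<close>, the number \<open>k \<le> \<mu>\<close> of triangles is \<open>o(n)\<close>.

  Adding and removing triangles. An edge-disjoint triangle that closes no further triangle can be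
  added to a configuration in \<open>(1 - o(1)) * (n choose 3)\<close> ways, and a configuration with \<open>k\<close> triangles
  arises at most \<open>k\<close> times like this. Hence \<open>W (k - 1) \<le> W k\<close> as soon as \<open>k \<le> (1 - \<epsilon>) * \<mu>\<close>, and this is
  where \<open>\<epsilon>\<close> enters (\<open>weight_sum_drop_triangles\<close>). On the other hand, if \<open>F\<close> has an edge-connected
  component \<open>C\<close> of an unwanted kind, then \<open>F - C\<close> is a configuration and \<open>e F = e C + e (F - C)\<close>. So
  the tilted probability of an unwanted component is at most the sum of \<open>p ^ e C\<close> over all unwanted
  edge-connected configurations \<open>C\<close> with at most \<open>k\<close> triangles (\<open>weight_with_cluster\<close>).

  Bounding the sum over \<open>C\<close>. The components can be large, but they can be explored triangle by
  triangle across known edges. A triangle that reaches a new vertex brings two new edges and a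
  factor \<open>n * p^2\<close>; one that stays inside the at most \<open>3 * k\<close> vertices already seen brings a new edge
  and a factor \<open>3 * k * p\<close>. If both factors are small, the sum over everything that can be grown from an
  edge set \<open>E\<close> is at most \<open>(2 * p) ^ card E\<close> (\<open>sum_explored\<close>). The second factor is \<open>O(n^3 * p^4)\<close>, which
  is the reason for the threshold \<open>n powr (-3/4)\<close>. It remains to count starting sets \<open>E\<close>: a component
  with two triangles contains a diamond, which contributes \<open>n^4 * p^5\<close>, and a non-elementary one
  contains an edge set with 4, 5 or 6 vertices and at least 6, 8 or 9 edges (\<open>nonelementary_seed\<close>),
  which contributes \<open>n^4 * p^6\<close>, \<open>n^5 * p^8\<close> or \<open>n^6 * p^9\<close>. This gives the two closeness claims: for
  \<open>p = o(n powr (-4/5))\<close> almost all of either measure sits on edge-disjoint configurations, where both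
  are constant.

  Far from uniform. The same argument with weight 1 in place of \<open>p ^ e F\<close> shows that a uniform
  configuration is edge-disjoint up to probability \<open>O(n^4 * p^6)\<close>. But joining an isolated vertex to the
  two ends of an edge turns edge-disjoint configurations into configurations with a single diamond,
  which use one edge less. Counting them shows that the tilted probability of being edge-disjoint is
  \<open>O(1 / (n^4 * p^5))\<close> (\<open>weight_packings\<close>).

  Far from tilted. Elementary components have at most three triangles, so their total weight is
  \<open>O(\<mu>)\<close> and the elementary configurations together weigh at most \<open>exp (O(\<mu>))\<close>
  (\<open>weight_elementary\<close>). They are outweighed by fans: join one vertex to all of two disjoint sets of
  size \<open>s = K * n powr (3/2) * p\<close> and choose any \<open>k\<close> pairs between these sets. Such fans weigh at
  least \<open>(s^2 * p / k) ^ k * p ^ (2 * s)\<close>, where the first factor is at least \<open>K ^ (2 * k)\<close> and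
  \<open>s * ln n = o(k)\<close> precisely because \<open>\<alpha> < 3/4\<close>. A large constant \<open>K\<close> then beats \<open>exp (O(\<mu>))\<close>.
\<close>

section \<open>Triples, configurations and covered edges\<close>

lemma in_pairs: "{a, b} \<in> pairs X \<longleftrightarrow> a \<in> X \<and> b \<in> X \<and> a \<noteq> b"
  by (auto simp: pairs_def card_2_iff card_insert_if)

lemma pairs_triple:
  assumes "a \<noteq> b" "a \<noteq> c" "b \<noteq> c"
  shows "pairs {a, b, c} = {{a, b}, {a, c}, {b, c}}"
proof
  show "pairs {a, b, c} \<subseteq> {{a, b}, {a, c}, {b, c}}"
    unfolding pairs_def card_2_iff by fastforce
  show "{{a, b}, {a, c}, {b, c}} \<subseteq> pairs {a, b, c}"
    using assms by (auto simp: in_pairs)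
qed

lemma finite_pairs: "finite X \<Longrightarrow> finite (pairs X)"
  by (simp add: pairs_def)

lemma card_pairs: "finite X \<Longrightarrow> card (pairs X) = card X choose 2"
  by (simp add: pairs_def n_subsets)

lemma card_pairs_triple: "card T = 3 \<Longrightarrow> card (pairs T) = 3"
  using card_pairs[of T] by (simp add: card_ge_0_finite choose_two)

lemma Union_pairs_triple: "card T = 3 \<Longrightarrow> \<Union>(pairs T) = T"
  by (auto simp: card_3_iff pairs_triple)

lemma triples_card: "T \<in> triples V \<Longrightarrow> card T = 3"
  by (simp add: triples_def)

lemma triple_through_pair:
  assumes "card T = 3" "{a, b} \<in> pairs T"
  obtains x where "T = {a, b, x}" "x \<noteq> a" "x \<noteq> b" "a \<noteq> b"
proof -
  have ab: "a \<in> T" "b \<in> T" "a \<noteq> b" using assms(2) by (auto simp: in_pairs)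
  have "card (T - {a, b}) = 1"
    using ab assms(1) by (subst card_Diff_subset) auto
  then obtain x where "T - {a, b} = {x}" by (auto simp: card_1_singleton_iff)
  then have "T = {a, b, x}" "x \<noteq> a" "x \<noteq> b" using ab by auto
  then show ?thesis using that ab by blast
qed

text \<open>
  Two different pairs inside a triple already have all three points as their union.
\<close>

lemma triple_eqI:
  assumes "card S = 3" "card T = 3" "e \<in> pairs S \<inter> pairs T" "f \<in> pairs S \<inter> pairs T" "e \<noteq> f"
  shows "S = T"
proof -
  have f: "finite S" "finite T" using assms by (auto intro: card_ge_0_finite)
  have "card (e \<union> f) > 2"
  proof (rule ccontr)
    assume "\<not> card (e \<union> f) > 2"
    moreover have "card e = 2" "card f = 2" "finite e" "finite f"
      using assms by (auto simp: pairs_def intro: card_ge_0_finite)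
    ultimately show False using assms(5)
      by (metis Un_upper1 Un_upper2 card_seteq finite_UnI linorder_not_less)
  qed
  moreover have "e \<union> f \<subseteq> S" "e \<union> f \<subseteq> T" using assms by (auto simp: pairs_def)
  ultimately show ?thesis
    using f assms by (metis card_seteq Suc_leI eval_nat_numeral(3))
qed

lemma edge_adjacent_iff:
  assumes "card S = 3" "card T = 3"
  shows "edge_adjacent S T \<longleftrightarrow> S \<noteq> T \<and> share_edge S T"
proof
  assume "edge_adjacent S T"
  then show "S \<noteq> T \<and> share_edge S T"
    using card_pairs_triple[OF assms(1)] by (auto simp: edge_adjacent_def share_edge_def)
next
  assume r: "S \<noteq> T \<and> share_edge S T"
  then obtain e where e: "e \<in> pairs S \<inter> pairs T" by (auto simp: share_edge_def)
  have "pairs S \<inter> pairs T = {e}" using e r triple_eqI[OF assms] by blast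
  then show "edge_adjacent S T" by (simp add: edge_adjacent_def)
qed

lemma share_edge_commute: "share_edge S T \<longleftrightarrow> share_edge T S"
  by (auto simp: share_edge_def)

lemma config_iff:
  "triangle_configuration V F \<longleftrightarrow>
     F \<subseteq> triples V \<and> (\<forall>T \<in> triples V. pairs T \<subseteq> covered_edges F \<longrightarrow> T \<in> F)"
proof -
  have "induced_edges (covered_edges F) T = pairs T \<longleftrightarrow> pairs T \<subseteq> covered_edges F" for T
  proof -
    have "induced_edges (covered_edges F) T = covered_edges F \<inter> pairs T"
      by (auto simp: induced_edges_def covered_edges_def pairs_def)
    then show ?thesis by blast
  qed
  then show ?thesis
    by (auto simp: triangle_configuration_def Tri_def covered_edges_def)
qed

lemma configsD:
  assumes "F \<in> configs V k"
  shows "F \<subseteq> triples V" "card F = k"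
    "\<And>T. T \<in> triples V \<Longrightarrow> pairs T \<subseteq> covered_edges F \<Longrightarrow> T \<in> F"
  using assms by (auto simp: configs_def config_iff)

lemma configsI:
  assumes "F \<subseteq> triples V" "card F = k"
    "\<And>T. T \<in> triples V \<Longrightarrow> pairs T \<subseteq> covered_edges F \<Longrightarrow> T \<in> F"
  shows "F \<in> configs V k"
  using assms by (auto simp: configs_def config_iff)

lemma finite_triples: "finite V \<Longrightarrow> finite (triples V)"
  by (simp add: triples_def)

lemma card_triples: "finite V \<Longrightarrow> card (triples V) = card V choose 3"
  by (simp add: triples_def n_subsets)

lemma covered_edges_Un: "covered_edges (F \<union> G) = covered_edges F \<union> covered_edges G"
  by (auto simp: covered_edges_def)

lemma covered_edges_insert: "covered_edges (insert T F) = pairs T \<union> covered_edges F"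
  by (auto simp: covered_edges_def)

lemma covered_edges_subset: "F \<subseteq> triples V \<Longrightarrow> covered_edges F \<subseteq> pairs V"
  by (auto simp: covered_edges_def triples_def pairs_def)

lemma Union_covered_edges:
  assumes "C \<subseteq> triples V" shows "\<Union>(covered_edges C) = \<Union>C"
proof -
  have "\<Union>(pairs T) = T" if "T \<in> C" for T
    using that assms by (intro Union_pairs_triple) (auto simp: triples_def)
  then show ?thesis unfolding covered_edges_def by blast
qed

lemma finite_covered: "finite V \<Longrightarrow> F \<subseteq> triples V \<Longrightarrow> finite (covered_edges F)"
  by (meson covered_edges_subset finite_pairs finite_subset)

lemma card_covered_edges_le:
  assumes "finite F" "F \<subseteq> triples V"
  shows "card (covered_edges F) \<le> 3 * card F"
proof -
  have "card (\<Union>T\<in>F. pairs T) \<le> (\<Sum>T\<in>F. card (pairs T))"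
    by (rule card_UN_le[OF assms(1)])
  also have "\<dots> = (\<Sum>T\<in>F. 3)"
    by (rule sum.cong) (use assms(2) card_pairs_triple triples_card in auto)
  finally show ?thesis by (simp add: covered_edges_def)
qed

text \<open>
  The union bound for weights: the sets \<open>A i\<close> may overlap, so a point can be paid for several times.
\<close>

lemma sum_le_sum_cover:
  fixes f :: "'b \<Rightarrow> real"
  assumes "finite I" "\<And>i. i \<in> I \<Longrightarrow> finite (A i)" "S \<subseteq> (\<Union>i\<in>I. A i)" "\<And>x. 0 \<le> f x"
  shows "sum f S \<le> (\<Sum>i\<in>I. sum f (A i))"
  using assms(1-3)
proof (induction I arbitrary: S rule: finite_induct)
  case empty
  then show ?case by simp
next
  case (insert i I)
  have fin: "finite S" using insert.prems insert.hyps by (meson finite.insertI finite_UN finite_subset)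
  have "sum f S = sum f (S \<inter> A i) + sum f (S - A i)"
    using fin by (metis sum.Int_Diff)
  also have "sum f (S \<inter> A i) \<le> sum f (A i)"
    using insert.prems assms(4) by (intro sum_mono2) auto
  also have "sum f (S - A i) \<le> (\<Sum>i\<in>I. sum f (A i))"
    using insert.prems by (intro insert.IH) auto
  finally show ?case using insert.hyps by simp
qed

section \<open>Exploring edge-connected graphs\<close>

text \<open>
  Connectedness in terms of closed sets of triangles; unlike paths, closed sets transfer directly to
  closed sets of edges, which is what the exploration below handles.
\<close>

definition edge_connected :: "'a set set \<Rightarrow> bool" where
  "edge_connected C \<longleftrightarrow> (\<forall>X \<subseteq> C. X \<noteq> {} \<and> (\<forall>S \<in> X. \<forall>T \<in> C. share_edge S T \<longrightarrow> T \<in> X) \<longrightarrow> X = C)"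

definition triangle_closed :: "'a set \<Rightarrow> 'a set set \<Rightarrow> 'a set set \<Rightarrow> bool" where
  "triangle_closed V H D \<longleftrightarrow>
     (\<forall>T \<in> triples V. pairs T \<subseteq> H \<and> pairs T \<inter> D \<noteq> {} \<longrightarrow> pairs T \<subseteq> D)"

text \<open>
  The possible outcomes \<open>H\<close> of a partial exploration with known edges \<open>E\<close> and queue \<open>Q\<close>: the known edges
  outside the queue have been processed, that is, every triangle of \<open>H\<close> through such an edge is already
  known, and all of \<open>H\<close> can be reached from \<open>E\<close> by passing from an edge of a triangle to its other edges.
\<close>

definition explored :: "'a set \<Rightarrow> nat \<Rightarrow> 'a set set \<Rightarrow> 'a set set \<Rightarrow> 'a set set set" where
  "explored V M E Q = {H. E \<subseteq> H \<and> H \<subseteq> pairs V \<and> card (\<Union>H) \<le> M \<and>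
     (\<forall>T \<in> triples V. pairs T \<subseteq> H \<and> pairs T \<inter> (E - Q) \<noteq> {} \<longrightarrow> pairs T \<subseteq> E) \<and>
     (\<forall>D. E \<subseteq> D \<and> D \<subseteq> H \<and> triangle_closed V H D \<longrightarrow> D = H)}"

lemma exploredI:
  assumes "E \<subseteq> H" "H \<subseteq> pairs V" "card (\<Union>H) \<le> M"
    "\<And>T. T \<in> triples V \<Longrightarrow> pairs T \<subseteq> H \<Longrightarrow> pairs T \<inter> (E - Q) \<noteq> {} \<Longrightarrow> pairs T \<subseteq> E"
    "\<And>D. E \<subseteq> D \<Longrightarrow> D \<subseteq> H \<Longrightarrow> triangle_closed V H D \<Longrightarrow> D = H"
  shows "H \<in> explored V M E Q"
proof -
  have "\<forall>T \<in> triples V. pairs T \<subseteq> H \<and> pairs T \<inter> (E - Q) \<noteq> {} \<longrightarrow> pairs T \<subseteq> E"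
    using assms(4) by (intro ballI impI) (elim conjE)
  moreover have "\<forall>D. E \<subseteq> D \<and> D \<subseteq> H \<and> triangle_closed V H D \<longrightarrow> D = H"
    using assms(5) by (intro allI impI) (elim conjE)
  ultimately show ?thesis unfolding explored_def using assms(1-3) by (intro CollectI conjI)
qed

lemma exploredD:
  assumes "H \<in> explored V M E Q"
  shows "E \<subseteq> H" "H \<subseteq> pairs V" "card (\<Union>H) \<le> M"
    "\<And>T. T \<in> triples V \<Longrightarrow> pairs T \<subseteq> H \<Longrightarrow> pairs T \<inter> (E - Q) \<noteq> {} \<Longrightarrow> pairs T \<subseteq> E"
    "\<And>D. E \<subseteq> D \<Longrightarrow> D \<subseteq> H \<Longrightarrow> triangle_closed V H D \<Longrightarrow> D = H"
  using assms by (simp_all add: explored_def)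

lemma finite_explored: "finite V \<Longrightarrow> finite (explored V M E Q)"
  by (rule finite_subset[of _ "Pow (pairs V)"]) (auto simp: explored_def finite_pairs)

text \<open>
  If removing \<open>{a, b}\<close> from the queue is not justified, some triangle \<open>{a, b, x}\<close> of \<open>H\<close> has an unknown
  edge; its new edges join both the known edges and the queue.
\<close>

lemma explored_step:
  assumes q: "{a, b} \<in> Q" "Q \<subseteq> E" "a \<noteq> b"
    and H: "H \<in> explored V M E Q"
    and nH: "H \<notin> explored V M E (Q - {{a, b}})"
  obtains x where "x \<in> V" "x \<noteq> a" "x \<noteq> b" "\<not> {{a, x}, {b, x}} \<subseteq> E"
    "H \<in> explored V M (E \<union> {{a, x}, {b, x}}) (Q \<union> ({{a, x}, {b, x}} - E))"
proof -
  note HD = exploredD[OF H]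
  have "\<exists>T. T \<in> triples V \<and> pairs T \<subseteq> H \<and> pairs T \<inter> (E - (Q - {{a, b}})) \<noteq> {} \<and>
    \<not> pairs T \<subseteq> E"
  proof (rule ccontr)
    assume no: "\<not> ?thesis"
    have "pairs T \<subseteq> E"
      if "T \<in> triples V" "pairs T \<subseteq> H" "pairs T \<inter> (E - (Q - {{a, b}})) \<noteq> {}" for T
      using that no by blast
    then have "H \<in> explored V M E (Q - {{a, b}})"
      using HD(1-3) HD(5) unfolding explored_def by simp
    then show False using nH by simp
  qed
  then obtain T where T: "T \<in> triples V" "pairs T \<subseteq> H" "pairs T \<inter> (E - (Q - {{a, b}})) \<noteq> {}"
    "\<not> pairs T \<subseteq> E"
    by blast
  then have ab: "{a, b} \<in> pairs T" using HD(4)[of T] by blast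
  obtain x where x: "T = {a, b, x}" "x \<noteq> a" "x \<noteq> b"
    using triple_through_pair[OF triples_card[OF T(1)] ab] by metis
  have pT: "pairs T = {{a, b}, {a, x}, {b, x}}" using x q by (simp add: pairs_triple)
  let ?D = "{{a, x}, {b, x}}"
  have "H \<in> explored V M (E \<union> ?D) (Q \<union> (?D - E))"
  proof (rule exploredI)
    show "E \<union> ?D \<subseteq> H" using HD(1) T(2) pT by auto
    show "\<And>S. S \<in> triples V \<Longrightarrow> pairs S \<subseteq> H \<Longrightarrow>
        pairs S \<inter> (E \<union> ?D - (Q \<union> (?D - E))) \<noteq> {} \<Longrightarrow> pairs S \<subseteq> E \<union> ?D"
      using HD(4) by blast
    show "\<And>D. E \<union> ?D \<subseteq> D \<Longrightarrow> D \<subseteq> H \<Longrightarrow>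
        triangle_closed V H D \<Longrightarrow> D = H"
      using HD(5) by simp
  qed (use HD in auto)
  moreover have "x \<in> V" using T(1) x by (auto simp: triples_def)
  moreover have "\<not> ?D \<subseteq> E" using T(4) pT q by auto
  ultimately show ?thesis using that x by blast
qed

lemma explored_no_queue:
  assumes "H \<in> explored V M E {}"
  shows "H = E"
proof -
  have "triangle_closed V H E"
    unfolding triangle_closed_def using exploredD(4)[OF assms] by (metis Diff_empty)
  then show ?thesis using exploredD(1)[OF assms] exploredD(5)[OF assms, of E] by simp
qed

text \<open>
  Process one queue edge \<open>{a, b}\<close> at a time. Either no triangle through it is left, and the queue loses
  an edge, which halves the bound; or a triangle \<open>{a, b, x}\<close> with one or two new edges is found. In the
  second case a known \<open>x\<close> (at most \<open>M\<close> choices) costs at most \<open>4 * p\<close>, since each new edge costs \<open>p\<close> and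
  doubles the bound by lengthening the queue. An unknown \<open>x\<close> (at most \<open>card V\<close> choices) makes both edges
  new and costs \<open>4 * p^2\<close>. The smallness assumption says that these costs fill the other half.
\<close>

lemma sum_explored:
  fixes p :: real
  assumes V: "finite V" and p: "0 \<le> p" "p \<le> 1"
    and small: "real (card V) * p^2 + real M * p \<le> 1 / 8"
    and EQ: "E \<subseteq> pairs V" "Q \<subseteq> E"
  shows "(\<Sum>H\<in>explored V M E Q. p ^ card (H - E)) \<le> 2 ^ card Q"
  using EQ
proof (induction "2 * card (pairs V - E) + card Q" arbitrary: E Q rule: less_induct)
  case less
  note E = less.prems(1) and Q = less.prems(2)
  have finE: "finite E" and finQ: "finite Q"
    using E Q finite_pairs[OF V] by (auto intro: finite_subset)
  show ?case
  proof (cases "Q = {}")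
    case True
    have "(\<Sum>H\<in>explored V M E {}. p ^ card (H - E)) \<le> (\<Sum>H\<in>{E}. p ^ card (H - E))"
      using explored_no_queue p by (intro sum_mono2) auto
    then show ?thesis using True by simp
  next
    case False
    then obtain q where q: "q \<in> Q" by blast
    have "card q = 2" using q Q E by (auto simp: pairs_def)
    then obtain a b where ab: "q = {a, b}" "a \<noteq> b" by (auto simp: card_2_iff)
    define D where "D x = {{a, x}, {b, x}} - E" for x
    define A where "A x = explored V M (E \<union> D x) (Q \<union> D x)" for x
    define X where "X = {x \<in> V - {a, b}. D x \<noteq> {}}"
    define f where "f = (\<lambda>H. p ^ card (H - E))"
    have fpos: "0 \<le> f H" for H using p by (simp add: f_def)
    have finX: "finite X" using V by (simp add: X_def)
    \<comment> \<open>Exploring the queue edge \<open>q\<close>: nothing is left to find, or some \<open>x\<close> closes a new triangle.\<close>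
    have cover: "explored V M E Q \<subseteq> explored V M E (Q - {q}) \<union> (\<Union>x\<in>X. A x)"
    proof
      fix H assume H: "H \<in> explored V M E Q"
      show "H \<in> explored V M E (Q - {q}) \<union> (\<Union>x\<in>X. A x)"
      proof (cases "H \<in> explored V M E (Q - {q})")
        case False
        obtain x where x: "x \<in> V" "x \<noteq> a" "x \<noteq> b" "\<not> {{a, x}, {b, x}} \<subseteq> E"
          "H \<in> explored V M (E \<union> {{a, x}, {b, x}}) (Q \<union> ({{a, x}, {b, x}} - E))"
          using explored_step[of a b Q E H V M] q Q ab H False by metis
        have "E \<union> {{a, x}, {b, x}} = E \<union> D x" by (auto simp: D_def)
        then have "H \<in> A x" "x \<in> X" using x by (auto simp: A_def D_def X_def)
        then show ?thesis by blast
      qed auto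
    qed
    have fin: "finite (A x)" for x by (simp add: A_def V finite_explored)
    have "sum f (explored V M E Q) \<le> sum f (explored V M E (Q - {q}) \<union> (\<Union>x\<in>X. A x))"
      using cover fpos V finX fin by (intro sum_mono2) (auto simp: finite_explored)
    also have "\<dots> \<le> sum f (explored V M E (Q - {q})) + sum f (\<Union>x\<in>X. A x)"
      using fpos V finX fin finite_explored[OF V]
      by (subst sum.union_inter[symmetric]) (auto intro: sum_nonneg)
    also have "sum f (\<Union>x\<in>X. A x) \<le> (\<Sum>x\<in>X. sum f (A x))"
      by (rule sum_le_sum_cover) (use finX fin fpos in auto)
    finally have main: "sum f (explored V M E Q) \<le>
        sum f (explored V M E (Q - {q})) + (\<Sum>x\<in>X. sum f (A x))" by simp
    have drop: "sum f (explored V M E (Q - {q})) \<le> 2 ^ card Q / 2"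
    proof -
      have c: "card Q = Suc (card (Q - {q}))" using q finQ by (metis card.remove)
      have "sum f (explored V M E (Q - {q})) \<le> 2 ^ card (Q - {q})"
        unfolding f_def using Q E c by (intro less.hyps) auto
      then show ?thesis using c by simp
    qed
    have Ax: "sum f (A x) \<le> p ^ card (D x) * 2 ^ (card Q + card (D x))" if x: "x \<in> X" for x
    proof -
      have xV: "x \<in> V" "x \<noteq> a" "x \<noteq> b" "D x \<noteq> {}" using x by (auto simp: X_def)
      have abV: "a \<in> V" "b \<in> V" using q Q E ab by (auto simp: pairs_def)
      have DV: "D x \<subseteq> pairs V" using xV abV by (auto simp: D_def in_pairs)
      have DE: "D x \<inter> E = {}" by (auto simp: D_def)
      have finD: "finite (D x)" by (simp add: D_def)
      have cD: "card (D x) > 0" using finD xV by (simp add: card_gt_0_iff)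
      have cQ: "card (Q \<union> D x) = card Q + card (D x)"
        using finQ finD DE Q by (intro card_Un_disjoint) auto
      have cE: "card (pairs V - E) = card (pairs V - (E \<union> D x)) + card (D x)"
      proof -
        have "pairs V - E = (pairs V - (E \<union> D x)) \<union> D x" using DV DE by auto
        also have "card \<dots> = card (pairs V - (E \<union> D x)) + card (D x)"
          using finite_pairs[OF V] finD by (intro card_Un_disjoint) auto
        finally show ?thesis .
      qed
      have "sum f (A x) = (\<Sum>H\<in>A x. p ^ card (D x) * p ^ card (H - (E \<union> D x)))"
      proof (rule sum.cong[OF refl])
        fix H assume "H \<in> A x"
        then have H: "E \<union> D x \<subseteq> H" "H \<subseteq> pairs V"
          unfolding A_def by (auto dest: exploredD(1,2))
        have "H - E = (H - (E \<union> D x)) \<union> D x" using H DE by auto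
        also have "card \<dots> = card (H - (E \<union> D x)) + card (D x)"
          using finite_subset[OF H(2) finite_pairs[OF V]] finD by (intro card_Un_disjoint) auto
        finally have "card (H - E) = card (H - (E \<union> D x)) + card (D x)" .
        then show "f H = p ^ card (D x) * p ^ card (H - (E \<union> D x))"
          by (simp add: f_def power_add mult.commute)
      qed
      also have "\<dots> = p ^ card (D x) * (\<Sum>H\<in>A x. p ^ card (H - (E \<union> D x)))"
        by (simp add: sum_distrib_left)
      also have "\<dots> \<le> p ^ card (D x) * 2 ^ card (Q \<union> D x)"
        unfolding A_def using E DV Q cQ cE cD p
        by (intro mult_left_mono less.hyps) auto
      finally show ?thesis using cQ by simp
    qed
    have cDle: "card (D x) \<le> 2" for x
    proof -
      have "card (D x) \<le> card {{a, x}, {b, x}}" unfolding D_def by (intro card_mono) auto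
      also have "\<dots> \<le> 2" by (simp add: card_insert_if)
      finally show ?thesis .
    qed
    have old: "sum f (A x) \<le> 4 * p * 2 ^ card Q" if x: "x \<in> X" for x
    proof -
      have "card (D x) \<noteq> 0" using x by (auto simp: X_def D_def)
      then consider "card (D x) = 1" | "card (D x) = 2" using cDle[of x] by linarith
      then have "p ^ card (D x) * 2 ^ card (D x) \<le> 4 * p"
      proof cases
        case 2
        have "p * p \<le> 1 * p" using p by (intro mult_right_mono) auto
        then show ?thesis using 2 by (simp add: power2_eq_square)
      qed (use p in auto)
      then have "p ^ card (D x) * 2 ^ card (D x) * 2 ^ card Q \<le> 4 * p * 2 ^ card Q"
        by (intro mult_right_mono) auto
      moreover have "p ^ card (D x) * 2 ^ (card Q + card (D x)) =
          p ^ card (D x) * 2 ^ card (D x) * 2 ^ card Q"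
        by (simp add: power_add)
      ultimately show ?thesis using Ax[OF x] by linarith
    qed
    have new: "sum f (A x) \<le> 4 * p^2 * 2 ^ card Q" if x: "x \<in> X" "x \<notin> \<Union>E" for x
    proof -
      have "D x = {{a, x}, {b, x}}" using x(2) by (auto simp: D_def)
      moreover have "{a, x} \<noteq> {b, x}" using ab(2) x(1) by (auto simp: X_def doubleton_eq_iff)
      ultimately have "card (D x) = 2" by simp
      then show ?thesis using Ax[OF x(1)] by (simp add: power_add mult_ac)
    qed
    have "(\<Sum>x\<in>X. sum f (A x)) \<le> real (card V) * (4 * p^2 * 2 ^ card Q) + real M * (4 * p * 2 ^ card Q)"
    proof (cases "card (\<Union>E) \<le> M")
      case True
      have finU: "finite (\<Union>E)" using E V by (auto simp: pairs_def intro: finite_subset)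
      have "(\<Sum>x\<in>X. sum f (A x)) = (\<Sum>x\<in>X \<inter> \<Union>E. sum f (A x)) + (\<Sum>x\<in>X - \<Union>E. sum f (A x))"
        using finX by (metis sum.Int_Diff)
      also have "(\<Sum>x\<in>X \<inter> \<Union>E. sum f (A x)) \<le> real (card (X \<inter> \<Union>E)) * (4 * p * 2 ^ card Q)"
        by (rule sum_bounded_above) (use old in auto)
      also have "\<dots> \<le> real M * (4 * p * 2 ^ card Q)"
        using True card_mono[of "\<Union>E" "X \<inter> \<Union>E"] finU p by (intro mult_right_mono) auto
      also have "(\<Sum>x\<in>X - \<Union>E. sum f (A x)) \<le> real (card (X - \<Union>E)) * (4 * p^2 * 2 ^ card Q)"
        by (rule sum_bounded_above) (use new in auto)
      also have "\<dots> \<le> real (card V) * (4 * p^2 * 2 ^ card Q)"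
        using card_mono[of V "X - \<Union>E"] V p by (intro mult_right_mono) (auto simp: X_def)
      finally show ?thesis by simp
    next
      case False
      have "A x = {}" for x
      proof (rule ccontr)
        assume "A x \<noteq> {}"
        then obtain H where "H \<in> A x" by blast
        then have H: "E \<union> D x \<subseteq> H" "H \<subseteq> pairs V" "card (\<Union>H) \<le> M"
          unfolding A_def by (auto dest: exploredD(1,2,3))
        have "finite (\<Union>H)" using H(2) V by (auto simp: pairs_def intro: finite_subset)
        then have "card (\<Union>E) \<le> card (\<Union>H)" using H(1) by (intro card_mono) auto
        then show False using H(3) False by simp
      qed
      then show ?thesis using p by simp
    qed
    also have "\<dots> = 4 * 2 ^ card Q * (real (card V) * p^2 + real M * p)"
      by (simp add: algebra_simps)
    also have "\<dots> \<le> 4 * 2 ^ card Q * (1 / 8)"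
      using small by (intro mult_left_mono) auto
    finally show ?thesis using main drop unfolding f_def by simp
  qed
qed

section \<open>Edge-connected components\<close>

definition component :: "'a set set \<Rightarrow> 'a set \<Rightarrow> 'a set set" where
  "component F T = (edge_adjacency F)\<^sup>* `` {T}"

lemma edge_components_eq: "edge_components F = component F ` F"
  by (auto simp: edge_components_def quotient_def component_def)

lemma sym_edge_adjacency: "sym (edge_adjacency F)"
  by (auto simp: edge_adjacency_def edge_adjacent_def sym_def Int_commute)

lemma component_self: "T \<in> component F T"
  by (simp add: component_def)

lemma component_subset:
  assumes "T \<in> F" shows "component F T \<subseteq> F"
proof
  fix S assume "S \<in> component F T"
  then have "(T, S) \<in> (edge_adjacency F)\<^sup>*" by (simp add: component_def)
  then show "S \<in> F" by (cases rule: rtranclE) (use assms in \<open>auto simp: edge_adjacency_def\<close>)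
qed

lemma component_eq:
  assumes "S \<in> component F T" shows "component F S = component F T"
proof -
  have "(T, S) \<in> (edge_adjacency F)\<^sup>*" using assms by (simp add: component_def)
  moreover from this have "(S, T) \<in> (edge_adjacency F)\<^sup>*"
    using sym_edge_adjacency sym_rtrancl by (metis symD)
  ultimately show ?thesis unfolding component_def by (auto intro: rtrancl_trans)
qed

text \<open>
  The components of the adjacency relation are closed under sharing an edge, because distinct triples
  share at most one edge and so adjacency is the same as being distinct and sharing an edge.
\<close>

lemma component_closed:
  assumes F: "F \<subseteq> triples V" and T: "T \<in> F"
    and S: "S \<in> component F T" and R: "R \<in> F" "share_edge S R"
  shows "R \<in> component F T"
proof (cases "S = R")
  case False
  have "S \<in> F" using component_subset[OF T] S by blast
  then have "(S, R) \<in> edge_adjacency F"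
    using False R F edge_adjacent_iff[of S R] by (auto simp: edge_adjacency_def triples_def)
  then show ?thesis using S by (auto simp: component_def intro: rtrancl_into_rtrancl)
qed (use S in simp)

lemma component_edge_disjoint:
  assumes F: "F \<subseteq> triples V" and T: "T \<in> F"
  shows "covered_edges (component F T) \<inter> covered_edges (F - component F T) = {}"
proof -
  have False if "S \<in> component F T" "e \<in> pairs S" "R \<in> F" "R \<notin> component F T" "e \<in> pairs R" for S R e
    using component_closed[OF F T that(1) that(3)] that by (auto simp: share_edge_def)
  then show ?thesis unfolding covered_edges_def by fast
qed

lemma component_edge_connected:
  assumes F: "F \<subseteq> triples V" and T: "T \<in> F"
  shows "edge_connected (component F T)"
  unfolding edge_connected_def
proof (intro allI impI, elim conjE)
  fix X assume X: "X \<subseteq> component F T" "X \<noteq> {}"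
    and cl: "\<forall>S\<in>X. \<forall>R\<in>component F T. share_edge S R \<longrightarrow> R \<in> X"
  obtain S where S: "S \<in> X" using X by blast
  have "R \<in> X" if "(S, R) \<in> (edge_adjacency F)\<^sup>*" for R
    using that
  proof (induction rule: rtrancl_induct)
    case (step y z)
    have "y \<in> component F T" using step.IH X by blast
    moreover have "share_edge y z" "z \<in> F"
      using step.hyps F edge_adjacent_iff[of y z] by (auto simp: edge_adjacency_def triples_def)
    ultimately have "z \<in> component F T" using component_closed[OF F T] by blast
    then show ?case using cl step.IH \<open>share_edge y z\<close> by blast
  qed (use S in simp)
  then have "component F S \<subseteq> X" by (auto simp: component_def)
  moreover have "component F S = component F T" using S X by (intro component_eq) blast
  ultimately show "X = component F T" using X by blast
qed

text \<open>
  Two edge-disjoint parts of a configuration are themselves configurations: a triangle covered by one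
  part belongs to the configuration, and it cannot belong to the other part, whose edges are different.
\<close>

lemma config_split:
  assumes V: "finite V" and F: "F \<in> configs V k" and C: "C \<subseteq> F"
    and dis: "covered_edges C \<inter> covered_edges (F - C) = {}"
  shows "C \<in> configs V (card C)" "F - C \<in> configs V (k - card C)"
    "card (covered_edges F) = card (covered_edges C) + card (covered_edges (F - C))"
    "card C \<le> k"
proof -
  note FD = configsD[OF F]
  have finF: "finite F" using FD(1) V finite_triples finite_subset by blast
  have ne: "pairs T \<noteq> {}" if "T \<in> F" for T
    using card_pairs_triple[of T] that FD(1) by (auto simp: triples_def)
  have cov: "covered_edges F = covered_edges C \<union> covered_edges (F - C)"
    using C by (metis Diff_partition covered_edges_Un)
  have key: "T \<in> A" if A: "A \<union> B = F" "covered_edges A \<inter> covered_edges B = {}"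
    and T: "T \<in> triples V" "pairs T \<subseteq> covered_edges A" for A B T
  proof -
    have "T \<in> F" using T FD(3)[of T] A(1) covered_edges_Un by blast
    moreover have "T \<notin> B"
      using ne[OF \<open>T \<in> F\<close>] T(2) A(2) by (auto simp: covered_edges_def)
    ultimately show ?thesis using A by blast
  qed
  show "C \<in> configs V (card C)"
    using key[of C "F - C"] C dis FD(1) by (intro configsI) auto
  show "F - C \<in> configs V (k - card C)"
    using key[of "F - C" C] C dis FD finF
    by (intro configsI) (auto simp: Int_commute card_Diff_subset finite_subset)
  show "card (covered_edges F) = card (covered_edges C) + card (covered_edges (F - C))"
    unfolding cov using V FD(1) C dis
    by (intro card_Un_disjoint) (auto intro!: finite_covered[of V])
  show "card C \<le> k" using C FD(2) finF card_mono by blast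
qed

section \<open>Adding an edge-disjoint triangle\<close>

text \<open>
  The weight \<open>r\<close> per edge is \<open>p\<close> for the tilted and 1 for the uniform measure.
\<close>

definition weight_sum :: "'a set \<Rightarrow> real \<Rightarrow> nat \<Rightarrow> real" where
  "weight_sum V r k = (\<Sum>F\<in>configs V k. r ^ card (covered_edges F))"

lemma weight_sum_nonneg: "0 \<le> r \<Longrightarrow> 0 \<le> weight_sum V r k"
  by (simp add: weight_sum_def sum_nonneg)

definition addable :: "'a set \<Rightarrow> 'a set set \<Rightarrow> 'a set set" where
  "addable V F = {T \<in> triples V. pairs T \<inter> covered_edges F = {} \<and> insert T F \<in> configs V (Suc (card F))}"

text \<open>
  There are two reasons why a triple \<open>T\<close> is not addable. Either it contains an existing edge, or one of its
  pairs \<open>{a, b}\<close> closes a triangle with existing edges \<open>{a, c}\<close> and \<open>{b, c}\<close>; then \<open>{a, b}\<close> is the symmetric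
  difference of these two edges. In both cases existing edges and one more vertex determine \<open>T\<close>.
\<close>

lemma blocked_triple_cases:
  assumes F: "F \<in> configs V j" and V: "finite V" and T: "T \<in> triples V" "T \<notin> addable V F"
  obtains e x where "e \<in> covered_edges F" "x \<in> V" "T = insert x e"
  | g h x where "g \<in> covered_edges F" "h \<in> covered_edges F" "x \<in> V" "T = insert x ((g - h) \<union> (h - g))"
proof -
  let ?G = "covered_edges F"
  note FD = configsD[OF F]
  have finF: "finite F" using FD(1) V finite_triples finite_subset by blast
  have cT: "card T = 3" "T \<subseteq> V" using T by (auto simp: triples_def)
  show ?thesis
  proof (cases "pairs T \<inter> ?G = {}")
    case False
    then obtain e where e: "e \<in> pairs T" "e \<in> ?G" by blast
    then have "card e = 2" by (simp add: pairs_def)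
    then obtain a b where ab: "e = {a, b}" by (auto simp: card_2_iff)
    obtain x where x: "T = {a, b, x}" using triple_through_pair[OF cT(1)] e ab by metis
    then have "T = insert x e" "x \<in> V" using ab cT by auto
    then show ?thesis using that(1) e by blast
  next
    case True
    have nT: "T \<notin> F"
    proof
      assume "T \<in> F"
      then have "pairs T \<subseteq> covered_edges F" by (auto simp: covered_edges_def)
      then show False using True card_pairs_triple[OF cT(1)] by (auto simp: inf_absorb1)
    qed
    have "insert T F \<notin> configs V (Suc (card F))" using True T by (auto simp: addable_def)
    moreover have "card (insert T F) = Suc (card F)" "insert T F \<subseteq> triples V"
      using nT finF FD(1) T by auto
    ultimately obtain S where S: "S \<in> triples V" "pairs S \<subseteq> covered_edges (insert T F)" "S \<notin> insert T F"
      using configsI[of "insert T F" V] by blast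
    have cS: "card S = 3" "S \<subseteq> V" using S by (auto simp: triples_def)
    have sub: "pairs S \<subseteq> pairs T \<union> ?G" using S by (simp add: covered_edges_insert)
    have "\<not> pairs S \<subseteq> ?G" using FD(3) S by blast
    then obtain e where e: "e \<in> pairs S" "e \<notin> ?G" by blast
    then have eT: "e \<in> pairs T" using sub by blast
    have "card e = 2" using e by (simp add: pairs_def)
    then obtain a b where ab: "e = {a, b}" "a \<noteq> b" by (auto simp: card_2_iff)
    obtain c where c: "S = {a, b, c}" "c \<noteq> a" "c \<noteq> b"
      using triple_through_pair[OF cS(1)] e ab by metis
    obtain x where x: "T = {a, b, x}" "x \<noteq> a" "x \<noteq> b"
      using triple_through_pair[OF cT(1)] eT ab by metis
    have "c \<noteq> x" using c x S by auto
    then have "{a, c} \<notin> pairs T" "{b, c} \<notin> pairs T" using x c by (auto simp: in_pairs)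
    moreover have "{a, c} \<in> pairs S" "{b, c} \<in> pairs S" using c by (auto simp: in_pairs)
    ultimately have g: "{a, c} \<in> ?G" "{b, c} \<in> ?G" using sub by blast+
    have "T = insert x (({a, c} - {b, c}) \<union> ({b, c} - {a, c}))" using x c ab by auto
    moreover have "x \<in> V" using x cT by blast
    ultimately show ?thesis using that(2) g by blast
  qed
qed

lemma card_addable:
  assumes V: "finite V" and F: "F \<in> configs V j"
  shows "card V choose 3 \<le> card (addable V F) + 12 * j^2 * card V"
proof -
  let ?G = "covered_edges F"
  note FD = configsD[OF F]
  have finF: "finite F" using FD(1) V finite_triples finite_subset by blast
  have cG: "card ?G \<le> 3 * j" using card_covered_edges_le[OF finF FD(1)] FD(2) by simp
  have finG: "finite ?G" using finite_covered[OF V FD(1)] .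
  let ?A = "(\<lambda>(e, x). insert x e) ` (?G \<times> V)"
  let ?B = "(\<lambda>((g, h), x). insert x ((g - h) \<union> (h - g))) ` ((?G \<times> ?G) \<times> V)"
  have "triples V \<subseteq> addable V F \<union> (?A \<union> ?B)"
  proof
    fix T assume T: "T \<in> triples V"
    show "T \<in> addable V F \<union> (?A \<union> ?B)"
    proof (cases "T \<in> addable V F")
      case False
      show ?thesis
        using F V T False
      proof (cases rule: blocked_triple_cases)
        case (1 e x)
        then show ?thesis by (auto intro!: image_eqI[of _ _ "(e, x)"])
      next
        case (2 g h x)
        then have "T \<in> ?B" by (intro image_eqI[of _ _ "((g, h), x)"]) auto
        then show ?thesis by blast
      qed
    qed simp
  qed
  then have "card (triples V) \<le> card (addable V F \<union> (?A \<union> ?B))"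
    using finG V finite_triples[OF V] by (intro card_mono) (auto simp: addable_def)
  also have "\<dots> \<le> card (addable V F) + (card ?A + card ?B)"
    by (meson card_Un_le le_trans nat_add_left_cancel_le)
  also have "card ?A \<le> card (?G \<times> V)" using finG V by (intro card_image_le) auto
  also have "card ?B \<le> card ((?G \<times> ?G) \<times> V)" using finG V by (intro card_image_le) auto
  finally have "card V choose 3 \<le>
      card (addable V F) + (card ?G * card V + card ?G * card ?G * card V)"
    by (simp add: card_triples[OF V] card_cartesian_product)
  also have "card ?G * card V + card ?G * card ?G * card V
      \<le> (3 * j) * card V + (3 * j) * (3 * j) * card V"
    using cG by (intro add_mono mult_mono) auto
  also have "\<dots> \<le> 12 * j^2 * card V"
  proof -
    have "j \<le> j^2" by (simp add: power2_eq_square)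
    then have "3 * j * card V \<le> 3 * j^2 * card V" by (intro mult_right_mono) auto
    then show ?thesis by (simp add: power2_eq_square)
  qed
  finally show ?thesis by simp
qed

lemma card_covered_insert_addable:
  assumes V: "finite V" and F: "F \<in> configs V j" and T: "T \<in> addable V F"
  shows "card (covered_edges (insert T F)) = card (covered_edges F) + 3"
    "insert T F \<in> configs V (Suc j)" "T \<notin> F"
proof -
  note FD = configsD[OF F]
  have T3: "card T = 3" using T by (auto simp: addable_def triples_def)
  have d: "pairs T \<inter> covered_edges F = {}" using T by (auto simp: addable_def)
  have "finite (pairs T)" using card_pairs_triple[OF T3] by (auto intro: card_ge_0_finite)
  then show "card (covered_edges (insert T F)) = card (covered_edges F) + 3"
    using d finite_covered[OF V FD(1)] card_pairs_triple[OF T3]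
    by (simp add: covered_edges_insert card_Un_disjoint)
  show "insert T F \<in> configs V (Suc j)" using T FD(2) by (auto simp: addable_def)
  show "T \<notin> F"
  proof
    assume "T \<in> F"
    then have "pairs T \<subseteq> covered_edges F" by (auto simp: covered_edges_def)
    then show False using d card_pairs_triple[OF T3] by (auto simp: inf_absorb1)
  qed
qed

text \<open>
  Double counting of the pairs of a configuration with \<open>j\<close> triangles and an addable triple: adding the
  triple multiplies the weight by \<open>r ^ 3\<close>, and each result is reached from at most \<open>Suc j\<close> pairs.
\<close>

lemma weight_sum_add_triangle:
  fixes r :: real
  assumes V: "finite V" and r: "0 \<le> r"
  shows "r ^ 3 * (real (card V choose 3) - 12 * real j^2 * real (card V)) * weight_sum V r j
    \<le> real (Suc j) * weight_sum V r (Suc j)"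
proof -
  have finc: "finite (configs V i)" for i using finite_configs[OF V] .
  have fina: "finite (addable V F)" for F using finite_triples[OF V] by (simp add: addable_def)
  have finF: "finite F" if "F \<in> configs V i" for F i
    using configsD(1)[OF that] finite_triples[OF V] finite_subset by blast
  have "r ^ 3 * (real (card V choose 3) - 12 * real j^2 * real (card V)) * weight_sum V r j
      = (\<Sum>F\<in>configs V j. (real (card V choose 3) - 12 * real j^2 * real (card V)) * r ^ (card (covered_edges F) + 3))"
    unfolding weight_sum_def sum_distrib_left by (intro sum.cong refl) (simp add: power_add)
  also have "\<dots> \<le> (\<Sum>F\<in>configs V j. real (card (addable V F)) * r ^ (card (covered_edges F) + 3))"
  proof (intro sum_mono mult_right_mono)
    fix F assume "F \<in> configs V j"
    then have "real (card V choose 3) \<le> real (card (addable V F) + 12 * j^2 * card V)"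
      using card_addable[OF V] by (intro of_nat_mono)
    then show "real (card V choose 3) - 12 * real j^2 * real (card V) \<le> real (card (addable V F))"
      by simp
  qed (use r in simp)
  also have "\<dots> = (\<Sum>F\<in>configs V j. \<Sum>T\<in>addable V F. r ^ card (covered_edges (insert T F)))"
    by (intro sum.cong refl) (simp add: card_covered_insert_addable(1)[OF V])
  also have "\<dots> = (\<Sum>(F, T)\<in>Sigma (configs V j) (addable V). r ^ card (covered_edges (insert T F)))"
    using finc fina by (subst sum.Sigma) auto
  also have "\<dots> \<le> (\<Sum>(F', T)\<in>Sigma (configs V (Suc j)) (\<lambda>F. F). r ^ card (covered_edges F'))"
  proof (rule sum_le_included[where i = "\<lambda>(F', T). (F' - {T}, T)"])
    show "\<forall>x\<in>Sigma (configs V j) (addable V). \<exists>y\<in>Sigma (configs V (Suc j)) (\<lambda>F. F).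
       (case y of (F', T) \<Rightarrow> (F' - {T}, T)) = x \<and>
       (case x of (F, T) \<Rightarrow> r ^ card (covered_edges (insert T F)))
       \<le> (case y of (F', T) \<Rightarrow> r ^ card (covered_edges F'))"
    proof
      fix x assume "x \<in> Sigma (configs V j) (addable V)"
      then obtain F T where x: "x = (F, T)" and FT: "F \<in> configs V j" "T \<in> addable V F" by auto
      show "\<exists>y\<in>Sigma (configs V (Suc j)) (\<lambda>F. F).
         (case y of (F', T) \<Rightarrow> (F' - {T}, T)) = x \<and>
         (case x of (F, T) \<Rightarrow> r ^ card (covered_edges (insert T F)))
         \<le> (case y of (F', T) \<Rightarrow> r ^ card (covered_edges F'))"
        using card_covered_insert_addable[OF V FT] by (intro bexI[of _ "(insert T F, T)"]) (auto simp: x)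
    qed
  qed (use finc fina finF r in auto)
  also have "\<dots> = (\<Sum>F\<in>configs V (Suc j). \<Sum>T\<in>F. r ^ card (covered_edges F))"
    by (rule sum.Sigma[symmetric]) (use finc finF in auto)
  also have "\<dots> = (\<Sum>F\<in>configs V (Suc j). real (Suc j) * r ^ card (covered_edges F))"
    by (intro sum.cong refl) (simp add: configsD(2))
  also have "\<dots> = real (Suc j) * weight_sum V r (Suc j)"
    by (simp add: weight_sum_def sum_distrib_left)
  finally show ?thesis .
qed

text \<open>
  The assumption bounds \<open>k\<close> by \<open>p ^ 3\<close> times the number of addable triples, so each step of
  \<open>weight_sum_add_triangle\<close> costs a factor of at most \<open>p ^ 3 / r ^ 3\<close>. For \<open>r = p\<close> this is monotonicity
  of the weight sums, for \<open>r = 1\<close> it says that every triangle costs \<open>p ^ 3\<close> in the uniform measure.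
\<close>

lemma weight_sum_drop_triangles:
  fixes p r :: real
  assumes V: "finite V" and r: "0 \<le> r"
    and k: "real k \<le> p ^ 3 * (real (card V choose 3) - 12 * real k^2 * real (card V))"
    and p: "0 < p"
  shows "t \<le> k \<Longrightarrow> r ^ (3 * t) * weight_sum V r (k - t) \<le> p ^ (3 * t) * weight_sum V r k"
proof (induction t)
  case (Suc t)
  let ?c = "real (card V choose 3) - 12 * real k^2 * real (card V)"
  define j where "j = k - Suc t"
  have j: "Suc j = k - t" "j \<le> k" "Suc j \<le> k" using Suc.prems by (auto simp: j_def)
  have c: "0 < ?c"
  proof (rule ccontr)
    assume "\<not> 0 < ?c"
    then have "p ^ 3 * ?c \<le> 0" using p by (simp add: mult_nonneg_nonpos)
    then show False using k Suc.prems by linarith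
  qed
  have W: "0 \<le> weight_sum V r i" for i using weight_sum_nonneg[OF r] .
  have "r ^ 3 * ?c * weight_sum V r j \<le>
      r ^ 3 * (real (card V choose 3) - 12 * real j^2 * real (card V)) * weight_sum V r j"
    using j r W by (intro mult_right_mono mult_left_mono diff_mono power_mono) auto
  also have "\<dots> \<le> real (Suc j) * weight_sum V r (Suc j)"
    by (rule weight_sum_add_triangle[OF V r])
  also have "\<dots> \<le> real k * weight_sum V r (Suc j)"
    using j W by (intro mult_right_mono) auto
  also have "\<dots> \<le> (p ^ 3 * ?c) * weight_sum V r (Suc j)"
    using k W by (intro mult_right_mono) auto
  finally have "?c * (r ^ 3 * weight_sum V r j) \<le> ?c * (p ^ 3 * weight_sum V r (Suc j))"
    by (simp add: mult_ac)
  then have step: "r ^ 3 * weight_sum V r j \<le> p ^ 3 * weight_sum V r (Suc j)"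
    using c by simp
  have "r ^ (3 * Suc t) * weight_sum V r (k - Suc t) = r ^ (3 * t) * (r ^ 3 * weight_sum V r j)"
    by (simp add: power_add j_def)
  also have "\<dots> \<le> r ^ (3 * t) * (p ^ 3 * weight_sum V r (k - t))"
    using step r j by (intro mult_left_mono) auto
  also have "\<dots> = p ^ 3 * (r ^ (3 * t) * weight_sum V r (k - t))" by simp
  also have "\<dots> \<le> p ^ 3 * (p ^ (3 * t) * weight_sum V r k)"
    using Suc p by (intro mult_left_mono) auto
  finally show ?case by (simp add: power_add)
qed simp

section \<open>Removing a component\<close>

definition clusters :: "'a set \<Rightarrow> nat \<Rightarrow> ('a set set \<Rightarrow> bool) \<Rightarrow> 'a set set set" where
  "clusters V k P = {C. C \<in> configs V (card C) \<and> C \<noteq> {} \<and> edge_connected C \<and> card C \<le> k \<and> P C}"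

lemma finite_clusters: "finite V \<Longrightarrow> finite (clusters V k P)"
  by (rule finite_subset[of _ "\<Union>i\<in>{..k}. configs V i"]) (auto simp: clusters_def finite_configs)

lemma component_in_clusters:
  assumes V: "finite V" and F: "F \<in> configs V k" and T: "T \<in> F" and P: "P (component F T)"
  shows "component F T \<in> clusters V k P"
proof -
  note FD = configsD[OF F]
  show ?thesis
    using config_split[OF V F component_subset[OF T] component_edge_disjoint[OF FD(1) T]]
      component_edge_connected[OF FD(1) T] component_self[of T F] P by (auto simp: clusters_def)
qed

text \<open>
  Deleting one component of the wanted kind maps a configuration to a pair consisting of this component
  and a smaller configuration, and the number of covered edges is additive.
\<close>

lemma sum_with_cluster:
  fixes r :: real
  assumes V: "finite V" and r: "0 \<le> r"
  shows "(\<Sum>F\<in>{F \<in> configs V k. \<exists>T\<in>F. P (component F T)}. r ^ card (covered_edges F))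
    \<le> (\<Sum>C\<in>clusters V k P. r ^ card (covered_edges C) * weight_sum V r (k - card C))"
proof -
  define A where "A C = {F \<in> configs V k. C \<subseteq> F \<and> F - C \<in> configs V (k - card C) \<and>
    card (covered_edges F) = card (covered_edges C) + card (covered_edges (F - C))}" for C
  have "(\<Sum>F\<in>{F \<in> configs V k. \<exists>T\<in>F. P (component F T)}. r ^ card (covered_edges F))
      \<le> (\<Sum>C\<in>clusters V k P. \<Sum>F\<in>A C. r ^ card (covered_edges F))"
  proof (rule sum_le_sum_cover)
    show "{F \<in> configs V k. \<exists>T\<in>F. P (component F T)} \<subseteq> (\<Union>C\<in>clusters V k P. A C)"
    proof clarify
      fix F T assume F: "F \<in> configs V k" and T: "T \<in> F" "P (component F T)"
      have "F \<in> A (component F T)"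
        using config_split[OF V F component_subset[OF T(1)]
            component_edge_disjoint[OF configsD(1)[OF F] T(1)]] component_subset[OF T(1)] F
        by (simp add: A_def)
      then show "F \<in> (\<Union>C\<in>clusters V k P. A C)"
        using component_in_clusters[OF V F T(1), of P] T(2) by blast
    qed
  qed (use V r in \<open>auto simp: finite_clusters A_def finite_configs\<close>)
  also have "\<dots> \<le> (\<Sum>C\<in>clusters V k P. r ^ card (covered_edges C) * weight_sum V r (k - card C))"
  proof (rule sum_mono)
    fix C assume "C \<in> clusters V k P"
    have "(\<Sum>F\<in>A C. r ^ card (covered_edges F)) \<le>
        (\<Sum>F\<in>configs V (k - card C). r ^ card (covered_edges C) * r ^ card (covered_edges F))"
    proof (rule sum_le_included[where i = "\<lambda>F. F \<union> C"])
      show "\<forall>F\<in>A C. \<exists>F'\<in>configs V (k - card C). F' \<union> C = F \<and>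
          r ^ card (covered_edges F) \<le> r ^ card (covered_edges C) * r ^ card (covered_edges F')"
      proof
        fix F assume "F \<in> A C"
        then show "\<exists>F'\<in>configs V (k - card C). F' \<union> C = F \<and>
            r ^ card (covered_edges F) \<le> r ^ card (covered_edges C) * r ^ card (covered_edges F')"
          by (intro bexI[of _ "F - C"]) (auto simp: A_def power_add)
      qed
    qed (use V r in \<open>auto simp: A_def finite_configs\<close>)
    then show "(\<Sum>F\<in>A C. r ^ card (covered_edges F)) \<le>
        r ^ card (covered_edges C) * weight_sum V r (k - card C)"
      by (simp add: weight_sum_def sum_distrib_left)
  qed
  finally show ?thesis .
qed

text \<open>
  A closed set of edges in the exploration yields a closed set of triangles of \<open>C\<close>, so edge-connectedness
  of \<open>C\<close> makes everything reachable from any nonempty part \<open>S\<close>. At the start all known edges are queued,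
  and nothing has to be saturated yet.
\<close>

lemma cluster_explored:
  assumes V: "finite V" and C: "C \<in> configs V (card C)" "edge_connected C"
    and M: "card (\<Union>C) \<le> M" and S: "S \<subseteq> C" "S \<noteq> {}"
  shows "covered_edges C \<in> explored V M (covered_edges S) (covered_edges S)"
proof (rule exploredI)
  note CD = configsD[OF C(1)]
  show "covered_edges S \<subseteq> covered_edges C" using S by (auto simp: covered_edges_def)
  show "covered_edges C \<subseteq> pairs V" by (rule covered_edges_subset[OF CD(1)])
  have "\<Union>(covered_edges C) = \<Union>C" by (rule Union_covered_edges[OF CD(1)])
  then show "card (\<Union>(covered_edges C)) \<le> M" using M by simp
  fix D assume D: "covered_edges S \<subseteq> D" "D \<subseteq> covered_edges C" "triangle_closed V (covered_edges C) D"
  let ?X = "{T \<in> C. pairs T \<subseteq> D}"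
  have "?X = C"
  proof -
    have "S \<subseteq> ?X" using S(1) D(1) by (auto simp: covered_edges_def)
    then have "?X \<noteq> {}" using S(2) by blast
    moreover have "T' \<in> ?X" if "T \<in> ?X" "T' \<in> C" "share_edge T T'" for T T'
    proof -
      have "pairs T' \<inter> D \<noteq> {}" using that by (auto simp: share_edge_def)
      moreover have "T' \<in> triples V" "pairs T' \<subseteq> covered_edges C"
        using that CD(1) by (auto simp: covered_edges_def)
      ultimately show ?thesis using D(3) that by (auto simp: triangle_closed_def)
    qed
    ultimately have "?X \<noteq> {} \<and> (\<forall>T\<in>?X. \<forall>T'\<in>C. share_edge T T' \<longrightarrow> T' \<in> ?X)"
      by (intro conjI ballI impI)
    then show ?thesis
      by (rule C(2)[unfolded edge_connected_def, rule_format, rotated]) blast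
  qed
  then show "D = covered_edges C" using D(2) by (auto simp: covered_edges_def)
qed auto

text \<open>
  The sum over arbitrarily large connected configurations is controlled by their small parts alone: all
  configurations containing a given seed \<open>E\<close> together cost only a factor \<open>2 ^ card E\<close> more than \<open>E\<close> itself.
\<close>

lemma sum_clusters:
  fixes p :: real
  assumes V: "finite V" and p: "0 \<le> p" "p \<le> 1"
    and small: "real (card V) * p^2 + real M * p \<le> 1 / 8"
    and CC: "\<And>C. C \<in> CC \<Longrightarrow> C \<in> configs V (card C) \<and> edge_connected C \<and> card (\<Union>C) \<le> M"
    and finE: "finite \<E>"
    and seed: "\<And>C. C \<in> CC \<Longrightarrow> \<exists>S\<subseteq>C. S \<noteq> {} \<and> covered_edges S \<in> \<E>"
    and E: "\<And>E. E \<in> \<E> \<Longrightarrow> E \<subseteq> pairs V"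
  shows "(\<Sum>C\<in>CC. p ^ card (covered_edges C)) \<le> (\<Sum>E\<in>\<E>. (2 * p) ^ card E)"
proof -
  have inj: "inj_on covered_edges CC"
  proof (rule inj_onI)
    fix C D assume CD: "C \<in> CC" "D \<in> CC" "covered_edges C = covered_edges D"
    have "A \<subseteq> B" if "A \<in> CC" "B \<in> CC" "covered_edges A = covered_edges B" for A B
    proof
      fix T assume T: "T \<in> A"
      have "A \<in> configs V (card A)" "B \<in> configs V (card B)" using CC that by auto
      moreover have "pairs T \<subseteq> covered_edges A" using T by (auto simp: covered_edges_def)
      ultimately show "T \<in> B" using T that(3) configsD(1,3) by (metis subsetD)
    qed
    then show "C = D" using CD by (metis subset_antisym)
  qed
  have "(\<Sum>C\<in>CC. p ^ card (covered_edges C)) = (\<Sum>H\<in>covered_edges ` CC. p ^ card H)"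
    using inj by (simp add: sum.reindex)
  also have "\<dots> \<le> (\<Sum>E\<in>\<E>. \<Sum>H\<in>explored V M E E. p ^ card H)"
  proof (rule sum_le_sum_cover)
    show "covered_edges ` CC \<subseteq> (\<Union>E\<in>\<E>. explored V M E E)"
    proof clarify
      fix C assume C: "C \<in> CC"
      obtain S where S: "S \<subseteq> C" "S \<noteq> {}" "covered_edges S \<in> \<E>" using seed[OF C] by blast
      have "covered_edges C \<in> explored V M (covered_edges S) (covered_edges S)"
        using CC[OF C] S by (intro cluster_explored[OF V]) auto
      then show "covered_edges C \<in> (\<Union>E\<in>\<E>. explored V M E E)" using S(3) by blast
    qed
  qed (use finE V p finite_explored in auto)
  also have "\<dots> \<le> (\<Sum>E\<in>\<E>. (2 * p) ^ card E)"
  proof (rule sum_mono)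
    fix E assume "E \<in> \<E>"
    then have EV: "E \<subseteq> pairs V" by (rule E)
    have "(\<Sum>H\<in>explored V M E E. p ^ card H) = (\<Sum>H\<in>explored V M E E. p ^ card E * p ^ card (H - E))"
    proof (rule sum.cong[OF refl])
      fix H assume "H \<in> explored V M E E"
      then have H: "E \<subseteq> H" "H \<subseteq> pairs V" by (auto dest: exploredD(1,2))
      have f: "finite H" using finite_subset[OF H(2) finite_pairs[OF V]] .
      have "card E \<le> card H" "card (H - E) = card H - card E"
        using H f by (auto intro: card_mono card_Diff_subset finite_subset)
      then show "p ^ card H = p ^ card E * p ^ card (H - E)" by (simp flip: power_add)
    qed
    also have "\<dots> = p ^ card E * (\<Sum>H\<in>explored V M E E. p ^ card (H - E))"
      by (simp add: sum_distrib_left)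
    also have "\<dots> \<le> p ^ card E * 2 ^ card E"
      using p small EV V by (intro mult_left_mono sum_explored) auto
    finally show "(\<Sum>H\<in>explored V M E E. p ^ card H) \<le> (2 * p) ^ card E"
      by (simp add: power_mult_distrib mult.commute)
  qed
  finally show ?thesis .
qed

definition seeds :: "'a set \<Rightarrow> nat \<Rightarrow> nat \<Rightarrow> 'a set set set" where
  "seeds V v e = {E. E \<subseteq> pairs V \<and> card (\<Union>E) = v \<and> e \<le> card E}"

lemma finite_seeds: "finite V \<Longrightarrow> finite (seeds V v e)"
  by (rule finite_subset[of _ "Pow (pairs V)"]) (auto simp: seeds_def finite_pairs)

lemma sum_seeds:
  fixes x :: real
  assumes V: "finite V" and x: "0 \<le> x" "x \<le> 1"
  shows "(\<Sum>E\<in>seeds V v e. x ^ card E) \<le> real (card V) ^ v * 2 ^ (v choose 2) * x ^ e"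
proof -
  let ?U = "{U. U \<subseteq> V \<and> card U = v}"
  have finU: "finite ?U" using V by simp
  have cover: "seeds V v e \<subseteq> (\<Union>U\<in>?U. Pow (pairs U))"
  proof
    fix E assume E: "E \<in> seeds V v e"
    have "\<Union>E \<subseteq> V" "E \<subseteq> pairs (\<Union>E)" using E by (auto simp: seeds_def pairs_def)
    then show "E \<in> (\<Union>U\<in>?U. Pow (pairs U))" using E by (auto simp: seeds_def)
  qed
  have "card (seeds V v e) \<le> card (\<Union>U\<in>?U. Pow (pairs U))"
    using cover finU V by (intro card_mono) (auto intro!: finite_pairs intro: finite_subset)
  also have "\<dots> \<le> (\<Sum>U\<in>?U. card (Pow (pairs U)))"
    by (rule card_UN_le[OF finU])
  also have "\<dots> = (\<Sum>U\<in>?U. 2 ^ (v choose 2))"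
    by (rule sum.cong[OF refl]) (use V in \<open>auto simp: card_Pow finite_pairs card_pairs finite_subset\<close>)
  also have "\<dots> = (card V choose v) * 2 ^ (v choose 2)"
    by (simp add: n_subsets[OF V])
  also have "\<dots> \<le> card V ^ v * 2 ^ (v choose 2)"
    by (cases "v \<le> card V") (auto simp: binomial_le_pow binomial_eq_0)
  finally have "real (card (seeds V v e)) \<le> real (card V ^ v * 2 ^ (v choose 2))"
    by (rule of_nat_mono)
  then have c: "real (card (seeds V v e)) \<le> real (card V) ^ v * 2 ^ (v choose 2)" by simp
  have "(\<Sum>E\<in>seeds V v e. x ^ card E) \<le> real (card (seeds V v e)) * x ^ e"
    by (rule sum_bounded_above) (use x in \<open>auto simp: seeds_def intro: power_decreasing\<close>)
  also have "\<dots> \<le> real (card V) ^ v * 2 ^ (v choose 2) * x ^ e"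
    using c x by (intro mult_right_mono) auto
  finally show ?thesis .
qed

section \<open>Small parts of edge-connected configurations\<close>

text \<open>
  A triangle glued to an edge along a new vertex \<open>x\<close> creates no other triangle, because \<open>x\<close> has only the two
  neighbours \<open>a\<close> and \<open>b\<close>. So the configuration property is inherited.
\<close>

lemma attach_triangle_new:
  assumes V: "finite V" and S: "S \<in> configs V m" and T: "T \<in> triples V"
    and ab: "T = {a, b, x}" "{a, b} \<in> covered_edges S" and x: "x \<notin> \<Union>S"
  shows "insert T S \<in> configs V (Suc m)" "T \<notin> S"
    "card (\<Union>(insert T S)) = Suc (card (\<Union>S))"
    "card (covered_edges (insert T S)) = card (covered_edges S) + 2"
    "pairs T \<inter> covered_edges S = {{a, b}}"
proof -
  note SD = configsD[OF S]
  have finS: "finite S" using SD(1) finite_triples[OF V] finite_subset by blast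
  have T3: "card T = 3" using T by (simp add: triples_def)
  then have d: "a \<noteq> b" "a \<noteq> x" "b \<noteq> x" using ab by (auto simp: card_insert_if split: if_splits)
  have pT: "pairs T = {{a, b}, {a, x}, {b, x}}" using pairs_triple[OF d] ab by simp
  have nx: "e \<notin> covered_edges S" if "x \<in> e" for e
    using x that by (auto simp: covered_edges_def pairs_def)
  have abS: "a \<in> \<Union>S" "b \<in> \<Union>S" using ab(2) by (auto simp: covered_edges_def pairs_def)
  show nT: "T \<notin> S" using x ab by blast
  show "pairs T \<inter> covered_edges S = {{a, b}}" using pT nx ab(2) by auto
  have cov: "covered_edges (insert T S) = covered_edges S \<union> {{a, x}, {b, x}}"
    using pT ab(2) by (auto simp: covered_edges_insert)
  show "card (covered_edges (insert T S)) = card (covered_edges S) + 2"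
  proof -
    have "{a, x} \<noteq> {b, x}" using d by (auto simp: doubleton_eq_iff)
    then have "card {{a, x}, {b, x}} = 2" by simp
    moreover have "covered_edges S \<inter> {{a, x}, {b, x}} = {}" using nx by auto
    ultimately show ?thesis unfolding cov
      using finite_covered[OF V SD(1)] by (metis card_Un_disjoint finite.emptyI finite.insertI)
  qed
  have "finite (\<Union>S)" using SD(1) V by (intro finite_subset[of "\<Union>S" V]) (auto simp: triples_def)
  moreover have "\<Union>(insert T S) = insert x (\<Union>S)" using ab abS by auto
  ultimately show "card (\<Union>(insert T S)) = Suc (card (\<Union>S))" using x by simp
  show "insert T S \<in> configs V (Suc m)"
  proof (rule configsI)
    show "card (insert T S) = Suc m" using nT finS SD(2) by simp
    show "insert T S \<subseteq> triples V" using T SD(1) by simp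
    fix R assume R: "R \<in> triples V" "pairs R \<subseteq> covered_edges (insert T S)"
    have R3: "card R = 3" using R by (simp add: triples_def)
    show "R \<in> insert T S"
    proof (cases "x \<in> R")
      case False
      then have "pairs R \<subseteq> covered_edges S"
        using R(2) unfolding cov by (auto simp: pairs_def)
      then show ?thesis using SD(3) R by blast
    next
      case True
      then obtain u w where uw: "R = {x, u, w}" "u \<noteq> x" "w \<noteq> x" "u \<noteq> w"
        using R3 by (auto simp: card_3_iff)
      have "{x, u} \<in> {{a, x}, {b, x}}" "{x, w} \<in> {{a, x}, {b, x}}"
        using R(2) uw nx[of "{x, u}"] nx[of "{x, w}"] unfolding cov
        by (auto simp: pairs_triple insert_commute)
      then have "R = T" using uw ab by (auto simp: doubleton_eq_iff)
      then show ?thesis by simp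
    qed
  qed
qed

text \<open>
  The alternative to a new vertex is a triangle on known vertices. It must bring a new edge, since a
  configuration contains all triangles on its edges.
\<close>

lemma attach_triangle:
  assumes V: "finite V" and S: "S \<in> configs V m" and T: "T \<in> triples V" "T \<notin> S"
    and R: "R \<in> S" "share_edge R T"
  obtains (inside) "\<Union>(insert T S) = \<Union>S" "card (covered_edges S) < card (covered_edges (insert T S))"
  | (new) a b x where "T = {a, b, x}" "{a, b} \<in> covered_edges S" "x \<notin> \<Union>S"
proof -
  note SD = configsD[OF S]
  obtain e where e: "e \<in> pairs R" "e \<in> pairs T" using R by (auto simp: share_edge_def)
  then have "card e = 2" by (simp add: pairs_def)
  then obtain a b where ab: "e = {a, b}" by (auto simp: card_2_iff)
  obtain x where x: "T = {a, b, x}"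
    using triple_through_pair[of T a b] T e ab by (auto simp: triples_def)
  show ?thesis
  proof (cases "x \<in> \<Union>S")
    case False
    have "{a, b} \<in> covered_edges S" using e ab R by (auto simp: covered_edges_def)
    then show ?thesis using new x False by blast
  next
    case True
    have "a \<in> R" "b \<in> R" using e ab by (auto simp: pairs_def)
    then have U: "\<Union>(insert T S) = \<Union>S" using R True x by auto
    have "\<not> pairs T \<subseteq> covered_edges S" using SD(3) T by blast
    then have "covered_edges S \<subset> covered_edges (insert T S)" by (auto simp: covered_edges_insert)
    moreover have "finite (covered_edges (insert T S))"
      using SD(1) T by (intro finite_covered[OF V]) auto
    ultimately show ?thesis using inside U psubset_card_mono by blast
  qed
qed

lemma single_triangle_config:
  assumes "T \<in> triples V"
  shows "{T} \<in> configs V 1" "card (\<Union>{T}) = 3" "card (covered_edges {T}) = 3"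
proof -
  have T3: "card T = 3" using assms by (simp add: triples_def)
  show "{T} \<in> configs V 1"
  proof (rule configsI)
    fix S assume S: "S \<in> triples V" "pairs S \<subseteq> covered_edges {T}"
    then have "\<Union>(pairs S) \<subseteq> \<Union>(pairs T)" by (auto simp: covered_edges_def)
    then have "S \<subseteq> T" using Union_pairs_triple T3 S(1) by (metis triples_card)
    then have "S = T" using S(1) T3 by (intro card_subset_eq) (auto simp: triples_def intro: card_ge_0_finite)
    then show "S \<in> {T}" by simp
  qed (use assms in auto)
  show "card (\<Union>{T}) = 3" using T3 by simp
  show "card (covered_edges {T}) = 3" using card_pairs_triple[OF T3] by (simp add: covered_edges_def)
qed

lemma edge_connected_grow:
  assumes "edge_connected C" "X \<subseteq> C" "X \<noteq> {}" "X \<noteq> C"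
  obtains R T where "R \<in> X" "T \<in> C" "T \<notin> X" "share_edge R T"
proof -
  have "\<not> (\<forall>S\<in>X. \<forall>T\<in>C. share_edge S T \<longrightarrow> T \<in> X)"
    using assms(1)[unfolded edge_connected_def, rule_format, of X] assms(2-4) by blast
  then show ?thesis using that by blast
qed

lemma diamond_config:
  assumes V: "finite V" and T: "T1 \<in> triples V" "T2 \<in> triples V" "T1 \<noteq> T2" "share_edge T1 T2"
  shows "{T2, T1} \<in> configs V 2" "card (\<Union>{T2, T1}) = 4" "card (covered_edges {T2, T1}) = 5"
proof -
  note one = single_triangle_config[OF T(1)]
  have n2: "T2 \<notin> {T1}" and s1: "T1 \<in> {T1}" using T(3) by auto
  have "\<exists>a b x. T2 = {a, b, x} \<and> {a, b} \<in> covered_edges {T1} \<and> x \<notin> \<Union>{T1}"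
    using V one(1) T(2) n2 s1 T(4)
  proof (cases rule: attach_triangle)
    case inside
    then have "T2 \<subseteq> T1" by blast
    then have "T2 = T1" using T(1,2) by (intro card_subset_eq) (auto simp: triples_def intro: card_ge_0_finite)
    then show ?thesis using T by simp
  qed blast
  then obtain a b x where x: "T2 = {a, b, x}" "{a, b} \<in> covered_edges {T1}" "x \<notin> \<Union>{T1}" by blast
  show "{T2, T1} \<in> configs V 2" "card (\<Union>{T2, T1}) = 4" "card (covered_edges {T2, T1}) = 5"
    using attach_triangle_new[OF V one(1) T(2) x] one(2,3) by (auto simp: numeral_2_eq_2)
qed

text \<open>
  The strict inequality holds because the two triangles of the diamond save an edge.
\<close>

lemma diamond_seed:
  assumes V: "finite V" and C: "C \<in> configs V (card C)" "edge_connected C" "2 \<le> card C"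
  shows "\<exists>S\<subseteq>C. S \<noteq> {} \<and> covered_edges S \<in> seeds V 4 5"
    "card (covered_edges C) < 3 * card C"
proof -
  note CD = configsD[OF C(1)]
  have finC: "finite C" using C(3) by (auto intro: card_ge_0_finite)
  obtain T1 where T1: "T1 \<in> C" using C(3) by fastforce
  have "{T1} \<noteq> C" using C(3) by auto
  then obtain T2 where T2: "T2 \<in> C" "T2 \<noteq> T1" "share_edge T1 T2"
    using edge_connected_grow[OF C(2), of "{T1}"] T1 by auto
  note dia = diamond_config[OF V _ _ T2(2)[symmetric] T2(3)]
  have tr: "T1 \<in> triples V" "T2 \<in> triples V" using T1 T2 CD(1) by auto
  have cov: "covered_edges {T2, T1} \<subseteq> pairs V" using tr by (intro covered_edges_subset) auto
  have un: "\<Union>(covered_edges {T2, T1}) = \<Union>{T2, T1}"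
    using tr by (intro Union_covered_edges[of _ V]) auto
  show "\<exists>S\<subseteq>C. S \<noteq> {} \<and> covered_edges S \<in> seeds V 4 5"
    using dia[OF tr] cov un T1 T2 by (intro exI[of _ "{T2, T1}"]) (simp add: seeds_def)
  have "C = (C - {T1, T2}) \<union> {T2, T1}" using T1 T2 by auto
  then have "card (covered_edges C) \<le> card (covered_edges (C - {T1, T2})) + card (covered_edges {T2, T1})"
    by (metis covered_edges_Un card_Un_le)
  also have "\<dots> \<le> 3 * card (C - {T1, T2}) + 5"
    using dia[OF tr] card_covered_edges_le[of "C - {T1, T2}" V] finC CD(1) by auto
  also have "card (C - {T1, T2}) = card C - 2"
    using T1 T2 finC by (simp add: card_Diff_subset)
  finally show "card (covered_edges C) < 3 * card C" using C(3) by simp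
qed

definition elementary_shape :: "'a set set \<Rightarrow> bool" where
  "elementary_shape C \<longleftrightarrow> isolated_triangle C \<or> diamond C \<or> piglet C \<or> three_book C"

lemma elementary_iff: "elementary F \<longleftrightarrow> (\<forall>T\<in>F. elementary_shape (component F T))"
  by (simp add: elementary_def edge_components_eq elementary_shape_def)

text \<open>
  The third triangle meets the other two at most in the edge \<open>{a, b}\<close> to which it is glued. So it shares
  an edge with exactly one of them, or all three share the same edge.
\<close>

lemma three_triangles_elementary:
  assumes V: "finite V" and T: "T1 \<in> triples V" "T2 \<in> triples V" "T3 \<in> triples V" "T1 \<noteq> T2" "share_edge T1 T2"
    and x: "T3 = {a, b, x}" "{a, b} \<in> covered_edges {T2, T1}" "x \<notin> \<Union>{T2, T1}"
  shows "elementary_shape {T1, T2, T3}"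
proof -
  note dia = diamond_config[OF V T(1,2,4,5)]
  note new = attach_triangle_new[OF V dia(1) T(3) x]
  have dist: "T3 \<noteq> T1" "T3 \<noteq> T2" using new(2) by auto
  have only: "e = {a, b}" if "e \<in> pairs T3" "e \<in> pairs T1 \<or> e \<in> pairs T2" for e
    using new(5) that by (auto simp: covered_edges_def)
  have ab: "{a, b} \<in> pairs T3" using new(5) by blast
  consider "share_edge T1 T3" "share_edge T2 T3" | "\<not> share_edge T1 T3" "share_edge T2 T3"
    | "share_edge T1 T3" "\<not> share_edge T2 T3"
    using x(2) ab by (auto simp: covered_edges_def share_edge_def)
  then show ?thesis
  proof cases
    case 1
    then have "{a, b} \<in> pairs T1 \<inter> pairs T2 \<inter> pairs T3"
      using only ab unfolding share_edge_def by blast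
    then have "three_book {T1, T2, T3}"
      unfolding three_book_def using dist T(4) by (intro exI[of _ T1] exI[of _ T2] exI[of _ T3]) auto
    then show ?thesis by (simp add: elementary_shape_def)
  next
    case 2
    then have "piglet {T1, T2, T3}"
      unfolding piglet_def using dist T(4,5)
      by (intro exI[of _ T1] exI[of _ T2] exI[of _ T3]) auto
    then show ?thesis by (simp add: elementary_shape_def)
  next
    case 3
    then have "piglet {T1, T2, T3}"
      unfolding piglet_def using dist T(4,5)
      by (intro exI[of _ T2] exI[of _ T1] exI[of _ T3]) (auto simp: share_edge_commute)
    then show ?thesis by (simp add: elementary_shape_def)
  qed
qed

text \<open>
  Collect triangles one at a time, each sharing an edge with an earlier one. The first two form a diamond.
  If the third has no new vertex, there are 6 edges on 4 vertices. Otherwise the three are a piglet or a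
  3-book with 7 edges on 5 vertices and no further triangle, so a fourth triangle exists and brings
  either a new edge on the same vertices or two new edges and a new vertex.
\<close>

lemma nonelementary_seed:
  assumes V: "finite V" and C: "C \<in> configs V (card C)" "edge_connected C" "C \<noteq> {}"
    and ns: "\<not> elementary_shape C"
  shows "\<exists>S\<subseteq>C. S \<noteq> {} \<and> covered_edges S \<in> seeds V 4 6 \<union> seeds V 5 8 \<union> seeds V 6 9"
proof -
  note CD = configsD[OF C(1)]
  have seedI: "\<exists>S\<subseteq>C. S \<noteq> {} \<and> covered_edges S \<in> seeds V 4 6 \<union> seeds V 5 8 \<union> seeds V 6 9"
    if "S \<subseteq> C" "S \<noteq> {}" "(card (\<Union>S), e) \<in> {(4, 6), (5, 8), (6, 9)}" "e \<le> card (covered_edges S)" for S e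
  proof -
    have "S \<subseteq> triples V" using that CD by blast
    then have "covered_edges S \<subseteq> pairs V" "\<Union>(covered_edges S) = \<Union>S"
      by (rule covered_edges_subset, rule Union_covered_edges)
    then show ?thesis using that by (intro exI[of _ S]) (auto simp: seeds_def)
  qed
  obtain T1 where T1: "T1 \<in> C" using C(3) by blast
  have "{T1} \<noteq> C" using ns by (auto simp: elementary_shape_def isolated_triangle_def)
  then obtain T2 where T2: "T2 \<in> C" "T1 \<noteq> T2" "share_edge T1 T2"
    using edge_connected_grow[OF C(2), of "{T1}"] T1 by auto
  have tr: "T1 \<in> triples V" "T2 \<in> triples V" using T1 T2 CD(1) by auto
  note dia = diamond_config[OF V tr T2(2,3)]
  have "{T2, T1} \<noteq> C"
  proof
    assume "{T2, T1} = C"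
    then have "C = {T1, T2}" "distinct [T1, T2]" using T2(2) by auto
    then have "diamond C" unfolding diamond_def using T2(3) by blast
    then show False using ns by (simp add: elementary_shape_def)
  qed
  then obtain R T3 where T3: "R \<in> {T2, T1}" "T3 \<in> C" "T3 \<notin> {T2, T1}" "share_edge R T3"
    using edge_connected_grow[OF C(2), of "{T2, T1}"] T1 T2 by blast
  have tr3: "T3 \<in> triples V" using T3 CD(1) by auto
  show ?thesis
    using V dia(1) tr3 T3(3,1,4)
  proof (cases rule: attach_triangle)
    case inside
    then show ?thesis using dia T1 T2 T3 by (intro seedI[of "insert T3 {T2, T1}" 6]) auto
  next
    case (new a b x)
    note three = attach_triangle_new[OF V dia(1) tr3 new]
    let ?S = "insert T3 {T2, T1}"
    have S: "?S \<subseteq> C" "?S \<noteq> {}" using T1 T2 T3 by auto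
    have "?S \<noteq> C"
      using three_triangles_elementary[OF V tr tr3 T2(2,3) new] ns by (auto simp: insert_commute)
    then obtain R T4 where T4: "R \<in> ?S" "T4 \<in> C" "T4 \<notin> ?S" "share_edge R T4"
      by (rule edge_connected_grow[OF C(2) S])
    have tr4: "T4 \<in> triples V" using T4 CD(1) by auto
    have sub: "insert T4 ?S \<subseteq> C" using S(1) T4(2) by blast
    show ?thesis
      using V three(1) tr4 T4(3,1,4)
    proof (cases rule: attach_triangle)
      case inside
      then show ?thesis using three dia sub by (intro seedI[of "insert T4 ?S" 8]) auto
    next
      case (new a' b' x')
      show ?thesis using attach_triangle_new[OF V three(1) tr4 new] three dia sub
        by (intro seedI[of "insert T4 ?S" 9]) auto
    qed
  qed
qed

lemma card_Union_triples_le: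
  assumes "finite C" "C \<subseteq> triples V" shows "card (\<Union>C) \<le> 3 * card C"
proof -
  have "card (\<Union>C) \<le> (\<Sum>T\<in>C. card T)" using assms by (metis card_Union_le_sum_card)
  also have "\<dots> = (\<Sum>T\<in>C. 3)" by (rule sum.cong) (use assms in \<open>auto simp: triples_def\<close>)
  finally show ?thesis by simp
qed

lemma sum_clusters_le:
  fixes p :: real
  assumes V: "finite V" and p: "0 \<le> p" "p \<le> 1"
    and small: "real (card V) * p^2 + real (3 * k) * p \<le> 1 / 8"
    and finE: "finite \<E>" and E: "\<And>E. E \<in> \<E> \<Longrightarrow> E \<subseteq> pairs V"
    and seed: "\<And>C. C \<in> clusters V k P \<Longrightarrow> \<exists>S\<subseteq>C. S \<noteq> {} \<and> covered_edges S \<in> \<E>"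
  shows "(\<Sum>C\<in>clusters V k P. p ^ card (covered_edges C)) \<le> (\<Sum>E\<in>\<E>. (2 * p) ^ card E)"
proof (rule sum_clusters[OF V p small _ finE seed E])
  fix C assume C: "C \<in> clusters V k P"
  have "C \<subseteq> triples V" using C configsD(1) by (auto simp: clusters_def)
  then have "card (\<Union>C) \<le> 3 * card C"
    using card_Union_triples_le finite_triples[OF V] finite_subset by metis
  then show "C \<in> configs V (card C) \<and> edge_connected C \<and> card (\<Union>C) \<le> 3 * k"
    using C by (auto simp: clusters_def)
qed

section \<open>Weight of configurations with an unwanted component\<close>

definition edge_disjoint :: "'a set set \<Rightarrow> bool" where
  "edge_disjoint F \<longleftrightarrow> (\<forall>S\<in>F. \<forall>T\<in>F. S \<noteq> T \<longrightarrow> \<not> share_edge S T)"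

lemma not_edge_disjoint_component:
  assumes V: "finite V" and F: "F \<in> configs V k" and nd: "\<not> edge_disjoint F"
  shows "\<exists>T\<in>F. 2 \<le> card (component F T)"
proof -
  note FD = configsD[OF F]
  obtain S T where ST: "S \<in> F" "T \<in> F" "S \<noteq> T" "share_edge S T"
    using nd by (auto simp: edge_disjoint_def)
  have "{S, T} \<subseteq> component F S"
    using component_closed[OF FD(1) ST(1) component_self ST(2,4)] component_self by auto
  moreover have "finite (component F S)"
    using component_subset[OF ST(1)] FD(1) finite_triples[OF V] by (meson finite_subset)
  ultimately have "card {S, T} \<le> card (component F S)" by (intro card_mono)
  moreover have "card {S, T} = 2" using ST(3) by simp
  ultimately show ?thesis using ST(1) by (intro bexI[of _ S]) simp_all
qed

context
  fixes V :: "'a set" and p :: real and k :: nat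
  assumes V: "finite V" and p: "0 < p" "2 * p \<le> 1"
    and k: "real k \<le> p ^ 3 * (real (card V choose 3) - 12 * real k^2 * real (card V))"
begin

text \<open>
  Here \<open>weight_sum V p (k - card C) \<le> weight_sum V p k\<close> removes the dependence on the remaining triangles.
\<close>

lemma weight_with_cluster:
  "(\<Sum>F\<in>{F \<in> configs V k. \<exists>T\<in>F. P (component F T)}. p ^ card (covered_edges F))
    \<le> (\<Sum>C\<in>clusters V k P. p ^ card (covered_edges C)) * weight_sum V p k"
proof -
  have "weight_sum V p (k - card C) \<le> weight_sum V p k" if "C \<in> clusters V k P" for C
    using weight_sum_drop_triangles[OF V _ k p(1), of p "card C"] p that by (simp add: clusters_def)
  then have "(\<Sum>C\<in>clusters V k P. p ^ card (covered_edges C) * weight_sum V p (k - card C))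
      \<le> (\<Sum>C\<in>clusters V k P. p ^ card (covered_edges C) * weight_sum V p k)"
    using p by (intro sum_mono mult_left_mono) auto
  then show ?thesis
    using sum_with_cluster[OF V, of p k P] p by (simp add: sum_distrib_right)
qed

lemma count_with_cluster:
  "real (card {F \<in> configs V k. \<exists>T\<in>F. P (component F T)})
    \<le> (\<Sum>C\<in>clusters V k P. p ^ (3 * card C)) * real (card (configs V k))"
proof -
  have "weight_sum V 1 (k - card C) \<le> p ^ (3 * card C) * weight_sum V 1 k" if "C \<in> clusters V k P" for C
    using weight_sum_drop_triangles[OF V _ k p(1), of 1 "card C"] p that by (simp add: clusters_def)
  then have "(\<Sum>C\<in>clusters V k P. weight_sum V 1 (k - card C))
      \<le> (\<Sum>C\<in>clusters V k P. p ^ (3 * card C) * weight_sum V 1 k)"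
    by (intro sum_mono)
  then show ?thesis
    using sum_with_cluster[OF V, of 1 k P] p by (simp add: sum_distrib_right weight_sum_def)
qed

text \<open>
  Both bounds come from the diamonds. In the uniform measure a component \<open>C\<close> costs \<open>p ^ (3 * card C)\<close>, and
  since \<open>C\<close> covers fewer than \<open>3 * card C\<close> edges, this saves at least one factor \<open>p\<close>.
\<close>

lemma weight_not_edge_disjoint:
  assumes small: "real (card V) * p^2 + real (3 * k) * p \<le> 1 / 8"
  shows "(\<Sum>F\<in>{F \<in> configs V k. \<not> edge_disjoint F}. p ^ card (covered_edges F))
      \<le> 2048 * (real (card V) ^ 4 * p ^ 5) * weight_sum V p k"
    and "real (card {F \<in> configs V k. \<not> edge_disjoint F})
      \<le> 2048 * (real (card V) ^ 4 * p ^ 5) * p * real (card (configs V k))"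
proof -
  let ?P = "\<lambda>C :: 'a set set. 2 \<le> card C"
  let ?CC = "clusters V k ?P"
  have sub: "{F \<in> configs V k. \<not> edge_disjoint F} \<subseteq> {F \<in> configs V k. \<exists>T\<in>F. ?P (component F T)}"
    using not_edge_disjoint_component[OF V] by blast
  have fin: "finite {F \<in> configs V k. \<exists>T\<in>F. ?P (component F T)}"
    using finite_configs[OF V] by simp
  have dia: "\<exists>S\<subseteq>C. S \<noteq> {} \<and> covered_edges S \<in> seeds V 4 5" "card (covered_edges C) < 3 * card C"
    if "C \<in> ?CC" for C
    using diamond_seed[OF V, of C] that by (auto simp: clusters_def)
  have "(\<Sum>C\<in>?CC. p ^ card (covered_edges C)) \<le> (\<Sum>E\<in>seeds V 4 5. (2 * p) ^ card E)"
    using p dia(1) by (intro sum_clusters_le[OF V _ _ small finite_seeds[OF V]]) (auto simp: seeds_def)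
  also have "\<dots> \<le> real (card V) ^ 4 * 2 ^ (4 choose 2) * (2 * p) ^ 5"
    using V p by (intro sum_seeds) auto
  also have "(4 choose 2 :: nat) = 6" by (simp add: choose_two)
  finally have S: "(\<Sum>C\<in>?CC. p ^ card (covered_edges C)) \<le> 2048 * (real (card V) ^ 4 * p ^ 5)"
    by (simp add: power_mult_distrib)
  have "(\<Sum>F\<in>{F \<in> configs V k. \<not> edge_disjoint F}. p ^ card (covered_edges F))
      \<le> (\<Sum>F\<in>{F \<in> configs V k. \<exists>T\<in>F. ?P (component F T)}. p ^ card (covered_edges F))"
    using sub fin p by (intro sum_mono2) auto
  also have "\<dots> \<le> (\<Sum>C\<in>?CC. p ^ card (covered_edges C)) * weight_sum V p k"
    by (rule weight_with_cluster)
  also have "\<dots> \<le> 2048 * (real (card V) ^ 4 * p ^ 5) * weight_sum V p k"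
    using S p by (intro mult_right_mono weight_sum_nonneg) auto
  finally show "(\<Sum>F\<in>{F \<in> configs V k. \<not> edge_disjoint F}. p ^ card (covered_edges F))
      \<le> 2048 * (real (card V) ^ 4 * p ^ 5) * weight_sum V p k" .
  have "(\<Sum>C\<in>?CC. p ^ (3 * card C)) \<le> (\<Sum>C\<in>?CC. p ^ card (covered_edges C) * p)"
  proof (rule sum_mono)
    fix C assume "C \<in> ?CC"
    then have "Suc (card (covered_edges C)) \<le> 3 * card C" using dia(2) by (simp add: Suc_le_eq)
    then have "p ^ (3 * card C) \<le> p ^ Suc (card (covered_edges C))"
      using p by (intro power_decreasing) auto
    then show "p ^ (3 * card C) \<le> p ^ card (covered_edges C) * p" by (simp add: mult.commute)
  qed
  also have "\<dots> = (\<Sum>C\<in>?CC. p ^ card (covered_edges C)) * p" by (simp add: sum_distrib_right)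
  also have "\<dots> \<le> 2048 * (real (card V) ^ 4 * p ^ 5) * p"
    using S p by (intro mult_right_mono) auto
  finally have S': "(\<Sum>C\<in>?CC. p ^ (3 * card C)) \<le> 2048 * (real (card V) ^ 4 * p ^ 5) * p" .
  have "real (card {F \<in> configs V k. \<not> edge_disjoint F})
      \<le> real (card {F \<in> configs V k. \<exists>T\<in>F. ?P (component F T)})"
    using sub fin by (intro of_nat_mono card_mono)
  also have "\<dots> \<le> (\<Sum>C\<in>?CC. p ^ (3 * card C)) * real (card (configs V k))"
    by (rule count_with_cluster)
  also have "\<dots> \<le> 2048 * (real (card V) ^ 4 * p ^ 5) * p * real (card (configs V k))"
    using S' by (intro mult_right_mono) auto
  finally show "real (card {F \<in> configs V k. \<not> edge_disjoint F})
      \<le> 2048 * (real (card V) ^ 4 * p ^ 5) * p * real (card (configs V k))" .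
qed

lemma weight_not_elementary:
  assumes small: "real (card V) * p^2 + real (3 * k) * p \<le> 1 / 8"
  shows "(\<Sum>F\<in>{F \<in> configs V k. \<not> elementary F}. p ^ card (covered_edges F))
      \<le> 2 ^ 24 * (real (card V) ^ 4 * p ^ 6 + real (card V) ^ 5 * p ^ 8 + real (card V) ^ 6 * p ^ 9)
         * weight_sum V p k"
proof -
  let ?n = "real (card V)"
  let ?P = "\<lambda>C :: 'a set set. \<not> elementary_shape C"
  let ?CC = "clusters V k ?P"
  let ?E = "seeds V 4 6 \<union> seeds V 5 8 \<union> seeds V 6 9"
  have fin: "finite (seeds V v e)" for v e by (rule finite_seeds[OF V])
  have "(\<Sum>C\<in>?CC. p ^ card (covered_edges C)) \<le> (\<Sum>E\<in>?E. (2 * p) ^ card E)"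
  proof (rule sum_clusters_le[OF V _ _ small])
    fix C assume "C \<in> ?CC"
    then show "\<exists>S\<subseteq>C. S \<noteq> {} \<and> covered_edges S \<in> ?E"
      by (intro nonelementary_seed[OF V]) (auto simp: clusters_def)
  qed (use p fin in \<open>auto simp: seeds_def\<close>)
  also have "\<dots> \<le> (\<Sum>E\<in>seeds V 4 6. (2 * p) ^ card E) + (\<Sum>E\<in>seeds V 5 8. (2 * p) ^ card E)
      + (\<Sum>E\<in>seeds V 6 9. (2 * p) ^ card E)"
  proof -
    have le: "sum g (A \<union> B) \<le> sum g A + sum g B"
      if "finite A" "finite B" "\<And>x. 0 \<le> g x" for A B and g :: "'a set set \<Rightarrow> real"
      using sum.union_inter[OF that(1,2), of g] sum_nonneg[of "A \<inter> B" g] that(3) by simp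
    have pos: "0 \<le> (2 * p) ^ card E" for E :: "'a set set" using p by simp
    show ?thesis
      using le[OF finite_UnI[OF fin fin] fin pos] le[OF fin fin pos] by (meson add_right_mono order_trans)
  qed
  also have "\<dots> \<le> ?n ^ 4 * 2 ^ (4 choose 2) * (2 * p) ^ 6 + ?n ^ 5 * 2 ^ (5 choose 2) * (2 * p) ^ 8
      + ?n ^ 6 * 2 ^ (6 choose 2) * (2 * p) ^ 9"
    using V p by (intro add_mono sum_seeds) auto
  also have "\<dots> = 2 ^ 12 * (?n ^ 4 * p ^ 6) + 2 ^ 18 * (?n ^ 5 * p ^ 8) + 2 ^ 24 * (?n ^ 6 * p ^ 9)"
    by (simp add: choose_two power_mult_distrib)
  also have "\<dots> \<le> 2 ^ 24 * (?n ^ 4 * p ^ 6) + 2 ^ 24 * (?n ^ 5 * p ^ 8) + 2 ^ 24 * (?n ^ 6 * p ^ 9)"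
    using p by (intro add_mono mult_right_mono) auto
  finally have S: "(\<Sum>C\<in>?CC. p ^ card (covered_edges C)) \<le>
      2 ^ 24 * (?n ^ 4 * p ^ 6 + ?n ^ 5 * p ^ 8 + ?n ^ 6 * p ^ 9)"
    by (simp add: algebra_simps)
  have "{F \<in> configs V k. \<not> elementary F} = {F \<in> configs V k. \<exists>T\<in>F. ?P (component F T)}"
    by (auto simp: elementary_iff)
  then have "(\<Sum>F\<in>{F \<in> configs V k. \<not> elementary F}. p ^ card (covered_edges F))
      \<le> (\<Sum>C\<in>?CC. p ^ card (covered_edges C)) * weight_sum V p k"
    using weight_with_cluster[of ?P] by simp
  also have "\<dots> \<le> 2 ^ 24 * (?n ^ 4 * p ^ 6 + ?n ^ 5 * p ^ 8 + ?n ^ 6 * p ^ 9) * weight_sum V p k"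
    using S p by (intro mult_right_mono weight_sum_nonneg) auto
  finally show ?thesis .
qed

end

section \<open>Trading an edge-disjoint triangle for a diamond\<close>

definition packings :: "'a set \<Rightarrow> nat \<Rightarrow> 'a set set set" where
  "packings V k = {F \<in> configs V k. edge_disjoint F}"

lemma finite_packings: "finite V \<Longrightarrow> finite (packings V k)"
  by (simp add: packings_def finite_configs)

lemma packingsD:
  assumes "F \<in> packings V k"
  shows "F \<in> configs V k" "edge_disjoint F" "F \<subseteq> triples V" "card F = k" "finite V \<Longrightarrow> finite F"
  using assms configsD(1,2)[of F V k] finite_subset[OF _ finite_triples, of F V]
  by (auto simp: packings_def)

lemma card_covered_packing:
  assumes V: "finite V" and F: "F \<in> packings V k"
  shows "card (covered_edges F) = 3 * k"
proof -
  have FC: "F \<in> configs V k" and dis: "edge_disjoint F" using F by (auto simp: packings_def)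
  note FD = configsD[OF FC]
  have finF: "finite F" using FD(1) finite_triples[OF V] finite_subset by blast
  have T3: "card (pairs T) = 3" if "T \<in> F" for T
    using card_pairs_triple[of T] that FD(1) by (auto simp: triples_def)
  then have T3': "finite (pairs T)" if "T \<in> F" for T
    using that by (intro card_ge_0_finite) simp
  have "card (covered_edges F) = (\<Sum>T\<in>F. card (pairs T))"
    unfolding covered_edges_def
    by (rule card_UN_disjoint) (use finF T3' dis in \<open>auto simp: edge_disjoint_def share_edge_def\<close>)
  also have "\<dots> = (\<Sum>T\<in>F. 3)" by (rule sum.cong) (use T3 in auto)
  finally show ?thesis using FD(2) by simp
qed

text \<open>
  A triangle of a packing can be removed, and the packing is recovered from the removed triangle.
\<close>

lemma packings_Suc:
  assumes V: "finite V"
  shows "Suc m * card (packings V (Suc m)) \<le> (card V choose 3) * card (packings V m)"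
proof -
  let ?A = "Sigma (packings V (Suc m)) (\<lambda>F. F)"
  have cardA: "card ?A = Suc m * card (packings V (Suc m))"
  proof -
    have "card ?A = (\<Sum>F\<in>packings V (Suc m). card F)"
    proof (rule card_SigmaI)
      show "\<forall>F\<in>packings V (Suc m). finite F"
        using packingsD(5) V by blast
    qed (simp add: finite_packings V)
    also have "\<dots> = (\<Sum>F\<in>packings V (Suc m). Suc m)"
      by (rule sum.cong) (simp_all add: packingsD(4))
    finally show ?thesis by simp
  qed
  have "inj_on (\<lambda>(F, T). (F - {T}, T)) ?A"
    by (rule inj_onI) auto
  moreover have "(\<lambda>(F, T). (F - {T}, T)) ` ?A \<subseteq> packings V m \<times> triples V"
  proof clarsimp
    fix F T assume F: "F \<in> packings V (Suc m)" and T: "T \<in> F"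
    have FC: "F \<in> configs V (Suc m)" and dis: "edge_disjoint F" using F by (auto simp: packings_def)
    have "covered_edges {T} \<inter> covered_edges (F - {T}) = {}"
      using dis T unfolding edge_disjoint_def share_edge_def covered_edges_def by blast
    then have "F - {T} \<in> configs V m"
      using config_split(2)[OF V FC, of "{T}"] T by simp
    moreover have "edge_disjoint (F - {T})" using dis by (auto simp: edge_disjoint_def)
    moreover have "T \<in> triples V" using configsD(1)[OF FC] T by blast
    ultimately show "F - {T} \<in> packings V m \<and> T \<in> triples V" by (simp add: packings_def)
  qed
  ultimately have "card ?A \<le> card (packings V m \<times> triples V)"
    using V by (intro card_inj_on_le) (auto simp: finite_packings finite_triples)
  then show ?thesis using cardA by (simp add: card_cartesian_product card_triples[OF V] mult.commute)
qed

text \<open>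
  The bound on the number of triangles that share an edge with another one records that there is a single
  diamond, so that only two of its triangles can have been added last.
\<close>

definition one_diamond :: "'a set \<Rightarrow> nat \<Rightarrow> 'a set set set" where
  "one_diamond V m = {F \<in> configs V (Suc m). card (covered_edges F) = 3 * m + 2 \<and>
     card {T \<in> F. \<exists>S\<in>F. S \<noteq> T \<and> share_edge S T} \<le> 2}"

lemma packing_attach:
  assumes V: "finite V" and F: "F \<in> packings V m" and e: "e \<in> covered_edges F" and x: "x \<in> V - \<Union>F"
  shows "insert (insert x e) F \<in> one_diamond V m" "insert x e \<notin> F"
    "pairs (insert x e) \<inter> covered_edges F = {e}" "x \<notin> e"
    "\<exists>S\<in>F. S \<noteq> insert x e \<and> share_edge S (insert x e)"
proof -
  have FC: "F \<in> configs V m" and dis: "edge_disjoint F" using F by (auto simp: packings_def)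
  note FD = configsD[OF FC]
  obtain S where S: "S \<in> F" "e \<in> pairs S" using e by (auto simp: covered_edges_def)
  then have e2: "card e = 2" "e \<subseteq> S" by (auto simp: pairs_def)
  then obtain a b where ab: "e = {a, b}" "a \<noteq> b" by (auto simp: card_2_iff)
  show xe: "x \<notin> e" using x S e2 by blast
  let ?T = "insert x e"
  have T: "?T = {a, b, x}" using ab by auto
  have "S \<subseteq> V" using S FD(1) by (auto simp: triples_def)
  then have Tr: "?T \<in> triples V" using x xe e2 by (auto simp: triples_def ab)
  have x': "x \<notin> \<Union>F" using x by blast
  note new = attach_triangle_new[OF V FC Tr T _ x', folded ab(1), OF e]
  show nT: "?T \<notin> F" by (rule new(2))
  show meet: "pairs ?T \<inter> covered_edges F = {e}" by (rule new(5))
  have eT: "e \<in> pairs ?T" using meet by blast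
  then have "e \<in> pairs S \<inter> pairs ?T" using S(2) by simp
  then have "share_edge S ?T" unfolding share_edge_def by (metis empty_iff)
  moreover have "S \<noteq> ?T" using S(1) nT by metis
  ultimately show "\<exists>S\<in>F. S \<noteq> ?T \<and> share_edge S ?T" using S(1) by metis
  have "{R \<in> insert ?T F. \<exists>S\<in>insert ?T F. S \<noteq> R \<and> share_edge S R} \<subseteq> {?T, S}"
  proof
    fix R assume R: "R \<in> {R \<in> insert ?T F. \<exists>S\<in>insert ?T F. S \<noteq> R \<and> share_edge S R}"
    show "R \<in> {?T, S}"
    proof (cases "R = ?T")
      case False
      then have RF: "R \<in> F" using R by blast
      obtain R' where R': "R' \<in> insert ?T F" "R' \<noteq> R" "share_edge R' R" using R by blast
      have "R' = ?T" using R' RF dis by (auto simp: edge_disjoint_def)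
      then obtain f where f: "f \<in> pairs ?T" "f \<in> pairs R" using R'(3) by (auto simp: share_edge_def)
      then have "f \<in> covered_edges F" using RF by (auto simp: covered_edges_def)
      then have "f = e" using f(1) meet by blast
      then have "share_edge S R" using f(2) S(2) by (auto simp: share_edge_def)
      then have "S = R" using dis S RF by (auto simp: edge_disjoint_def)
      then show ?thesis by simp
    qed simp
  qed
  then have "card {R \<in> insert ?T F. \<exists>S\<in>insert ?T F. S \<noteq> R \<and> share_edge S R} \<le> card {?T, S}"
    by (intro card_mono) auto
  also have "\<dots> \<le> 2" by (simp add: card_insert_if)
  finally show "insert ?T F \<in> one_diamond V m"
    using new(1,4) card_covered_packing[OF V F] by (simp add: one_diamond_def)
qed

text \<open>
  Glue a triangle to one of the \<open>3 * m\<close> edges of a packing along an unused vertex. The result and the added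
  triangle determine the packing, the edge and the vertex, and the added triangle is one of at most two.
\<close>

lemma packings_one_diamond:
  assumes V: "finite V"
  shows "card (packings V m) * (3 * m * (card V - 3 * m)) \<le> 2 * card (one_diamond V m)"
proof -
  let ?Z = "Sigma (packings V m) (\<lambda>F. covered_edges F \<times> (V - \<Union>F))"
  let ?Y = "Sigma (one_diamond V m) (\<lambda>F. {T \<in> F. \<exists>S\<in>F. S \<noteq> T \<and> share_edge S T})"
  let ?f = "\<lambda>(F, e, x). (insert (insert x e) F, insert x e)"
  have finF: "finite F" "F \<subseteq> triples V" if "F \<in> configs V i" for F i
    using configsD(1)[OF that] finite_triples[OF V] finite_subset by blast+
  have fin1: "finite (one_diamond V m)" by (simp add: one_diamond_def finite_configs[OF V])
  have finY: "finite ?Y"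
    by (intro finite_SigmaI fin1) (auto simp: one_diamond_def dest: finF)
  have "card (packings V m) * (3 * m * (card V - 3 * m)) = (\<Sum>F\<in>packings V m. 3 * m * (card V - 3 * m))"
    by simp
  also have "\<dots> \<le> (\<Sum>F\<in>packings V m. card (covered_edges F \<times> (V - \<Union>F)))"
  proof (rule sum_mono)
    fix F assume F: "F \<in> packings V m"
    then have FC: "F \<in> configs V m" by (simp add: packings_def)
    have "card (\<Union>F) \<le> 3 * m"
      using card_Union_triples_le[OF finF[OF FC]] configsD(2)[OF FC] by simp
    moreover have "card V - card (\<Union>F) \<le> card (V - \<Union>F)"
      by (rule diff_card_le_card_Diff) (use finF[OF FC] V in \<open>auto simp: triples_def intro: finite_subset\<close>)
    ultimately show "3 * m * (card V - 3 * m) \<le> card (covered_edges F \<times> (V - \<Union>F))"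
      unfolding card_cartesian_product card_covered_packing[OF V F] by (intro mult_left_mono) auto
  qed
  also have "\<dots> = card ?Z"
    by (rule card_SigmaI[symmetric])
      (use V finite_covered[OF V packingsD(3)] in \<open>auto simp: finite_packings\<close>)
  also have "\<dots> \<le> card ?Y"
  proof (rule card_inj_on_le[OF _ _ finY])
    show "inj_on ?f ?Z"
    proof (rule inj_onI)
      fix y z assume yz: "y \<in> ?Z" "z \<in> ?Z" "?f y = ?f z"
      obtain F e x where y: "y = (F, e, x)" "F \<in> packings V m" "e \<in> covered_edges F" "x \<in> V - \<Union>F"
        using yz(1) by auto
      obtain G f u where z: "z = (G, f, u)" "G \<in> packings V m" "f \<in> covered_edges G" "u \<in> V - \<Union>G"
        using yz(2) by auto
      have T: "insert x e = insert u f" and I: "insert (insert x e) F = insert (insert u f) G"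
        using yz(3) y z by auto
      note aF = packing_attach[OF V y(2-4)] and aG = packing_attach[OF V z(2-4)]
      have FG: "F = G" using I aF(2) aG(2) T by (metis insert_ident)
      then have "e = f" using aF(3) aG(3) T by auto
      then have "x = u" using T aF(4) aG(4) by blast
      then show "y = z" using y z FG \<open>e = f\<close> by simp
    qed
    show "?f ` ?Z \<subseteq> ?Y"
    proof
      fix w assume "w \<in> ?f ` ?Z"
      then obtain F e x where w: "w = (insert (insert x e) F, insert x e)"
        and y: "F \<in> packings V m" "e \<in> covered_edges F" "x \<in> V - \<Union>F" by auto
      show "w \<in> ?Y" using packing_attach[OF V y] unfolding w by auto
    qed
  qed
  also have "\<dots> = (\<Sum>F\<in>one_diamond V m. card {T \<in> F. \<exists>S\<in>F. S \<noteq> T \<and> share_edge S T})"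
    by (rule card_SigmaI) (use fin1 finF in \<open>auto simp: one_diamond_def\<close>)
  also have "\<dots> \<le> (\<Sum>F\<in>one_diamond V m. 2)"
    by (rule sum_mono) (simp add: one_diamond_def)
  finally show ?thesis by simp
qed

text \<open>
  Passing from \<open>Suc m\<close> triangles in a packing to \<open>m\<close> and then to a single diamond keeps the number of
  triangles and replaces \<open>3 * Suc m\<close> edges by \<open>3 * m + 2\<close>, which gains the factor \<open>p\<close> on the right.
\<close>

lemma weight_packings:
  fixes p :: real
  assumes V: "finite V" and p: "0 \<le> p"
  shows "real (Suc m) * (real (3 * m) * real (card V - 3 * m)) *
      (\<Sum>F\<in>packings V (Suc m). p ^ card (covered_edges F))
    \<le> 2 * real (card V choose 3) * p * weight_sum V p (Suc m)"
proof -
  let ?c = "3 * m * (card V - 3 * m)"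
  have "Suc m * card (packings V (Suc m)) * ?c \<le> (card V choose 3) * card (packings V m) * ?c"
    by (intro mult_right_mono packings_Suc V) auto
  also have "\<dots> = (card V choose 3) * (card (packings V m) * ?c)" by simp
  also have "\<dots> \<le> (card V choose 3) * (2 * card (one_diamond V m))"
    by (intro mult_left_mono packings_one_diamond V) auto
  finally have "real (Suc m * card (packings V (Suc m)) * ?c)
      \<le> real ((card V choose 3) * (2 * card (one_diamond V m)))"
    by (rule of_nat_mono)
  then have count: "real (Suc m) * real ?c * real (card (packings V (Suc m)))
      \<le> 2 * real (card V choose 3) * real (card (one_diamond V m))"
    by (simp only: of_nat_mult of_nat_numeral mult_ac)
  have "(\<Sum>F\<in>packings V (Suc m). p ^ card (covered_edges F)) =
      (\<Sum>F\<in>packings V (Suc m). p ^ (3 * Suc m))"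
    by (intro sum.cong refl) (simp add: card_covered_packing[OF V])
  then have P: "(\<Sum>F\<in>packings V (Suc m). p ^ card (covered_edges F)) =
      real (card (packings V (Suc m))) * (p * p ^ (3 * m + 2))"
    by (simp add: power_add mult_ac power2_eq_square power3_eq_cube)
  have "real (card (one_diamond V m)) * p ^ (3 * m + 2) =
      (\<Sum>F\<in>one_diamond V m. p ^ card (covered_edges F))"
    by (simp add: one_diamond_def)
  also have "\<dots> \<le> weight_sum V p (Suc m)"
    unfolding weight_sum_def using p
    by (intro sum_mono2) (auto simp: finite_configs[OF V] one_diamond_def)
  finally have D: "real (card (one_diamond V m)) * p ^ (3 * m + 2) \<le> weight_sum V p (Suc m)" .
  have "real (Suc m) * real ?c * (\<Sum>F\<in>packings V (Suc m). p ^ card (covered_edges F))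
      = (real (Suc m) * real ?c * real (card (packings V (Suc m)))) * (p * p ^ (3 * m + 2))"
    unfolding P by simp
  also have "\<dots> \<le> (2 * real (card V choose 3) * real (card (one_diamond V m))) * (p * p ^ (3 * m + 2))"
    using count p by (intro mult_right_mono) auto
  also have "\<dots> = 2 * real (card V choose 3) * p * (real (card (one_diamond V m)) * p ^ (3 * m + 2))"
    by (simp add: mult_ac)
  also have "\<dots> \<le> 2 * real (card V choose 3) * p * weight_sum V p (Suc m)"
    using D p by (intro mult_left_mono) auto
  finally show ?thesis by (simp only: of_nat_mult of_nat_numeral mult_ac)
qed

section \<open>Weight of the elementary configurations\<close>

lemma card_elementary_shape: "elementary_shape C \<Longrightarrow> card C \<le> 3 \<and> finite C"
  by (auto simp: elementary_shape_def isolated_triangle_def diamond_def piglet_def three_book_def card_insert_if)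

lemma component_eqI:
  assumes F: "F \<subseteq> triples V" and ST: "S \<in> F" "T \<in> F"
    and e: "e \<in> covered_edges (component F S)" "e \<in> covered_edges (component F T)"
  shows "component F S = component F T"
proof -
  obtain A B where AB: "A \<in> component F S" "B \<in> component F T" "e \<in> pairs A" "e \<in> pairs B"
    using e by (auto simp: covered_edges_def)
  have "B \<in> F" using AB(2) component_subset[OF ST(2)] by blast
  moreover have "share_edge A B" using AB by (auto simp: share_edge_def)
  ultimately have "B \<in> component F S" using component_closed[OF F ST(1) AB(1)] by blast
  then show ?thesis using component_eq AB(2) by metis
qed

text \<open>
  A configuration is determined by the set of its components, and its weight is the product of their
  weights \<open>w C\<close>. Summing over arbitrary sets of connected configurations with at most three triangles
  gives the product of all \<open>1 + w C\<close>, hence the exponential of the sum of all \<open>w C\<close>. This sum is bounded by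
  exploring from single triangles; at most 9 vertices occur, so \<open>p\<close> need not be compared with \<open>k\<close>.
\<close>

lemma weight_elementary:
  fixes p :: real
  assumes V: "finite V" and p: "0 \<le> p" "p \<le> 1"
    and small: "real (card V) * p^2 + 9 * p \<le> 1 / 8"
  shows "(\<Sum>F\<in>elem_configs V k. p ^ card (covered_edges F)) \<le> exp (8 * (real (card V choose 3) * p ^ 3))"
proof -
  let ?CC = "clusters V 3 (\<lambda>_. True)"
  define w where "w C = p ^ card (covered_edges C)" for C :: "'a set set"
  have finCC: "finite ?CC" by (rule finite_clusters[OF V])
  have wpos: "0 \<le> w C" for C using p by (simp add: w_def)
  have tot: "sum w ?CC \<le> 8 * (real (card V choose 3) * p ^ 3)"
  proof -
    have "sum w ?CC \<le> (\<Sum>E\<in>pairs ` triples V. (2 * p) ^ card E)"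
      unfolding w_def
    proof (rule sum_clusters_le[OF V p])
      show "real (card V) * p^2 + real (3 * 3) * p \<le> 1 / 8" using small by simp
      show "finite (pairs ` triples V)" using finite_triples[OF V] by simp
      show "E \<subseteq> pairs V" if "E \<in> pairs ` triples V" for E
        using that by (auto simp: triples_def pairs_def)
      fix C assume C: "C \<in> ?CC"
      then obtain T where T: "T \<in> C" by (auto simp: clusters_def)
      moreover have "T \<in> triples V" using C T configsD(1) by (auto simp: clusters_def)
      ultimately show "\<exists>S\<subseteq>C. S \<noteq> {} \<and> covered_edges S \<in> pairs ` triples V"
        by (intro exI[of _ "{T}"]) (auto simp: covered_edges_def)
    qed
    also have "\<dots> = (\<Sum>E\<in>pairs ` triples V. (2 * p) ^ 3)"
      by (rule sum.cong) (auto simp: triples_card card_pairs_triple)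
    also have "\<dots> = real (card (pairs ` triples V)) * (2 * p) ^ 3" by simp
    also have "\<dots> \<le> real (card V choose 3) * (2 * p) ^ 3"
      using card_image_le[OF finite_triples[OF V], of pairs] p card_triples[OF V]
      by (intro mult_right_mono) auto
    finally show ?thesis by (simp add: power_mult_distrib)
  qed
  have comps: "edge_components F \<subseteq> ?CC" "\<Union>(edge_components F) = F"
    "(\<Prod>C\<in>edge_components F. w C) = p ^ card (covered_edges F)" if F: "F \<in> elem_configs V k" for F
  proof -
    have FC: "F \<in> configs V k" and el: "elementary F" using F by (auto simp: elem_configs_def)
    note FD = configsD[OF FC]
    have finF: "finite F" using FD(1) finite_triples[OF V] finite_subset by blast
    show "edge_components F \<subseteq> ?CC"
    proof
      fix C assume "C \<in> edge_components F"
      then obtain T where T: "T \<in> F" "C = component F T" by (auto simp: edge_components_eq)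
      then have "elementary_shape C" using el by (simp add: elementary_iff)
      then have "card C \<le> 3" using card_elementary_shape by blast
      moreover have "C \<in> clusters V k (\<lambda>_. True)" using component_in_clusters[OF V FC T(1)] T(2) by simp
      ultimately show "C \<in> ?CC" by (simp add: clusters_def)
    qed
    show U: "\<Union>(edge_components F) = F"
      using component_self component_subset by (fastforce simp: edge_components_eq)
    have "covered_edges F = (\<Union>C\<in>edge_components F. covered_edges C)"
      by (subst U[symmetric]) (auto simp: covered_edges_def)
    also have "card \<dots> = (\<Sum>C\<in>edge_components F. card (covered_edges C))"
    proof (rule card_UN_disjoint)
      show "finite (edge_components F)" using finF by (simp add: edge_components_eq)
      have "finite (covered_edges (component F T))" if "T \<in> F" for T
        using component_subset[OF that] FD(1) by (intro finite_covered[OF V]) blast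
      then show "\<forall>C\<in>edge_components F. finite (covered_edges C)"
        by (simp add: edge_components_eq)
      have "covered_edges (component F S) \<inter> covered_edges (component F T) = {}"
        if "S \<in> F" "T \<in> F" "component F S \<noteq> component F T" for S T
        using component_eqI[OF FD(1) that(1,2)] that(3) by (metis disjoint_iff)
      then show "\<forall>C\<in>edge_components F. \<forall>D\<in>edge_components F. C \<noteq> D \<longrightarrow> covered_edges C \<inter> covered_edges D = {}"
        by (simp add: edge_components_eq)
    qed
    finally show "(\<Prod>C\<in>edge_components F. w C) = p ^ card (covered_edges F)"
      by (simp add: w_def power_sum)
  qed
  have "inj_on edge_components (elem_configs V k)"
    using comps(2) by (metis inj_onI)
  then have "(\<Sum>F\<in>elem_configs V k. p ^ card (covered_edges F)) =
      (\<Sum>X\<in>edge_components ` elem_configs V k. \<Prod>C\<in>X. w C)"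
    by (simp add: sum.reindex comps(3))
  also have "\<dots> \<le> (\<Sum>X\<in>Pow ?CC. \<Prod>C\<in>X. w C)"
    using comps(1) finCC wpos by (intro sum_mono2) (auto intro: prod_nonneg)
  also have "\<dots> = (\<Prod>C\<in>?CC. w C + 1)"
    using prod_add[OF finCC, of w "\<lambda>_. 1"] by simp
  also have "\<dots> \<le> (\<Prod>C\<in>?CC. exp (w C))"
    using wpos by (intro prod_mono) (auto simp: add.commute)
  also have "\<dots> = exp (sum w ?CC)" by (simp add: exp_sum finCC)
  also have "\<dots> \<le> exp (8 * (real (card V choose 3) * p ^ 3))" using tot by simp
  finally show ?thesis .
qed

section \<open>Fans\<close>

text \<open>
  Triangles with a common vertex \<open>x\<close>, one for each pair in \<open>M\<close>. The graph formed by the pairs is to be bipartite.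
\<close>

definition fan :: "'a \<Rightarrow> ('a \<times> 'a) set \<Rightarrow> 'a set set" where
  "fan x M = (\<lambda>(a, b). {x, a, b}) ` M"

context
  fixes V A B :: "'a set" and x :: 'a and s :: nat
  assumes V: "finite V" and x: "x \<in> V" "x \<notin> A" "x \<notin> B"
    and A: "A \<subseteq> V" "card A = s" and B: "B \<subseteq> V" "card B = s" and AB: "A \<inter> B = {}"
begin

lemma fan_inj: "inj_on (\<lambda>(a, b). {x, a, b}) (A \<times> B)"
proof (rule inj_onI, clarify)
  fix a b c d assume h: "a \<in> A" "b \<in> B" "c \<in> A" "d \<in> B" "{x, a, b} = {x, c, d}"
  have "{x, a, b} \<inter> A = {a}" "{x, c, d} \<inter> A = {c}" "{x, a, b} \<inter> B = {b}" "{x, c, d} \<inter> B = {d}"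
    using h(1-4) x AB by auto
  then show "a = c \<and> b = d" using h(5) by (metis singleton_inject)
qed

lemma fan_edges:
  assumes M: "M \<subseteq> A \<times> B"
  shows "covered_edges (fan x M) = (\<Union>m\<in>M. {{x, fst m}, {x, snd m}, {fst m, snd m}})"
proof -
  have "pairs {x, a, b} = {{x, a}, {x, b}, {a, b}}" if "(a, b) \<in> M" for a b
    using that M x AB by (intro pairs_triple) auto
  then have "pairs {x, fst m, snd m} = {{x, fst m}, {x, snd m}, {fst m, snd m}}" if "m \<in> M" for m
    using that by simp
  then show ?thesis by (simp add: covered_edges_def fan_def case_prod_unfold)
qed

text \<open>
  A triangle through \<open>x\<close> is given by a pair in \<open>M\<close>, and there is no other one since \<open>M\<close> is bipartite.
\<close>

lemma fan_config:
  assumes M: "M \<subseteq> A \<times> B"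
  shows "fan x M \<in> configs V (card M)"
proof (rule configsI)
  note cov = fan_edges[OF M]
  show "card (fan x M) = card M"
    unfolding fan_def by (rule card_image) (rule inj_on_subset[OF fan_inj M])
  have "{x, a, b} \<in> triples V" if "(a, b) \<in> M" for a b
  proof -
    have "a \<in> A" "b \<in> B" using that M by auto
    then have "a \<noteq> b" "x \<noteq> a" "x \<noteq> b" "{x, a, b} \<subseteq> V" using x A B AB by auto
    then show ?thesis by (simp add: triples_def)
  qed
  then show "fan x M \<subseteq> triples V" by (auto simp: fan_def)
  have edge: "(u, w) \<in> M \<or> (w, u) \<in> M"
    if uw: "{u, w} \<in> covered_edges (fan x M)" "u \<noteq> x" "w \<noteq> x" for u w
  proof -
    obtain m where "m \<in> M" "{u, w} \<in> {{x, fst m}, {x, snd m}, {fst m, snd m}}"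
      using uw(1) unfolding cov by blast
    then obtain a b where "(a, b) \<in> M" "{u, w} \<in> {{x, a}, {x, b}, {a, b}}"
      by (metis prod.collapse)
    then show ?thesis using uw(2,3) by (auto simp: doubleton_eq_iff)
  qed
  fix R assume R: "R \<in> triples V" "pairs R \<subseteq> covered_edges (fan x M)"
  then obtain u v w where uvw: "R = {u, v, w}" "u \<noteq> v" "u \<noteq> w" "v \<noteq> w"
    by (auto simp: triples_def card_3_iff)
  have e: "{u, v} \<in> covered_edges (fan x M)" "{u, w} \<in> covered_edges (fan x M)" "{v, w} \<in> covered_edges (fan x M)"
    using R(2) uvw by (auto simp: pairs_triple)
  have fanI: "{x, a, b} \<in> fan x M" if "(a, b) \<in> M \<or> (b, a) \<in> M" for a b
    using that by (auto simp: fan_def image_iff insert_commute intro: bexI[of _ "(a, b)"] bexI[of _ "(b, a)"])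
  consider "u = x" | "v = x" | "w = x" | "u \<noteq> x" "v \<noteq> x" "w \<noteq> x" by blast
  then show "R \<in> fan x M"
  proof cases
    case 1
    then show ?thesis using fanI[OF edge[OF e(3)]] uvw by simp
  next
    case 2
    then show ?thesis using fanI[OF edge[OF e(2)]] uvw by (simp add: insert_commute)
  next
    case 3
    then show ?thesis using fanI[OF edge[OF e(1)]] uvw by (simp add: insert_commute)
  next
    case 4
    then have "(u, v) \<in> M \<or> (v, u) \<in> M" "(u, w) \<in> M \<or> (w, u) \<in> M" "(v, w) \<in> M \<or> (w, v) \<in> M"
      using edge e by auto
    then show ?thesis using M AB by blast
  qed
qed

lemma card_fan_edges_le:
  assumes M: "M \<subseteq> A \<times> B" and fin: "finite M"
  shows "card (covered_edges (fan x M)) \<le> 2 * s + card M"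
proof -
  let ?X = "(\<lambda>a. {x, a}) ` A" and ?Y = "(\<lambda>b. {x, b}) ` B" and ?Z = "(\<lambda>(a, b). {a, b}) ` M"
  have finAB: "finite A" "finite B" using V A B finite_subset by blast+
  have "covered_edges (fan x M) \<subseteq> ?X \<union> (?Y \<union> ?Z)"
    unfolding fan_edges[OF M] using M by force
  then have "card (covered_edges (fan x M)) \<le> card (?X \<union> (?Y \<union> ?Z))"
    using finAB fin by (intro card_mono) auto
  also have "\<dots> \<le> card ?X + (card ?Y + card ?Z)"
    by (meson card_Un_le le_trans nat_add_left_cancel_le)
  also have "\<dots> \<le> s + (s + card M)"
    using card_image_le[OF finAB(1)] card_image_le[OF finAB(2)] card_image_le[OF fin] A B
    by (intro add_mono) auto
  finally show ?thesis by simp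
qed

text \<open>
  All triangles that contain both \<open>x\<close> and a fixed \<open>a \<in> A\<close> lie in one component. If components have at most
  three triangles, then every \<open>a\<close> is in at most three pairs, and there are at most \<open>3 * s\<close> pairs.
\<close>

lemma fan_not_elementary:
  assumes M: "M \<subseteq> A \<times> B" and large: "3 * s < card M"
  shows "\<not> elementary (fan x M)"
proof
  assume el: "elementary (fan x M)"
  have finAB: "finite A" "finite B" using V A B finite_subset by blast+
  then have finM: "finite M" using M finite_subset by blast
  note tr = configsD(1)[OF fan_config[OF M]]
  have deg: "card (M `` {a}) \<le> 3" for a
  proof (cases "M `` {a} = {}")
    case False
    then obtain b where b: "(a, b) \<in> M" by blast
    let ?T = "\<lambda>b. {x, a, b}"
    have F: "?T c \<in> fan x M" if "c \<in> M `` {a}" for c using that by (auto simp: fan_def)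
    have ax: "a \<noteq> x" using b M x by auto
    have "share_edge (?T b) (?T c)" for c
      using ax in_pairs[of x a "?T b"] in_pairs[of x a "?T c"] by (auto simp: share_edge_def)
    then have sub: "?T ` (M `` {a}) \<subseteq> component (fan x M) (?T b)"
      using component_closed[OF tr F component_self F] b by blast
    have shp: "elementary_shape (component (fan x M) (?T b))"
      using el F b by (auto simp: elementary_iff)
    have "inj_on ?T (M `` {a})"
    proof (rule inj_onI)
      fix c d assume "c \<in> M `` {a}" "d \<in> M `` {a}" "?T c = ?T d"
      then show "c = d" using inj_onD[OF fan_inj, of "(a, c)" "(a, d)"] M by auto
    qed
    then have "card (M `` {a}) = card (?T ` (M `` {a}))" by (simp add: card_image)
    also have "\<dots> \<le> card (component (fan x M) (?T b))"
      using sub card_elementary_shape[OF shp] by (intro card_mono) auto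
    also have "\<dots> \<le> 3" using card_elementary_shape[OF shp] by simp
    finally show ?thesis .
  qed simp
  have "M = Sigma A (\<lambda>a. M `` {a})" using M by auto
  then have "card M = (\<Sum>a\<in>A. card (M `` {a}))"
    using card_SigmaI[of A "\<lambda>a. M `` {a}"] finAB finM by (metis finite_Image)
  also have "\<dots> \<le> (\<Sum>a\<in>A. 3)" using deg by (intro sum_mono)
  finally show False using large A by simp
qed

text \<open>
  Keeping \<open>A\<close> and \<open>B\<close> fixed already gives enough fans.
\<close>

lemma weight_fans:
  fixes p :: real
  assumes p: "0 \<le> p" "p \<le> 1" and k: "3 * s < k"
  shows "real (s^2 choose k) * p ^ (2 * s + k)
    \<le> (\<Sum>F\<in>{F \<in> configs V k. \<not> elementary F}. p ^ card (covered_edges F))"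
proof -
  let ?MM = "{M. M \<subseteq> A \<times> B \<and> card M = k}"
  have finAB: "finite (A \<times> B)" using V A B finite_subset by blast
  have inj: "inj_on (fan x) ?MM"
    using inj_on_image_Pow[OF fan_inj] unfolding fan_def by (rule inj_on_subset) auto
  have "card ?MM = (s^2 choose k)"
    using n_subsets[OF finAB, of k] A B by (simp add: card_cartesian_product power2_eq_square)
  then have "real (s^2 choose k) * p ^ (2 * s + k) = (\<Sum>M\<in>?MM. p ^ (2 * s + k))" by simp
  also have "\<dots> \<le> (\<Sum>M\<in>?MM. p ^ card (covered_edges (fan x M)))"
  proof (rule sum_mono)
    fix M assume M: "M \<in> ?MM"
    then have "card (covered_edges (fan x M)) \<le> 2 * s + k"
      using card_fan_edges_le[of M] finAB finite_subset by blast
    then show "p ^ (2 * s + k) \<le> p ^ card (covered_edges (fan x M))"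
      using p by (intro power_decreasing) auto
  qed
  also have "\<dots> = (\<Sum>F\<in>fan x ` ?MM. p ^ card (covered_edges F))"
    using inj by (simp add: sum.reindex)
  also have "\<dots> \<le> (\<Sum>F\<in>{F \<in> configs V k. \<not> elementary F}. p ^ card (covered_edges F))"
    using p k fan_config fan_not_elementary finite_configs[OF V]
    by (intro sum_mono2) auto
  finally show ?thesis .
qed

end

section \<open>Total variation distance\<close>

lemma tv_dist_finite:
  assumes A: "finite A" "set_pmf P \<subseteq> A" "set_pmf Q \<subseteq> A"
  shows "tv_dist P Q = 1 / 2 * (\<Sum>x\<in>A. \<bar>pmf P x - pmf Q x\<bar>)"
proof -
  have zero: "pmf P x = 0" "pmf Q x = 0" if "x \<notin> A" for x
    using that A(2,3) by (auto simp: set_pmf_iff)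
  have "(\<Sum>\<^sub>\<infinity>x. \<bar>pmf P x - pmf Q x\<bar>) = (\<Sum>\<^sub>\<infinity>x\<in>A. \<bar>pmf P x - pmf Q x\<bar>)"
    by (rule infsum_cong_neutral) (auto simp: zero)
  then show ?thesis using A by (simp add: tv_dist_def)
qed

lemma tv_dist_le_1:
  assumes A: "finite A" "set_pmf P \<subseteq> A" "set_pmf Q \<subseteq> A"
  shows "tv_dist P Q \<le> 1"
proof -
  have "(\<Sum>x\<in>A. \<bar>pmf P x - pmf Q x\<bar>) \<le> (\<Sum>x\<in>A. pmf P x + pmf Q x)"
    by (intro sum_mono) (smt (verit) pmf_nonneg)
  also have "\<dots> = 2" using A by (simp add: sum.distrib sum_pmf_eq_1)
  finally show ?thesis using tv_dist_finite[OF A] by simp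
qed

lemma tv_dist_nonneg:
  assumes A: "finite A" "set_pmf P \<subseteq> A" "set_pmf Q \<subseteq> A"
  shows "0 \<le> tv_dist P Q"
  unfolding tv_dist_finite[OF A] by (simp add: sum_nonneg)

lemma tv_dist_ge_event:
  assumes A: "finite A" "set_pmf P \<subseteq> A" "set_pmf Q \<subseteq> A" and D: "D \<subseteq> A"
  shows "(\<Sum>x\<in>D. pmf Q x) - (\<Sum>x\<in>D. pmf P x) \<le> tv_dist P Q"
proof -
  have split: "(\<Sum>x\<in>A. g x) = (\<Sum>x\<in>D. g x) + (\<Sum>x\<in>A - D. g x)" for g :: "'a \<Rightarrow> real"
    using sum.subset_diff[OF D A(1), of g] by simp
  have 1: "(\<Sum>x\<in>D. pmf Q x) - (\<Sum>x\<in>D. pmf P x) \<le> (\<Sum>x\<in>D. \<bar>pmf P x - pmf Q x\<bar>)"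
    unfolding sum_subtractf[symmetric] by (intro sum_mono) simp
  have 2: "(\<Sum>x\<in>A - D. pmf P x) - (\<Sum>x\<in>A - D. pmf Q x) \<le> (\<Sum>x\<in>A - D. \<bar>pmf P x - pmf Q x\<bar>)"
    unfolding sum_subtractf[symmetric] by (intro sum_mono) simp
  show ?thesis
    using 1 2 split[of "\<lambda>x. \<bar>pmf P x - pmf Q x\<bar>"] split[of "pmf P"] split[of "pmf Q"]
      sum_pmf_eq_1[OF A(1,2)] sum_pmf_eq_1[OF A(1,3)]
    unfolding tv_dist_finite[OF A] by linarith
qed

text \<open>
  On \<open>D\<close> both measures are constant, so there the distance is the difference of the total masses of \<open>D\<close>,
  which equals that of the complements.
\<close>

lemma tv_dist_le_common_part:
  assumes A: "finite A" "set_pmf P \<subseteq> A" "set_pmf Q \<subseteq> A" and D: "D \<subseteq> A"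
    and P: "\<And>x. x \<in> D \<Longrightarrow> pmf P x = c" and Q: "\<And>x. x \<in> D \<Longrightarrow> pmf Q x = d"
  shows "tv_dist P Q \<le> (\<Sum>x\<in>A - D. pmf P x) + (\<Sum>x\<in>A - D. pmf Q x)"
proof -
  have split: "(\<Sum>x\<in>A. g x) = (\<Sum>x\<in>D. g x) + (\<Sum>x\<in>A - D. g x)" for g :: "'a \<Rightarrow> real"
    using sum.subset_diff[OF D A(1), of g] by simp
  have "(\<Sum>x\<in>D. \<bar>pmf P x - pmf Q x\<bar>) = real (card D) * \<bar>c - d\<bar>" using P Q by simp
  also have "\<dots> = \<bar>real (card D) * c - real (card D) * d\<bar>"
    by (metis abs_mult abs_of_nat right_diff_distrib)
  also have "\<dots> = \<bar>(\<Sum>x\<in>D. pmf P x) - (\<Sum>x\<in>D. pmf Q x)\<bar>" using P Q by simp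
  finally have 1: "(\<Sum>x\<in>D. \<bar>pmf P x - pmf Q x\<bar>) = \<bar>(\<Sum>x\<in>D. pmf P x) - (\<Sum>x\<in>D. pmf Q x)\<bar>" .
  have 2: "(\<Sum>x\<in>A - D. \<bar>pmf P x - pmf Q x\<bar>) \<le> (\<Sum>x\<in>A - D. pmf P x) + (\<Sum>x\<in>A - D. pmf Q x)"
    unfolding sum.distrib[symmetric] by (intro sum_mono) (smt (verit) pmf_nonneg)
  have "0 \<le> (\<Sum>x\<in>A - D. pmf P x)" "0 \<le> (\<Sum>x\<in>A - D. pmf Q x)" by (simp_all add: sum_nonneg)
  then show ?thesis
    using 1 2 split[of "\<lambda>x. \<bar>pmf P x - pmf Q x\<bar>"] split[of "pmf P"] split[of "pmf Q"]
      sum_pmf_eq_1[OF A(1,2)] sum_pmf_eq_1[OF A(1,3)]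
    unfolding tv_dist_finite[OF A] by linarith
qed

text \<open>
  Conditioning moves exactly the mass outside \<open>S\<close> into \<open>S\<close>.
\<close>

lemma tv_dist_cond_pmf:
  assumes A: "finite A" "set_pmf P \<subseteq> A" and S: "S \<subseteq> A" "0 < (\<Sum>x\<in>S. pmf P x)"
  shows "tv_dist (cond_pmf P S) P = 1 - (\<Sum>x\<in>S. pmf P x)"
proof -
  let ?s = "\<Sum>x\<in>S. pmf P x"
  have finS: "finite S" using A S finite_subset by blast
  have ne: "set_pmf P \<inter> S \<noteq> {}"
    using S(2) by (metis disjoint_iff less_irrefl set_pmf_iff sum.neutral)
  have ms: "measure (measure_pmf P) S = ?s" by (rule measure_measure_pmf_finite[OF finS])
  have s1: "?s \<le> 1" unfolding ms[symmetric] by simp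
  have cp: "pmf (cond_pmf P S) x = (if x \<in> S then pmf P x / ?s else 0)" for x
    using pmf_cond[OF ne, of x] ms by simp
  have sub: "set_pmf (cond_pmf P S) \<subseteq> A" using set_cond_pmf[OF ne] A by auto
  have "(\<Sum>x\<in>A. \<bar>pmf (cond_pmf P S) x - pmf P x\<bar>) =
      (\<Sum>x\<in>S. \<bar>pmf (cond_pmf P S) x - pmf P x\<bar>) + (\<Sum>x\<in>A - S. \<bar>pmf (cond_pmf P S) x - pmf P x\<bar>)"
    using sum.subset_diff[OF S(1) A(1), of "\<lambda>x. \<bar>pmf (cond_pmf P S) x - pmf P x\<bar>"] by simp
  also have "(\<Sum>x\<in>S. \<bar>pmf (cond_pmf P S) x - pmf P x\<bar>) = (\<Sum>x\<in>S. pmf P x / ?s - pmf P x)"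
  proof (rule sum.cong[OF refl])
    fix x assume "x \<in> S"
    have "pmf P x \<le> pmf P x / ?s" using S(2) s1 by (simp add: field_simps mult_left_le)
    then show "\<bar>pmf (cond_pmf P S) x - pmf P x\<bar> = pmf P x / ?s - pmf P x"
      using \<open>x \<in> S\<close> cp by simp
  qed
  also have "\<dots> = 1 - ?s" using S(2) by (simp add: sum_subtractf sum_divide_distrib[symmetric])
  also have "(\<Sum>x\<in>A - S. \<bar>pmf (cond_pmf P S) x - pmf P x\<bar>) = (\<Sum>x\<in>A - S. pmf P x)"
    using cp by (intro sum.cong) auto
  also have "\<dots> = 1 - ?s"
    using sum.subset_diff[OF S(1) A(1), of "pmf P"] sum_pmf_eq_1[OF A] by simp
  finally show ?thesis unfolding tv_dist_finite[OF A(1) sub A(2)] by simp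
qed

section \<open>Bounds for a fixed number of vertices\<close>

lemma packings_nonempty:
  assumes V: "finite V"
  shows "3 * k \<le> card V \<Longrightarrow> packings V k \<noteq> {}"
proof (induction k)
  case 0
  have "pairs T \<noteq> {}" if "T \<in> triples V" for T
    using card_pairs_triple[OF triples_card[OF that]] by auto
  then have "{} \<in> configs V 0" by (intro configsI) (auto simp: covered_edges_def)
  then have "{} \<in> packings V 0" by (simp add: packings_def edge_disjoint_def)
  then show ?case by blast
next
  case (Suc k)
  then have "packings V k \<noteq> {}" by simp
  then obtain F where F: "F \<in> packings V k" by blast
  note FD = configsD[OF packingsD(1)[OF F]]
  have finF: "finite F" using packingsD(5)[OF F V] .
  have finU: "finite (\<Union>F)" using FD(1) V by (intro finite_subset[of "\<Union>F" V]) (auto simp: triples_def)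
  have "card (\<Union>F) \<le> 3 * k" using card_Union_triples_le[OF finF FD(1)] FD(2) by simp
  then have "3 \<le> card V - card (\<Union>F)" using Suc.prems by simp
  also have "\<dots> \<le> card (V - \<Union>F)" by (rule diff_card_le_card_Diff[OF finU])
  finally obtain T where T: "T \<subseteq> V - \<Union>F" "card T = 3" by (metis obtain_subset_with_card_n)
  have Tr: "T \<in> triples V" using T by (auto simp: triples_def)
  have finT: "finite T" using T(2) by (auto intro: card_ge_0_finite)
  have disT: "T \<inter> \<Union>F = {}" using T by blast
  have nT: "T \<notin> F"
  proof
    assume "T \<in> F"
    then have "T = {}" using disT by blast
    then show False using T(2) by simp
  qed
  have covU: "e \<subseteq> \<Union>F" if "e \<in> covered_edges F" for e
    using that by (auto simp: covered_edges_def pairs_def)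
  have noshare: "\<not> share_edge S T" if "S \<in> F" for S
  proof
    assume "share_edge S T"
    then obtain e where "e \<subseteq> S" "e \<subseteq> T" "card e = 2" by (auto simp: share_edge_def pairs_def)
    then show False using that disT by (auto simp: card_2_iff)
  qed
  have "insert T F \<in> configs V (Suc k)"
  proof (rule configsI)
    show "insert T F \<subseteq> triples V" using Tr FD(1) by simp
    show "card (insert T F) = Suc k" using finF nT FD(2) by simp
    fix R assume R: "R \<in> triples V" "pairs R \<subseteq> covered_edges (insert T F)"
    show "R \<in> insert T F"
    proof (cases "R \<inter> T = {}")
      case True
      have "pairs R \<subseteq> covered_edges F"
      proof
        fix e assume e: "e \<in> pairs R"
        then have "e \<subseteq> R" "e \<noteq> {}" by (auto simp: pairs_def)
        then have "e \<notin> pairs T" using True by (auto simp: pairs_def)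
        then show "e \<in> covered_edges F" using e R(2) by (auto simp: covered_edges_insert)
      qed
      then show ?thesis using FD(3) R(1) by blast
    next
      case False
      then obtain x where x: "x \<in> R" "x \<in> T" by blast
      have "u \<in> T" if u: "u \<in> R" for u
      proof (cases "u = x")
        case False
        then have "{x, u} \<in> pairs R" using u x by (simp add: in_pairs)
        moreover have "{x, u} \<notin> covered_edges F" using covU[of "{x, u}"] x disT by auto
        ultimately have "{x, u} \<in> pairs T" using R(2) by (auto simp: covered_edges_insert)
        then show ?thesis by (simp add: in_pairs)
      qed (use x in simp)
      then have "R \<subseteq> T" by blast
      then have "R = T" using R(1) T(2) finT by (intro card_subset_eq) (auto simp: triples_def)
      then show ?thesis by simp
    qed
  qed
  moreover have "edge_disjoint (insert T F)"
    using packingsD(2)[OF F] noshare noshare[unfolded share_edge_commute[of _ T]]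
    by (simp add: edge_disjoint_def)
  ultimately show ?case by (auto simp: packings_def)
qed

lemma packing_elementary:
  assumes "F \<in> packings V k" shows "F \<in> elem_configs V k"
proof -
  have "\<not> edge_adjacent S T" if "S \<in> F" "T \<in> F" for S T
  proof -
    have "card S = 3" "card T = 3" using packingsD(3)[OF assms] that by (auto simp: triples_def)
    then show ?thesis
      using edge_adjacent_iff[of S T] packingsD(2)[OF assms] that unfolding edge_disjoint_def by metis
  qed
  then have "edge_adjacency F = {}" by (auto simp: edge_adjacency_def)
  then have "component F T = {T}" for T by (simp add: component_def)
  then have "elementary F"
    by (simp add: elementary_iff elementary_shape_def isolated_triangle_def)
  then show ?thesis using packingsD(1)[OF assms] by (simp add: elem_configs_def)
qed

context
  fixes V :: "'a set" and p :: real and k :: nat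
  assumes V: "finite V" and p: "0 < p" and k3: "3 * k \<le> card V"
begin

lemma configs_nonempty: "configs V k \<noteq> {}"
  using packings_nonempty[OF V k3] by (auto simp: packings_def)

lemma weight_sum_pos: "0 < weight_sum V p k"
  unfolding weight_sum_def
  by (rule sum_pos[OF finite_configs[OF V] configs_nonempty]) (use p in simp)

lemma pmf_unif: "F \<in> configs V k \<Longrightarrow> pmf (nu_unif V k) F = 1 / real (card (configs V k))"
  using configs_nonempty finite_configs[OF V] by (simp add: nu_unif_def)

lemma set_pmf_unif: "set_pmf (nu_unif V k) \<subseteq> configs V k"
  using configs_nonempty finite_configs[OF V] by (simp add: nu_unif_def)

lemma pmf_tilt:
  assumes "F \<in> configs V k"
  shows "pmf (nu_tilt V p k) F = p ^ card (covered_edges F) / weight_sum V p k"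
proof -
  let ?c = "1 / real (card (configs V k))"
  have c: "?c > 0" using configs_nonempty finite_configs[OF V] by (simp add: card_gt_0_iff)
  have w: "tilt_weight V p k G = ?c * p ^ card (covered_edges G)" if "G \<in> configs V k" for G
    using that by (simp add: tilt_weight_def pmf_unif)
  then have "(\<Sum>G\<in>configs V k. tilt_weight V p k G) = ?c * weight_sum V p k"
    by (simp add: weight_sum_def sum_distrib_left)
  then show ?thesis
    using pmf_nu_tilt[OF V configs_nonempty p, of F] w[OF assms] c by simp
qed

lemma set_pmf_tilt: "set_pmf (nu_tilt V p k) \<subseteq> configs V k"
proof
  fix F assume F: "F \<in> set_pmf (nu_tilt V p k)"
  show "F \<in> configs V k"
  proof (rule ccontr)
    assume "F \<notin> configs V k"
    then have "tilt_weight V p k F = 0"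
      using configs_nonempty finite_configs[OF V] by (simp add: tilt_weight_def nu_unif_def)
    then have "pmf (nu_tilt V p k) F = 0" using pmf_nu_tilt[OF V configs_nonempty p, of F] by simp
    then show False using F by (simp add: set_pmf_iff)
  qed
qed

lemma prob_tilt:
  assumes "X \<subseteq> configs V k"
  shows "(\<Sum>F\<in>X. pmf (nu_tilt V p k) F) = (\<Sum>F\<in>X. p ^ card (covered_edges F)) / weight_sum V p k"
  unfolding sum_divide_distrib using assms by (intro sum.cong refl pmf_tilt) blast

lemma prob_unif:
  assumes "X \<subseteq> configs V k"
  shows "(\<Sum>F\<in>X. pmf (nu_unif V k) F) = real (card X) / real (card (configs V k))"
proof -
  have "(\<Sum>F\<in>X. pmf (nu_unif V k) F) = (\<Sum>F\<in>X. 1 / real (card (configs V k)))"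
    using assms by (intro sum.cong refl pmf_unif) blast
  then show ?thesis by simp
qed

lemma tv_elem_eq:
  "tv_dist (nu_tilt_elem V p k) (nu_tilt V p k) =
    1 - (\<Sum>F\<in>elem_configs V k. p ^ card (covered_edges F)) / weight_sum V p k"
proof -
  have sub: "elem_configs V k \<subseteq> configs V k" by (auto simp: elem_configs_def)
  have ne: "elem_configs V k \<noteq> {}" using packings_nonempty[OF V k3] packing_elementary by blast
  have "finite (elem_configs V k)" using sub finite_configs[OF V] finite_subset by blast
  then have "0 < (\<Sum>F\<in>elem_configs V k. p ^ card (covered_edges F))"
    using ne p by (intro sum_pos) auto
  then have "0 < (\<Sum>F\<in>elem_configs V k. pmf (nu_tilt V p k) F)"
    using weight_sum_pos by (simp add: prob_tilt[OF sub])
  then show ?thesis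
    unfolding nu_tilt_elem_def
    using tv_dist_cond_pmf[OF finite_configs[OF V] set_pmf_tilt sub] prob_tilt[OF sub] by simp
qed

lemma weight_elem_split:
  "weight_sum V p k = (\<Sum>F\<in>elem_configs V k. p ^ card (covered_edges F))
     + (\<Sum>F\<in>{F \<in> configs V k. \<not> elementary F}. p ^ card (covered_edges F))"
proof -
  have "elem_configs V k \<subseteq> configs V k"
    and "configs V k - elem_configs V k = {F \<in> configs V k. \<not> elementary F}"
    by (auto simp: elem_configs_def)
  then show ?thesis unfolding weight_sum_def
    using sum.subset_diff[OF _ finite_configs[OF V], of "elem_configs V k" k
        "\<lambda>F. p ^ card (covered_edges F)"] by simp
qed

text \<open>
  The distance is the tilted probability of not being elementary; the quotient compares elementary configurations with fans.
\<close>

lemma tv_elem_ge_by_fans: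
  assumes p1: "p \<le> 1" and small: "real (card V) * p^2 + 9 * p \<le> 1 / 8"
    and s: "3 * s < k" "k \<le> s^2" "2 * s + 1 \<le> card V"
  shows "1 - exp (8 * (real (card V choose 3) * p ^ 3)) / (real (s^2 choose k) * p ^ (2 * s + k))
    \<le> tv_dist (nu_tilt_elem V p k) (nu_tilt V p k)"
proof -
  let ?el = "\<Sum>F\<in>elem_configs V k. p ^ card (covered_edges F)"
  let ?L = "real (s^2 choose k) * p ^ (2 * s + k)"
  obtain A where A: "A \<subseteq> V" "card A = s" using s(3) obtain_subset_with_card_n[of s V] by auto
  have finA: "finite A" using A V finite_subset by blast
  have "Suc s \<le> card (V - A)" using A V s(3) finA by (simp add: card_Diff_subset)
  then obtain B' where B': "B' \<subseteq> V - A" "card B' = Suc s" by (rule obtain_subset_with_card_n)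
  then obtain x where x: "x \<in> B'" by fastforce
  let ?B = "B' - {x}"
  have finB: "finite B'" using B' by (auto intro: card_ge_0_finite)
  have L: "?L \<le> (\<Sum>F\<in>{F \<in> configs V k. \<not> elementary F}. p ^ card (covered_edges F))"
  proof (rule weight_fans)
    show "x \<in> V" "x \<notin> A" "?B \<subseteq> V" "A \<inter> ?B = {}" using x B' by auto
    show "card ?B = s" using B' x finB by simp
  qed (use V A p p1 s in auto)
  have L0: "0 < ?L" using s p by simp
  have el0: "0 \<le> ?el" using p by (simp add: sum_nonneg)
  have LW: "?L \<le> weight_sum V p k" using L el0 unfolding weight_elem_split by linarith
  have "?el / weight_sum V p k \<le> ?el / ?L"
    by (rule divide_left_mono[OF LW el0 mult_pos_pos[OF weight_sum_pos L0]])
  also have "\<dots> \<le> exp (8 * (real (card V choose 3) * p ^ 3)) / ?L"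
    using L0 p p1 by (intro divide_right_mono weight_elementary[OF V _ _ small]) auto
  finally show ?thesis unfolding tv_elem_eq by simp
qed

lemma tv_elem_le:
  assumes p2: "2 * p \<le> 1"
    and k: "real k \<le> p ^ 3 * (real (card V choose 3) - 12 * real k^2 * real (card V))"
    and small: "real (card V) * p^2 + real (3 * k) * p \<le> 1 / 8"
  shows "tv_dist (nu_tilt_elem V p k) (nu_tilt V p k)
    \<le> 2 ^ 24 * (real (card V) ^ 4 * p ^ 6 + real (card V) ^ 5 * p ^ 8 + real (card V) ^ 6 * p ^ 9)"
proof -
  let ?b = "2 ^ 24 * (real (card V) ^ 4 * p ^ 6 + real (card V) ^ 5 * p ^ 8 + real (card V) ^ 6 * p ^ 9)"
  let ?el = "\<Sum>F\<in>elem_configs V k. p ^ card (covered_edges F)"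
  let ?W = "weight_sum V p k"
  have "1 - ?el / ?W = (?W - ?el) / ?W" using weight_sum_pos by (simp add: diff_divide_distrib)
  also have "?W - ?el = (\<Sum>F\<in>{F \<in> configs V k. \<not> elementary F}. p ^ card (covered_edges F))"
    using weight_elem_split by simp
  also have "\<dots> / ?W \<le> ?b"
    using weight_not_elementary[OF V p p2 k small] weight_sum_pos
    by (subst pos_divide_le_eq) auto
  finally show ?thesis unfolding tv_elem_eq .
qed

lemma prob_not_packing:
  assumes p2: "2 * p \<le> 1"
    and k: "real k \<le> p ^ 3 * (real (card V choose 3) - 12 * real k^2 * real (card V))"
    and small: "real (card V) * p^2 + real (3 * k) * p \<le> 1 / 8"
  shows "(\<Sum>F\<in>configs V k - packings V k. pmf (nu_tilt V p k) F) \<le> 2048 * (real (card V) ^ 4 * p ^ 5)"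
    and "(\<Sum>F\<in>configs V k - packings V k. pmf (nu_unif V k) F) \<le> 2048 * (real (card V) ^ 4 * p ^ 5) * p"
proof -
  have eq: "configs V k - packings V k = {F \<in> configs V k. \<not> edge_disjoint F}"
    by (auto simp: packings_def)
  have sub: "configs V k - packings V k \<subseteq> configs V k" by blast
  have c: "0 < real (card (configs V k))"
    using configs_nonempty finite_configs[OF V] by (simp add: card_gt_0_iff)
  show "(\<Sum>F\<in>configs V k - packings V k. pmf (nu_tilt V p k) F) \<le> 2048 * (real (card V) ^ 4 * p ^ 5)"
    unfolding prob_tilt[OF sub] using weight_not_edge_disjoint(1)[OF V p p2 k small] weight_sum_pos
    by (subst pos_divide_le_eq) (auto simp: eq)
  show "(\<Sum>F\<in>configs V k - packings V k. pmf (nu_unif V k) F) \<le> 2048 * (real (card V) ^ 4 * p ^ 5) * p"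
    unfolding prob_unif[OF sub] using weight_not_edge_disjoint(2)[OF V p p2 k small] c
    by (subst pos_divide_le_eq) (auto simp: eq)
qed

lemma tv_unif_le:
  assumes p2: "2 * p \<le> 1"
    and k: "real k \<le> p ^ 3 * (real (card V choose 3) - 12 * real k^2 * real (card V))"
    and small: "real (card V) * p^2 + real (3 * k) * p \<le> 1 / 8"
  shows "tv_dist (nu_tilt V p k) (nu_unif V k) \<le> 4096 * (real (card V) ^ 4 * p ^ 5)"
proof -
  have sub: "packings V k \<subseteq> configs V k" by (auto simp: packings_def)
  have "tv_dist (nu_tilt V p k) (nu_unif V k) \<le>
      (\<Sum>F\<in>configs V k - packings V k. pmf (nu_tilt V p k) F)
      + (\<Sum>F\<in>configs V k - packings V k. pmf (nu_unif V k) F)"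
  proof (rule tv_dist_le_common_part[OF finite_configs[OF V] set_pmf_tilt set_pmf_unif sub])
    fix F assume F: "F \<in> packings V k"
    then have FC: "F \<in> configs V k" using sub by blast
    show "pmf (nu_tilt V p k) F = p ^ (3 * k) / weight_sum V p k"
      using pmf_tilt[OF FC] card_covered_packing[OF V F] by simp
    show "pmf (nu_unif V k) F = 1 / real (card (configs V k))" by (rule pmf_unif[OF FC])
  qed
  also have "\<dots> \<le> 2048 * (real (card V) ^ 4 * p ^ 5) + 2048 * (real (card V) ^ 4 * p ^ 5) * p"
    by (intro add_mono prob_not_packing assms)
  also have "\<dots> \<le> 2048 * (real (card V) ^ 4 * p ^ 5) + 2048 * (real (card V) ^ 4 * p ^ 5) * 1"
    using p p2 by (intro add_left_mono mult_left_mono) auto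
  finally show ?thesis by (simp add: mult_ac)
qed

text \<open>
  The event of being a packing separates the measures: it is likely under the uniform one and, by the
  switching to a single diamond, unlikely under the tilted one.
\<close>

lemma tv_unif_ge:
  assumes p2: "2 * p \<le> 1"
    and k: "real k \<le> p ^ 3 * (real (card V choose 3) - 12 * real k^2 * real (card V))"
    and small: "real (card V) * p^2 + real (3 * k) * p \<le> 1 / 8"
    and k2: "2 \<le> k" "6 * k \<le> card V"
  shows "1 - 2048 * (real (card V) ^ 4 * p ^ 6)
      - 8 * (real (card V choose 3) * p) / (3 * real k^2 * real (card V))
    \<le> tv_dist (nu_tilt V p k) (nu_unif V k)"
proof -
  have sub: "packings V k \<subseteq> configs V k" by (auto simp: packings_def)
  let ?N = "real (card V choose 3)" and ?n = "real (card V)" and ?W = "weight_sum V p k"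
  let ?D = "\<Sum>F\<in>packings V k. p ^ card (covered_edges F)"
  obtain m where m: "k = Suc m" using k2 by (cases k) auto
  have D0: "0 \<le> ?D" using p by (simp add: sum_nonneg)
  have n0: "0 < ?n" using k2 by linarith
  have "3 * real k^2 * ?n / 4 = real k * ((3 * (real k / 2)) * (?n / 2))"
    by (simp add: power2_eq_square)
  also have "\<dots> \<le> real k * (real (3 * m) * real (card V - 3 * m))"
  proof (intro mult_left_mono mult_mono)
    show "3 * (real k / 2) \<le> real (3 * m)" using k2 m by simp
    show "?n / 2 \<le> real (card V - 3 * m)" using k2 m by (simp add: of_nat_diff)
  qed auto
  finally have "(3 * real k^2 * ?n / 4) * ?D \<le> real k * (real (3 * m) * real (card V - 3 * m)) * ?D"
    using D0 by (intro mult_right_mono)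
  also have "\<dots> \<le> 2 * ?N * p * ?W"
    using weight_packings[OF V, of p m] p m by simp
  finally have "(3 * real k^2 * ?n / 4) * ?D \<le> 2 * ?N * p * ?W" .
  then have "?D * (3 * real k^2 * ?n) \<le> 8 * (?N * p) * ?W" by (simp add: mult_ac)
  then have "?D / ?W * (3 * real k^2 * ?n) \<le> 8 * (?N * p)"
    using weight_sum_pos by (simp add: divide_le_eq)
  moreover have "0 < 3 * real k^2 * ?n" using n0 k2 by simp
  ultimately have "?D / ?W \<le> 8 * (?N * p) / (3 * real k^2 * ?n)"
    by (simp only: pos_le_divide_eq)
  moreover have "(\<Sum>F\<in>packings V k. pmf (nu_unif V k) F) \<ge> 1 - 2048 * (?n ^ 4 * p ^ 5) * p"
    using prob_not_packing(2)[OF p2 k small] sum_pmf_eq_1[OF finite_configs[OF V] set_pmf_unif]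
      sum.subset_diff[OF sub finite_configs[OF V], of "pmf (nu_unif V k)"] by linarith
  moreover have "2048 * (?n ^ 4 * p ^ 5) * p = 2048 * (?n ^ 4 * p ^ 6)"
    by (simp add: eval_nat_numeral)
  ultimately show ?thesis
    using tv_dist_ge_event[OF finite_configs[OF V] set_pmf_tilt set_pmf_unif sub]
    unfolding prob_tilt[OF sub] by linarith
qed

lemma tv_bounds:
  "0 \<le> tv_dist (nu_tilt V p k) (nu_unif V k)" "tv_dist (nu_tilt V p k) (nu_unif V k) \<le> 1"
  "0 \<le> tv_dist (nu_tilt_elem V p k) (nu_tilt V p k)" "tv_dist (nu_tilt_elem V p k) (nu_tilt V p k) \<le> 1"
proof -
  show "0 \<le> tv_dist (nu_tilt V p k) (nu_unif V k)"
    by (rule tv_dist_nonneg[OF finite_configs[OF V] set_pmf_tilt set_pmf_unif])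
  show "tv_dist (nu_tilt V p k) (nu_unif V k) \<le> 1"
    by (rule tv_dist_le_1[OF finite_configs[OF V] set_pmf_tilt set_pmf_unif])
  have el0: "0 \<le> (\<Sum>F\<in>elem_configs V k. p ^ card (covered_edges F))"
    and ne0: "0 \<le> (\<Sum>F\<in>{F \<in> configs V k. \<not> elementary F}. p ^ card (covered_edges F))"
    using p by (simp_all add: sum_nonneg)
  show "0 \<le> tv_dist (nu_tilt_elem V p k) (nu_tilt V p k)"
    using ne0 weight_elem_split weight_sum_pos unfolding tv_elem_eq by (simp add: divide_le_eq)
  show "tv_dist (nu_tilt_elem V p k) (nu_tilt V p k) \<le> 1"
    using el0 weight_sum_pos unfolding tv_elem_eq by simp
qed

end

section \<open>Asymptotics\<close>

text \<open>
  The exponent of \<open>n\<close> in \<open>n ^ b * (n powr c) ^ a\<close> is not positive.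
\<close>

lemma smallo_powr_tendsto_0:
  fixes p :: "nat \<Rightarrow> real"
  assumes o: "p \<in> o(\<lambda>n. real n powr c)" and e: "c * real a + real b \<le> 0" and a: "0 < a"
  shows "(\<lambda>n. real n ^ b * p n ^ a) \<longlonglongrightarrow> 0"
proof -
  have "(\<lambda>n. p n / real n powr c) \<longlonglongrightarrow> 0" by (rule smalloD_tendsto[OF o])
  then have lim: "(\<lambda>n. \<bar>p n / real n powr c\<bar> ^ a) \<longlonglongrightarrow> 0"
    using a by (metis tendsto_power[OF tendsto_rabs_zero] zero_power)
  have "eventually (\<lambda>n. norm (real n ^ b * p n ^ a) \<le> \<bar>p n / real n powr c\<bar> ^ a) sequentially"
    using eventually_ge_at_top[of 1]
  proof eventually_elim
    case (elim n)
    have n: "real n \<ge> 1" using elim by simp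
    have "real n ^ b = real n powr real b" using n by (simp add: powr_realpow)
    also have "\<dots> \<le> real n powr (- (c * real a))" using n e by (intro powr_mono) auto
    also have "\<dots> = 1 / (real n powr c) ^ a"
      using n by (simp add: powr_minus powr_powr[symmetric] powr_realpow inverse_eq_divide)
    finally have "real n ^ b * \<bar>p n\<bar> ^ a \<le> 1 / (real n powr c) ^ a * \<bar>p n\<bar> ^ a"
      by (intro mult_right_mono) auto
    then show ?case by (simp add: abs_mult power_abs power_divide abs_divide)
  qed
  then show ?thesis using lim by (rule Lim_null_comparison)
qed

lemma power_mult_powr: "0 < x \<Longrightarrow> x ^ m * x powr b = x powr (real m + b)" for x b :: real
  by (simp add: powr_add powr_realpow)

lemma eventually_le_of_tendsto_0:
  fixes f :: "nat \<Rightarrow> real"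
  assumes "f \<longlonglongrightarrow> 0" "0 < c"
  shows "eventually (\<lambda>n. f n \<le> c) sequentially"
  using order_tendstoD(2)[OF assms] by (rule eventually_mono) simp

lemma choose_3_bounds:
  assumes "3 \<le> n"
  shows "real n ^ 3 / 27 \<le> real (n choose 3)" "real (n choose 3) \<le> real n ^ 3"
proof -
  have "(real n / real 3) ^ 3 \<le> real (n choose 3)"
    using binomial_ge_n_over_k_pow_k[of 3 n, where 'a = real] assms by simp
  then show "real n ^ 3 / 27 \<le> real (n choose 3)" by (simp add: power_divide)
  have "n choose 3 \<le> n ^ 3" by (rule binomial_le_pow[OF assms])
  then have "real (n choose 3) \<le> real (n ^ 3)" by (rule of_nat_mono)
  then show "real (n choose 3) \<le> real n ^ 3" by simp
qed

context
  fixes \<epsilon> :: real and V :: "nat \<Rightarrow> 'a set" and p \<mu> :: "nat \<Rightarrow> real" and k :: "nat \<Rightarrow> nat"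
  assumes eps: "\<epsilon> > 0"
    and V: "\<And>n. finite (V n)" and cV: "\<And>n. card (V n) = n"
    and p01: "eventually (\<lambda>n. 0 < p n \<and> p n < 1) sequentially"
    and po: "p \<in> o(\<lambda>n. real n powr (- 2 / 3))"
    and mu: "\<And>n. \<mu> n = real (n choose 3) * p n ^ 3"
    and kmu: "eventually (\<lambda>n. real (k n) \<le> (1 - \<epsilon>) * \<mu> n) sequentially"
begin

lemma power_product_tendsto_0:
  "3 * b \<le> 2 * a \<Longrightarrow> 0 < a \<Longrightarrow> (\<lambda>n. real n ^ b * p n ^ a) \<longlonglongrightarrow> 0"
  by (rule smallo_powr_tendsto_0[OF po]) auto

lemma eventually_k_le_n3p3: "eventually (\<lambda>n. real (k n) \<le> real n ^ 3 * p n ^ 3) sequentially"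
  using p01 kmu eventually_ge_at_top[of 3]
proof eventually_elim
  case (elim n)
  have m0: "0 \<le> \<mu> n" using elim by (simp add: mu)
  have "real (k n) \<le> 1 * \<mu> n"
    using elim(2) mult_right_mono[OF _ m0, of "1 - \<epsilon>" 1] eps by linarith
  also have "\<dots> \<le> real n ^ 3 * p n ^ 3"
    using choose_3_bounds(2)[of n] elim by (simp add: mu mult_right_mono)
  finally show ?case .
qed

lemma eventually_k_le:
  assumes "0 < c" shows "eventually (\<lambda>n. real (k n) \<le> c * real n) sequentially"
proof -
  have "eventually (\<lambda>n. real n ^ 2 * p n ^ 3 \<le> c) sequentially"
    by (rule eventually_le_of_tendsto_0[OF power_product_tendsto_0 assms]) auto
  then show ?thesis using eventually_k_le_n3p3
  proof eventually_elim
    case (elim n)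
    have "real n * (real n ^ 2 * p n ^ 3) \<le> real n * c" using elim by (intro mult_left_mono) auto
    then show ?case using elim(2) by (simp add: eval_nat_numeral mult_ac)
  qed
qed

text \<open>
  As \<open>k = o(n)\<close>, the number \<open>12 * k^2 * n\<close> of triples that cannot be added is at most \<open>\<epsilon> * (n choose 3)\<close>, and
  the factor \<open>1 - \<epsilon>\<close> in the upper bound on \<open>k\<close> pays for it.
\<close>

lemma eventually_k_le_isolated_extensions:
  "eventually (\<lambda>n. real (k n) \<le> p n ^ 3 * (real (card (V n) choose 3) - 12 * real (k n)^2 * real (card (V n)))) sequentially"
proof -
  \<comment> \<open>With \<open>n choose 3 \<ge> n^3 / 27\<close>, the bound \<open>12 * k^2 * n \<le> \<epsilon> * n^3 / 27\<close> holds once \<open>k \<le> c * n\<close>.\<close>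
  define c where "c = sqrt (\<epsilon> / 324)"
  have c: "0 < c" "c^2 = \<epsilon> / 324" using eps by (auto simp: c_def)
  show ?thesis
    using p01 kmu eventually_ge_at_top[of 3] eventually_k_le[OF c(1)]
  proof eventually_elim
    case (elim n)
    have "12 * real (k n)^2 * real n \<le> 12 * (c * real n)^2 * real n"
      using elim by (intro mult_right_mono mult_left_mono power_mono) auto
    also have "\<dots> = 12 * c^2 * real n ^ 3" by (simp add: eval_nat_numeral)
    also have "\<dots> = \<epsilon> * (real n ^ 3 / 27)" unfolding c(2) by simp
    also have "\<dots> \<le> \<epsilon> * real (n choose 3)"
      using choose_3_bounds(1)[of n] elim eps by (intro mult_left_mono) auto
    finally have "(1 - \<epsilon>) * real (n choose 3) \<le> real (n choose 3) - 12 * real (k n)^2 * real n"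
      by (simp add: algebra_simps)
    then have "p n ^ 3 * ((1 - \<epsilon>) * real (n choose 3)) \<le> p n ^ 3 * (real (n choose 3) - 12 * real (k n)^2 * real n)"
      using elim by (intro mult_left_mono) auto
    then show ?case using elim(2) by (simp add: mu cV mult_ac)
  qed
qed

lemma eventually_p_le: "0 < c \<Longrightarrow> eventually (\<lambda>n. p n \<le> c) sequentially"
  using eventually_le_of_tendsto_0[OF power_product_tendsto_0[of 0 1]] by simp

lemma eventually_exploration_small:
  assumes "(\<lambda>n. real n ^ 3 * p n ^ 4) \<longlonglongrightarrow> 0"
  shows "eventually (\<lambda>n. real (card (V n)) * p n ^ 2 + real (3 * k n) * p n \<le> 1 / 8) sequentially"
proof -
  have 1: "eventually (\<lambda>n. real n ^ 1 * p n ^ 2 \<le> 1 / 16) sequentially"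
    by (rule eventually_le_of_tendsto_0[OF power_product_tendsto_0]) auto
  have 2: "eventually (\<lambda>n. real n ^ 3 * p n ^ 4 \<le> 1 / 48) sequentially"
    by (rule eventually_le_of_tendsto_0[OF assms]) auto
  show ?thesis using 1 2 p01 eventually_k_le_n3p3
  proof eventually_elim
    case (elim n)
    have "real (k n) * p n \<le> (real n ^ 3 * p n ^ 3) * p n" using elim by (intro mult_right_mono) auto
    also have "\<dots> = real n ^ 3 * p n ^ 4" by (simp add: eval_nat_numeral)
    finally show ?case using elim by (simp add: cV)
  qed
qed

lemma eventually_finite_bounds_apply:
  assumes "(\<lambda>n. real n ^ 3 * p n ^ 4) \<longlonglongrightarrow> 0"
  shows "eventually (\<lambda>n. 0 < p n \<and> 2 * p n \<le> 1 \<and> 6 * k n \<le> card (V n) \<and>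
    real (k n) \<le> p n ^ 3 * (real (card (V n) choose 3) - 12 * real (k n)^2 * real (card (V n))) \<and>
    real (card (V n)) * p n ^ 2 + real (3 * k n) * p n \<le> 1 / 8) sequentially"
proof -
  have "eventually (\<lambda>n. p n \<le> 1 / 2) sequentially" by (rule eventually_p_le) simp
  moreover have "eventually (\<lambda>n. real (k n) \<le> 1 / 6 * real n) sequentially" by (rule eventually_k_le) simp
  ultimately show ?thesis using p01 eventually_k_le_isolated_extensions eventually_exploration_small[OF assms]
    by eventually_elim (simp add: cV)
qed

lemma tilt_close_to_uniform:
  assumes "p \<in> o(\<lambda>n. real n powr (- 4 / 5))"
  shows "(\<lambda>n. tv_dist (nu_tilt (V n) (p n) (k n)) (nu_unif (V n) (k n))) \<longlonglongrightarrow> 0"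
proof -
  have l: "(\<lambda>n. real n ^ 3 * p n ^ 4) \<longlonglongrightarrow> 0" "(\<lambda>n. real n ^ 4 * p n ^ 5) \<longlonglongrightarrow> 0"
    by (rule smallo_powr_tendsto_0[OF assms]; simp)+
  show ?thesis
  proof (rule tendsto_sandwich)
    show "eventually (\<lambda>n. 0 \<le> tv_dist (nu_tilt (V n) (p n) (k n)) (nu_unif (V n) (k n))) sequentially"
      using eventually_finite_bounds_apply[OF l(1)] by (rule eventually_mono) (intro tv_bounds V; simp)
    show "eventually (\<lambda>n. tv_dist (nu_tilt (V n) (p n) (k n)) (nu_unif (V n) (k n))
        \<le> 4096 * (real n ^ 4 * p n ^ 5)) sequentially"
      using eventually_finite_bounds_apply[OF l(1)]
    proof eventually_elim
      case (elim n)
      then show ?case using tv_unif_le[OF V[of n], of "p n" "k n"] by (simp add: cV)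
    qed
    show "(\<lambda>n. 4096 * (real n ^ 4 * p n ^ 5)) \<longlonglongrightarrow> 0"
      using tendsto_mult_right_zero[OF l(2)] by simp
  qed simp
qed

lemma elementary_close_to_tilt:
  assumes "p \<in> o(\<lambda>n. real n powr (- 3 / 4))"
  shows "(\<lambda>n. tv_dist (nu_tilt_elem (V n) (p n) (k n)) (nu_tilt (V n) (p n) (k n))) \<longlonglongrightarrow> 0"
proof -
  have l: "(\<lambda>n. real n ^ 3 * p n ^ 4) \<longlonglongrightarrow> 0"
    by (rule smallo_powr_tendsto_0[OF assms]) simp_all
  show ?thesis
  proof (rule tendsto_sandwich)
    show "eventually (\<lambda>n. 0 \<le> tv_dist (nu_tilt_elem (V n) (p n) (k n)) (nu_tilt (V n) (p n) (k n))) sequentially"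
      using eventually_finite_bounds_apply[OF l] by (rule eventually_mono) (intro tv_bounds V; simp)
    show "eventually (\<lambda>n. tv_dist (nu_tilt_elem (V n) (p n) (k n)) (nu_tilt (V n) (p n) (k n))
        \<le> 2 ^ 24 * (real n ^ 4 * p n ^ 6 + real n ^ 5 * p n ^ 8 + real n ^ 6 * p n ^ 9)) sequentially"
      using eventually_finite_bounds_apply[OF l]
    proof eventually_elim
      case (elim n)
      then show ?case using tv_elem_le[OF V[of n], of "p n" "k n"] by (simp add: cV)
    qed
    have "(\<lambda>n. real n ^ 4 * p n ^ 6 + real n ^ 5 * p n ^ 8 + real n ^ 6 * p n ^ 9) \<longlonglongrightarrow> 0 + 0 + 0"
      by (intro tendsto_add power_product_tendsto_0) auto
    then show "(\<lambda>n. 2 ^ 24 * (real n ^ 4 * p n ^ 6 + real n ^ 5 * p n ^ 8 + real n ^ 6 * p n ^ 9)) \<longlonglongrightarrow> 0"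
      using tendsto_mult_right_zero by fastforce
  qed simp
qed

lemma eventually_k_ge:
  assumes "(\<lambda>n. real (k n)) \<in> \<Theta>(\<mu>)"
  obtains c where "0 < c" "eventually (\<lambda>n. c * \<mu> n \<le> real (k n)) sequentially"
proof -
  have "(\<lambda>n. real (k n)) \<in> \<Omega>(\<mu>)" using assms by (auto simp: bigtheta_def)
  then obtain c where c: "c > 0" "eventually (\<lambda>n. norm (real (k n)) \<ge> c * norm (\<mu> n)) sequentially"
    by (rule landau_omega.bigE)
  from c(2) p01 have "eventually (\<lambda>n. c * \<mu> n \<le> real (k n)) sequentially"
    by eventually_elim (simp add: mu)
  then show ?thesis using that c(1) by blast
qed

lemma tilt_far_from_uniform:
  assumes lo: "(\<lambda>n. real n powr (- 4 / 5)) \<in> o(p)" and up: "p \<in> o(\<lambda>n. real n powr (- 3 / 4))"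
    and th: "(\<lambda>n. real (k n)) \<in> \<Theta>(\<mu>)"
  shows "(\<lambda>n. tv_dist (nu_tilt (V n) (p n) (k n)) (nu_unif (V n) (k n))) \<longlonglongrightarrow> 1"
proof -
  have l: "(\<lambda>n. real n ^ 3 * p n ^ 4) \<longlonglongrightarrow> 0"
    by (rule smallo_powr_tendsto_0[OF up]) simp_all
  obtain c where c: "0 < c" and ck: "eventually (\<lambda>n. c * \<mu> n \<le> real (k n)) sequentially"
    using eventually_k_ge[OF th] by blast
  have inv: "(\<lambda>n. 1 / (real n ^ 4 * p n ^ 5)) \<longlonglongrightarrow> 0"
  proof (rule Lim_transform_eventually)
    show "(\<lambda>n. (real n powr (- 4 / 5) / p n) ^ 5) \<longlonglongrightarrow> 0"
      using tendsto_power[OF smalloD_tendsto[OF lo], of 5] by simp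
    show "eventually (\<lambda>n. (real n powr (- 4 / 5) / p n) ^ 5 = 1 / (real n ^ 4 * p n ^ 5)) sequentially"
      using eventually_ge_at_top[of 1]
    proof eventually_elim
      case (elim n)
      have "(real n powr (- 4 / 5)) ^ 5 = real n powr (- 4)"
        using elim by (simp add: powr_power)
      also have "\<dots> = 1 / real n ^ 4"
        using elim by (simp add: powr_minus powr_numeral inverse_eq_divide)
      finally show ?case by (simp add: power_divide)
    qed
  qed
  have k2: "eventually (\<lambda>n. 2 \<le> k n) sequentially"
  proof -
    have "eventually (\<lambda>n. 1 / (real n ^ 4 * p n ^ 5) \<le> c / 54) sequentially"
      by (rule eventually_le_of_tendsto_0[OF inv]) (use c in simp)
    moreover have "eventually (\<lambda>n. real n ^ 1 * p n ^ 2 \<le> 1) sequentially"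
      by (rule eventually_le_of_tendsto_0[OF power_product_tendsto_0]) auto
    ultimately show ?thesis using p01 ck eventually_ge_at_top[of 3]
    proof eventually_elim
      case (elim n)
      have n: "real n > 0" using elim by simp
      have pos: "0 < real n ^ 4 * p n ^ 5" using n elim by simp
      have "54 \<le> c * (real n ^ 4 * p n ^ 5)" using elim(1) pos by (simp add: divide_le_eq)
      also have "real n ^ 4 * p n ^ 5 = (real n ^ 3 * p n ^ 3) * (real n ^ 1 * p n ^ 2)"
        by (simp add: eval_nat_numeral)
      also have "\<dots> \<le> (real n ^ 3 * p n ^ 3) * 1" using elim n by (intro mult_left_mono) auto
      finally have "54 \<le> c * (real n ^ 3 * p n ^ 3)" using c by simp
      then have "2 \<le> c * (real n ^ 3 / 27 * p n ^ 3)" by simp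
      also have "\<dots> \<le> c * (real (n choose 3) * p n ^ 3)"
        using choose_3_bounds(1)[of n] c elim by (intro mult_left_mono mult_right_mono) auto
      also have "\<dots> \<le> real (k n)" using elim by (simp add: mu)
      finally show ?case by simp
    qed
  qed
  show ?thesis
  proof (rule tendsto_sandwich)
    show "eventually (\<lambda>n. tv_dist (nu_tilt (V n) (p n) (k n)) (nu_unif (V n) (k n)) \<le> 1) sequentially"
      using eventually_finite_bounds_apply[OF l] by (rule eventually_mono) (intro tv_bounds V; simp)
    show "eventually (\<lambda>n. 1 - 2048 * (real n ^ 4 * p n ^ 6) - 72 / c^2 * (1 / (real n ^ 4 * p n ^ 5))
        \<le> tv_dist (nu_tilt (V n) (p n) (k n)) (nu_unif (V n) (k n))) sequentially"
      using eventually_finite_bounds_apply[OF l] k2 ck eventually_ge_at_top[of 3]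
    proof eventually_elim
      case (elim n)
      have n: "real n > 0" and p: "0 < p n" using elim by auto
      define N where "N = real (n choose 3)"
      have N: "real n ^ 3 / 27 \<le> N" using choose_3_bounds(1)[of n] elim by (simp add: N_def)
      then have N0: "0 < N" using n by (smt (verit) divide_pos_pos zero_less_power)
      have "8 * (N * p n) / (3 * real (k n)^2 * real n) \<le> 8 * (N * p n) / (3 * (c * (N * p n ^ 3))^2 * real n)"
        using elim N0 n p c
        by (intro divide_left_mono mult_right_mono mult_left_mono power_mono mult_pos_pos) (auto simp: mu N_def)
      also have "\<dots> = 8 / (3 * c^2 * p n ^ 5 * real n) / N"
        using N0 n p c by (simp add: field_simps eval_nat_numeral)
      also have "\<dots> \<le> 8 / (3 * c^2 * p n ^ 5 * real n) / (real n ^ 3 / 27)"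
        using N N0 n p c by (intro divide_left_mono) auto
      also have "\<dots> = 72 / c^2 * (1 / (real n ^ 4 * p n ^ 5))"
        using n p c by (simp add: field_simps eval_nat_numeral)
      finally have "8 * (N * p n) / (3 * real (k n)^2 * real n) \<le> 72 / c^2 * (1 / (real n ^ 4 * p n ^ 5))" .
      moreover have "1 - 2048 * (real n ^ 4 * p n ^ 6) - 8 * (N * p n) / (3 * real (k n)^2 * real n)
          \<le> tv_dist (nu_tilt (V n) (p n) (k n)) (nu_unif (V n) (k n))"
        using tv_unif_ge[OF V[of n], of "p n" "k n"] elim by (simp add: cV N_def)
      ultimately show ?case by linarith
    qed
    have "(\<lambda>n. 1 - 2048 * (real n ^ 4 * p n ^ 6) - 72 / c^2 * (1 / (real n ^ 4 * p n ^ 5))) \<longlonglongrightarrow> 1 - 2048 * 0 - 72 / c^2 * 0"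
      by (intro tendsto_intros power_product_tendsto_0 inv) auto
    then show "(\<lambda>n. 1 - 2048 * (real n ^ 4 * p n ^ 6) - 72 / c^2 * (1 / (real n ^ 4 * p n ^ 5))) \<longlonglongrightarrow> 1"
      by simp
  qed simp
qed

text \<open>
  With \<open>\<mu> \<le> k / c\<close> the elementary weight is at most \<open>exp (8 * k / c)\<close>. The choice \<open>ln K = 4 / c + 1\<close> makes
  \<open>K ^ (2 * k) = exp (8 * k / c + 2 * k)\<close>, and since \<open>p ^ (2 * s) \<ge> exp (- k)\<close> the fans exceed the
  elementary weight by a factor of at least \<open>exp k\<close>.
\<close>

lemma elementary_far_from_tilt:
  assumes al: "2 / 3 < \<alpha>" "\<alpha> < 3 / 4" and pe: "eventually (\<lambda>n. p n = real n powr (- \<alpha>)) sequentially"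
    and th: "(\<lambda>n. real (k n)) \<in> \<Theta>(\<mu>)"
  shows "(\<lambda>n. tv_dist (nu_tilt_elem (V n) (p n) (k n)) (nu_tilt (V n) (p n) (k n))) \<longlonglongrightarrow> 1"
proof -
  obtain c where c: "0 < c" and ck: "eventually (\<lambda>n. c * \<mu> n \<le> real (k n)) sequentially"
    using eventually_k_ge[OF th] by blast
  define K where "K = exp (4 / c + 1)"
  have K1: "1 \<le> K" using c by (simp add: K_def)
  define y where "y n = K * real n powr (3 / 2 - \<alpha>)" for n
  define s where "s n = nat \<lceil>y n\<rceil>" for n
  have big: "eventually (\<lambda>n. 4 * K * \<alpha> * real n powr (3 / 2 - \<alpha>) * ln (real n) \<le> c / 27 * real n powr (3 - 3 * \<alpha>)) sequentially"
  proof -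
    have "(\<lambda>n. ln (real n) / real n powr (3 / 2 - 2 * \<alpha>)) \<longlonglongrightarrow> 0"
      using al by (intro lim_ln_over_power) auto
    then have "eventually (\<lambda>n. ln (real n) / real n powr (3 / 2 - 2 * \<alpha>) \<le> c / (108 * K * \<alpha>)) sequentially"
      by (rule eventually_le_of_tendsto_0) (use c K1 al in auto)
    then show ?thesis using eventually_ge_at_top[of 1]
    proof eventually_elim
      case (elim n)
      have n: "0 < real n" using elim by simp
      have "ln (real n) \<le> c / (108 * K * \<alpha>) * real n powr (3 / 2 - 2 * \<alpha>)"
        using elim n by (simp add: pos_divide_le_eq)
      then have "4 * K * \<alpha> * real n powr (3 / 2 - \<alpha>) * ln (real n) \<le>
          4 * K * \<alpha> * real n powr (3 / 2 - \<alpha>) * (c / (108 * K * \<alpha>) * real n powr (3 / 2 - 2 * \<alpha>))"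
        using K1 al by (intro mult_left_mono) auto
      also have "\<dots> = c / 27 * (real n powr (3 / 2 - \<alpha>) * real n powr (3 / 2 - 2 * \<alpha>))"
        using K1 al by (simp add: field_simps)
      also have "real n powr (3 / 2 - \<alpha>) * real n powr (3 / 2 - 2 * \<alpha>) = real n powr (3 - 3 * \<alpha>)"
        by (simp add: powr_add[symmetric])
      finally show ?case .
    qed
  qed
  have n27: "eventually (\<lambda>n. exp 3 \<le> real n) sequentially"
    using filterlim_real_sequentially by (simp add: filterlim_at_top)
  have small: "eventually (\<lambda>n. real n ^ 1 * p n ^ 2 \<le> 1 / 16) sequentially"
    by (rule eventually_le_of_tendsto_0[OF power_product_tendsto_0]) auto
  have p144: "eventually (\<lambda>n. p n \<le> 1 / 144) sequentially" by (rule eventually_p_le) simp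
  have k_third: "eventually (\<lambda>n. real (k n) \<le> 1 / 3 * real n) sequentially" by (rule eventually_k_le) simp
  have main: "eventually (\<lambda>n. 1 - exp (- real (k n)) \<le> tv_dist (nu_tilt_elem (V n) (p n) (k n)) (nu_tilt (V n) (p n) (k n))) sequentially"
    using p01 pe ck big n27 eventually_k_le_n3p3 small p144 k_third
      eventually_ge_at_top[of 3]
  proof eventually_elim
    case (elim n)
    have n: "1 \<le> real n" using elim by simp
    have p: "0 < p n" "p n \<le> 1" using elim by auto
    have ln3: "3 \<le> ln (real n)" using elim(5) n by (simp add: ln_ge_iff)
    define Y where "Y = real n powr (3 / 2 - \<alpha>)"
    have Y1: "1 \<le> Y" unfolding Y_def using n al by (intro ge_one_powr_ge_zero) auto
    have p3: "p n ^ 3 = real n powr (- 3 * \<alpha>)" using elim n by (simp add: powr_power mult.commute)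
    have n3p3: "real n ^ 3 * p n ^ 3 = real n powr (3 - 3 * \<alpha>)"
      unfolding p3 using power_mult_powr[of "real n" 3 "- 3 * \<alpha>"] n by simp
    have kl: "c / 27 * real n powr (3 - 3 * \<alpha>) \<le> real (k n)"
    proof -
      have "c / 27 * (real n ^ 3 * p n ^ 3) = c * (real n ^ 3 / 27 * p n ^ 3)" by simp
      also have "\<dots> \<le> c * \<mu> n"
        unfolding mu using choose_3_bounds(1)[of n] elim c by (intro mult_left_mono mult_right_mono) auto
      finally show ?thesis using elim n3p3 by simp
    qed
    have sy: "y n \<le> real (s n)" "real (s n) \<le> 2 * K * Y"
    proof -
      have y1: "1 \<le> y n" using K1 Y1 mult_mono[of 1 K 1 Y] by (simp add: y_def Y_def)
      have "real (s n) = of_int \<lceil>y n\<rceil>" using y1 by (simp add: s_def)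
      moreover have "y n = K * Y" by (simp add: y_def Y_def)
      ultimately show "y n \<le> real (s n)" "real (s n) \<le> 2 * K * Y"
        using y1 le_of_int_ceiling[of "y n"] of_int_ceiling_le_add_one[of "y n"] by linarith+
    qed
    have s1: "1 \<le> real (s n)"
      using sy(1) K1 Y1 mult_mono[of 1 K 1 Y] by (simp add: y_def Y_def)
    have sln: "2 * real (s n) * \<alpha> * ln (real n) \<le> real (k n)"
    proof -
      have "2 * real (s n) * \<alpha> * ln (real n) \<le> 2 * (2 * K * Y) * \<alpha> * ln (real n)"
        using sy al ln3 by (intro mult_right_mono mult_left_mono) auto
      also have "\<dots> = 4 * K * \<alpha> * Y * ln (real n)" by simp
      also have "\<dots> \<le> real (k n)" using elim(4) kl unfolding Y_def by linarith
      finally show ?thesis .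
    qed
    \<comment> \<open>Since \<open>\<alpha> > 2 / 3\<close> and \<open>ln n \<ge> 3\<close>, the bound on \<open>s * ln n\<close> also bounds \<open>4 * s\<close>.\<close>
    have s3: "3 * s n < k n"
    proof -
      have "4 * real (s n) = 2 * real (s n) * (2 / 3) * 3" by simp
      also have "\<dots> \<le> 2 * real (s n) * \<alpha> * ln (real n)"
        using al ln3 by (intro mult_mono) auto
      finally show ?thesis using sln s1 by linarith
    qed
    have s2: "K ^ 2 * (real n ^ 3 * p n ^ 2) \<le> real (s n) ^ 2"
    proof -
      have "p n ^ 2 = real n powr (- 2 * \<alpha>)" using elim n by (simp add: powr_power mult.commute)
      then have "real n ^ 3 * p n ^ 2 = real n powr (3 - 2 * \<alpha>)"
        using power_mult_powr[of "real n" 3 "- 2 * \<alpha>"] n by simp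
      also have "\<dots> = Y ^ 2" unfolding Y_def using n by (simp add: powr_power algebra_simps)
      finally have "K ^ 2 * (real n ^ 3 * p n ^ 2) = (y n) ^ 2"
        by (simp add: y_def Y_def power_mult_distrib)
      also have "\<dots> \<le> real (s n) ^ 2" using sy K1 by (intro power_mono) (auto simp: y_def)
      finally show ?thesis .
    qed
    have n3: "0 < real n ^ 3 * p n ^ 3" using n p by simp
    have s2p: "K ^ 2 * (real n ^ 3 * p n ^ 3) \<le> real (s n) ^ 2 * p n"
      using mult_right_mono[OF s2, of "p n"] p by (simp add: eval_nat_numeral mult_ac)
    have ks: "k n \<le> s n ^ 2"
    proof -
      have "real (k n) \<le> 1 * (real n ^ 3 * p n ^ 3)" using elim by simp
      also have "\<dots> \<le> K ^ 2 * (real n ^ 3 * p n ^ 3)" using K1 n3 by (intro mult_right_mono) auto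
      also have "\<dots> \<le> real (s n) ^ 2 * 1"
        using s2p p mult_left_mono[of "p n" 1 "real (s n) ^ 2"] by simp
      finally have "real (k n) \<le> real (s n ^ 2)" by simp
      then show ?thesis by (simp only: of_nat_le_iff)
    qed
    have k0: "0 < real (k n)" using s3 by simp
    have base: "K ^ 2 \<le> real (s n) ^ 2 / real (k n) * p n"
    proof -
      have "K ^ 2 * real (k n) \<le> K ^ 2 * (real n ^ 3 * p n ^ 3)" using elim K1 by (intro mult_left_mono) auto
      then have "K ^ 2 * real (k n) \<le> real (s n) ^ 2 * p n" using s2p by linarith
      then show ?thesis using k0 by (simp add: field_simps)
    qed
    have choose: "(real (s n) ^ 2 / real (k n)) ^ k n \<le> real (s n ^ 2 choose k n)"
      using binomial_ge_n_over_k_pow_k[OF ks, where 'a = real] by simp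
    have "p n ^ (2 * s n) = exp (- (2 * real (s n) * \<alpha> * ln (real n)))"
    proof -
      have "p n = exp (- \<alpha> * ln (real n))" using elim(2) n by (simp add: powr_def)
      then show ?thesis by (simp add: exp_of_nat_mult[symmetric] mult_ac)
    qed
    then have ps: "exp (- real (k n)) \<le> p n ^ (2 * s n)" using sln by simp
    have "exp (8 * real (k n) / c + real (k n)) = exp (2 * real (k n) * (4 / c + 1)) * exp (- real (k n))"
      by (simp add: exp_add[symmetric] algebra_simps)
    also have "exp (2 * real (k n) * (4 / c + 1)) = (K ^ 2) ^ k n"
    proof -
      have "(K ^ 2) ^ k n = K ^ (2 * k n)" by (simp add: power_mult)
      also have "\<dots> = exp (real (2 * k n) * (4 / c + 1))"
        unfolding K_def by (simp only: exp_of_nat_mult)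
      finally show ?thesis by simp
    qed
    also have "\<dots> * exp (- real (k n)) \<le> (real (s n) ^ 2 / real (k n) * p n) ^ k n * p n ^ (2 * s n)"
      using base ps K1 p by (intro mult_mono power_mono) auto
    also have "\<dots> = (real (s n) ^ 2 / real (k n)) ^ k n * p n ^ (2 * s n + k n)"
      by (simp only: power_mult_distrib power_add mult_ac)
    also have "\<dots> \<le> real (s n ^ 2 choose k n) * p n ^ (2 * s n + k n)"
      using choose p by (intro mult_right_mono) auto
    finally have L: "exp (8 * real (k n) / c + real (k n)) \<le> real (s n ^ 2 choose k n) * p n ^ (2 * s n + k n)" .
    have "exp (8 * (real (n choose 3) * p n ^ 3)) \<le> exp (8 * real (k n) / c)"
    proof -
      have "c * (real (n choose 3) * p n ^ 3) \<le> real (k n)" using elim(3) by (simp add: mu)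
      then show ?thesis using c by (simp add: field_simps)
    qed
    then have "exp (8 * (real (n choose 3) * p n ^ 3)) / (real (s n ^ 2 choose k n) * p n ^ (2 * s n + k n))
        \<le> exp (8 * real (k n) / c) / exp (8 * real (k n) / c + real (k n))"
      using L by (intro frac_le) auto
    also have "\<dots> = exp (- real (k n))" by (simp add: exp_diff[symmetric])
    finally have "exp (8 * (real (n choose 3) * p n ^ 3)) / (real (s n ^ 2 choose k n) * p n ^ (2 * s n + k n))
        \<le> exp (- real (k n))" .
    moreover have "1 - exp (8 * (real (n choose 3) * p n ^ 3)) / (real (s n ^ 2 choose k n) * p n ^ (2 * s n + k n))
        \<le> tv_dist (nu_tilt_elem (V n) (p n) (k n)) (nu_tilt (V n) (p n) (k n))"
    proof -
      have "3 * k n \<le> n" using elim(9) by simp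
      then show ?thesis
        using tv_elem_ge_by_fans[OF V[of n], of "p n" "k n" "s n"] elim p s3 ks by (simp add: cV)
    qed
    ultimately show ?case by linarith
  qed
  \<comment> \<open>Finally \<open>k \<longlonglongrightarrow> \<infinity>\<close>, so the gain \<open>exp k\<close> is unbounded.\<close>
  have kinf: "filterlim (\<lambda>n. real (k n)) at_top sequentially"
  proof (rule filterlim_at_top_mono)
    show "filterlim (\<lambda>n. c / 27 * real n powr (3 - 3 * \<alpha>)) at_top sequentially"
      using c al by (intro filterlim_tendsto_pos_mult_at_top[OF tendsto_const]
          filterlim_compose[OF _ filterlim_real_sequentially] real_powr_at_top) auto
    show "eventually (\<lambda>n. c / 27 * real n powr (3 - 3 * \<alpha>) \<le> real (k n)) sequentially"
      using p01 pe ck eventually_ge_at_top[of 3]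
    proof eventually_elim
      case (elim n)
      have n: "1 \<le> real n" using elim by simp
      have "real n ^ 3 * p n ^ 3 = real n powr (3 - 3 * \<alpha>)"
      proof -
        have "p n ^ 3 = real n powr (- 3 * \<alpha>)" using elim n by (simp add: powr_power mult.commute)
        then show ?thesis using power_mult_powr[of "real n" 3 "- 3 * \<alpha>"] n by simp
      qed
      moreover have "c / 27 * (real n ^ 3 * p n ^ 3) = c * (real n ^ 3 / 27 * p n ^ 3)" by simp
      moreover have "\<dots> \<le> c * \<mu> n"
        unfolding mu using choose_3_bounds(1)[of n] elim c by (intro mult_left_mono mult_right_mono) auto
      ultimately show ?case using elim by simp
    qed
  qed
  show ?thesis
  proof (rule tendsto_sandwich[OF main])
    show "eventually (\<lambda>n. tv_dist (nu_tilt_elem (V n) (p n) (k n)) (nu_tilt (V n) (p n) (k n)) \<le> 1) sequentially"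
      using p01 k_third
    proof eventually_elim
      case (elim n)
      then show ?case using tv_bounds(4)[OF V[of n], of "p n" "k n"] by (simp add: cV)
    qed
    have "(\<lambda>n. exp (- real (k n))) \<longlonglongrightarrow> 0"
      by (rule filterlim_compose[OF exp_at_bot]) (use kinf in \<open>simp add: filterlim_uminus_at_bot\<close>)
    then show "(\<lambda>n. 1 - exp (- real (k n))) \<longlonglongrightarrow> 1"
      using tendsto_diff[OF tendsto_const, of _ 0 sequentially 1] by simp
  qed simp
qed

end

theorem theorem1p3:
  fixes \<epsilon> :: real and V :: "nat \<Rightarrow> 'a set" and p \<mu> :: "nat \<Rightarrow> real" and k :: "nat \<Rightarrow> nat"
  assumes "\<epsilon> > 0"
    and "\<And>n. finite (V n)" and "\<And>n. card (V n) = n"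
    and "eventually (\<lambda>n. 0 < p n \<and> p n < 1) sequentially"
    and "p \<in> o(\<lambda>n. real n powr (- 2 / 3))"
    and "\<And>n. \<mu> n = real (n choose 3) * p n ^ 3"
    and "eventually (\<lambda>n. real (k n) \<le> (1 - \<epsilon>) * \<mu> n) sequentially"
  shows
    "(p \<in> o(\<lambda>n. real n powr (- 4 / 5)) \<longrightarrow>
        (\<lambda>n. tv_dist (nu_tilt (V n) (p n) (k n)) (nu_unif (V n) (k n))) \<longlonglongrightarrow> 0) \<and>
     ((\<lambda>n. real n powr (- 4 / 5)) \<in> o(p) \<and> p \<in> o(\<lambda>n. real n powr (- 3 / 4)) \<and>
      (\<lambda>n. real (k n)) \<in> \<Theta>(\<mu>) \<longrightarrow>
        (\<lambda>n. tv_dist (nu_tilt (V n) (p n) (k n)) (nu_unif (V n) (k n))) \<longlonglongrightarrow> 1) \<and>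
     (p \<in> o(\<lambda>n. real n powr (- 3 / 4)) \<longrightarrow>
        (\<lambda>n. tv_dist (nu_tilt_elem (V n) (p n) (k n)) (nu_tilt (V n) (p n) (k n))) \<longlonglongrightarrow> 0) \<and>
     (\<forall>\<alpha>. 2 / 3 < \<alpha> \<and> \<alpha> < 3 / 4 \<and> eventually (\<lambda>n. p n = real n powr (- \<alpha>)) sequentially \<and>
      (\<lambda>n. real (k n)) \<in> \<Theta>(\<mu>) \<longrightarrow>
        (\<lambda>n. tv_dist (nu_tilt_elem (V n) (p n) (k n)) (nu_tilt (V n) (p n) (k n))) \<longlonglongrightarrow> 1)"
  by (intro conjI allI impI; (elim conjE)?)
    (rule tilt_close_to_uniform[OF assms] tilt_far_from_uniform[OF assms] elementary_close_to_tilt[OF assms] elementary_far_from_tilt[OF assms]; assumption)+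

end
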